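(* Let $m\ge2$ and $I=[0,1]$. Let $\mathcal{K}_{2m-1}$ denote the reproducing kernel of $\Pi^{2m-1}_0$ regarded as a subspace of $L^2(I)$. Then $\mathcal{K}_{2m-1}$ can be expressed both as $$\mathcal{K}_{2m-1}(r_1,r_2)=\int_I P_{2m-1}\hat{\bar{\mathcal{H}}}(r_1,s)\cdot P_{2m-1}\hat{\bar{\mathcal{H}}}(r_2,s)\,ds,$$ where $P_{2m-1}:L^2(I)\to\Pi^{2m-1}_0$ is the $L^2(I)$-orthogonal projection acting on the second variable of $\hat{\bar{\mathcal{H}}}$, and as $$\mathcal{K}_{2m-1}(r_1,r_2)=\frac{(r_1-r_1^2)(r_2-r_2^2)}{2(2m-1)(2m)(2m+1)}\cdot\frac{P''_{2m}(r_1)P''_{2m-1}(r_2)-P''_{2m-1}(r_1)P''_{2m}(r_2)}{r_1-r_2},\qquad (r_1,r_2)\in I^2,$$ where here $P_k(r)=\frac{1}{k!}\frac{d^k}{dr^k}(r^2-r)^k$ are the Legendre polynomials shifted to $I$ (the quotient being read by continuity when $r_1=r_2$). Moreover, $\Pi^{2m-1}_0$ is also a reproducing kernel Hilbert space with kernel $$\mathcal{K}(r_1,r_2):=\int_I\hat{\bar{\mathcal{H}}}(r_1,s)\,\hat{\bar{\mathcal{H}}}(r_2,s)\,ds,$$ and $\mathcal{K}-\mathcal{K}_{2m-1}$ is a reproducing kernel.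
   Context: $\Pi^{n}_0$ is the space of real polynomials $\phi$ of degree at most $n$ with $\phi(0)=\phi(1)=0$. $L^2(I)$ is with respect to Lebesgue measure. A reproducing kernel on $I$ is the reproducing kernel of some reproducing kernel Hilbert space of functions on $I$ (a Hilbert space of functions with continuous point evaluations); the statement about $\mathcal{K}$ means that $\Pi^{2m-1}_0$, with the Hilbert space structure it receives as the range of the integral operator $\phi\mapsto\int_I\phi(s)\hat{\bar{\mathcal{H}}}(\cdot,s)\,ds$ on $L^2(I)$, is a reproducing kernel Hilbert space whose kernel is $\mathcal{K}$. $M^n\subset\mathbb{R}^n$ is the set of vectors $(\mathbb{E}_{t\sim\mu}[t^i])_{i=1}^n$ as $\mu$ ranges over Borel probability measures on $[0,1]$, and $\mathrm{Vol}$ is $n$-dimensional Lebesgue measure. With $\Delta_N(t):=\prod_{1\le j<k\le N}(t_k-t_j)$, for $t_*\in I$, $t\in I^{m-1}$ define $$\mathcal{J}^c_{ol}(t_*,t):=t_*\prod_{j=1}^{m-1}(t_j-t_* )^2\prod_{j=1}^{m-1}t_j^2\cdot\Delta_{m-1}^4(t),\quad \mathcal{J}^c_{ou}(t_*,t):=(1-t_* )\prod_{j=1}^{m-1}(t_j-t_* )^2\prod_{j=1}^{m-1}(1-t_j)^2\cdot\Delta_{m-1}^4(t),$$ $$\mathcal{H}(t_*,t):=\mathcal{J}^c_{ou}(0,t)-\mathcal{J}^c_{ol}(t_*,t)-\mathcal{J}^c_{ou}(t_*,t),$$ $$\bar{\mathcal{H}}(t_*,s):=\int_{I^{m-2}}\mathcal{H}\bigl(t_*,(s,t_2,\dots,t_{m-1})\bigr)\,dt_2\cdots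 dt_{m-1}\quad(s\in I;\ \text{no integration if } m=2),$$ $$\hat{\bar{\mathcal{H}}}:=\frac{1}{\mathrm{Vol}(M^{2m-1})}\frac{2}{(2m-1)!(m-2)!}\bar{\mathcal{H}} .$$ *)

theory Defs
  imports "HOL-Probability.Probability"
begin

section \<open>Reproducing kernel Hilbert spaces of real functions\<close>

text \<open>
  A function on a set \<open>S\<close> is represented by an element of \<^term>\<open>extensional S\<close>, so that equality of
  such functions is pointwise equality on \<open>S\<close>.  A Hilbert space of functions is a pair of a carrier
  \<open>H\<close> and an inner product \<open>ip\<close>, of which only the values on \<open>H\<close> matter.
\<close>

text \<open>The value off \<open>H\<close> is fixed to 0 because \<^locale>\<open>Metric_space\<close> asks for symmetry and
  nonnegativity on the whole type.\<close>
definition ip_dist :: "'s set \<Rightarrow> ('s \<Rightarrow> real) set \<Rightarrow> (('s \<Rightarrow> real) \<Rightarrow> ('s \<Rightarrow> real) \<Rightarrow> real)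
    \<Rightarrow> ('s \<Rightarrow> real) \<Rightarrow> ('s \<Rightarrow> real) \<Rightarrow> real" where
  "ip_dist S H ip f g =
     (if f \<in> H \<and> g \<in> H then sqrt (ip (\<lambda>x\<in>S. f x - g x) (\<lambda>x\<in>S. f x - g x)) else 0)"

locale rkhs =
  fixes S :: "'s set"
    and H :: "('s \<Rightarrow> real) set"
    and ip :: "('s \<Rightarrow> real) \<Rightarrow> ('s \<Rightarrow> real) \<Rightarrow> real"
  assumes carrier_extensional: "H \<subseteq> extensional S"
    and zero_mem: "(\<lambda>x\<in>S. 0) \<in> H"
    and lincomb_mem: "\<And>a b f g. f \<in> H \<Longrightarrow> g \<in> H \<Longrightarrow> (\<lambda>x\<in>S. a * f x + b * g x) \<in> H"
    and ip_commute: "\<And>f g. f \<in> H \<Longrightarrow> g \<in> H \<Longrightarrow> ip f g = ip g f"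
    and ip_linear: "\<And>a b f g h. f \<in> H \<Longrightarrow> g \<in> H \<Longrightarrow> h \<in> H
                      \<Longrightarrow> ip (\<lambda>x\<in>S. a * f x + b * g x) h = a * ip f h + b * ip g h"
    and ip_pos: "\<And>f. f \<in> H \<Longrightarrow> f \<noteq> (\<lambda>x\<in>S. 0) \<Longrightarrow> ip f f > 0"
    and complete: "Metric_space.mcomplete H (ip_dist S H ip)"
    and eval_continuous: "\<And>x. x \<in> S \<Longrightarrow>
          continuous_map (Metric_space.mtopology H (ip_dist S H ip)) euclideanreal (\<lambda>f. f x)"

text \<open>Only the values of the kernel on \<open>S \<times> S\<close> matter.\<close>
definition rkhs_with_kernel :: "'s set \<Rightarrow> ('s \<Rightarrow> real) set
    \<Rightarrow> (('s \<Rightarrow> real) \<Rightarrow> ('s \<Rightarrow> real) \<Rightarrow> real) \<Rightarrow> ('s \<Rightarrow> 's \<Rightarrow> real) \<Rightarrow> bool" where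
  "rkhs_with_kernel S H ip K \<longleftrightarrow> rkhs S H ip \<and>
     (\<forall>x\<in>S. (\<lambda>y\<in>S. K x y) \<in> H \<and> (\<forall>f\<in>H. ip f (\<lambda>y\<in>S. K x y) = f x))"

definition is_reproducing_kernel :: "'s set \<Rightarrow> ('s \<Rightarrow> 's \<Rightarrow> real) \<Rightarrow> bool" where
  "is_reproducing_kernel S K \<longleftrightarrow> (\<exists>H ip. rkhs_with_kernel S H ip K)"

definition reproducing_kernel :: "('s \<Rightarrow> real) set
    \<Rightarrow> (('s \<Rightarrow> real) \<Rightarrow> ('s \<Rightarrow> real) \<Rightarrow> real) \<Rightarrow> 's \<Rightarrow> 's \<Rightarrow> real" where
  "reproducing_kernel H ip x y = (THE k. k \<in> H \<and> (\<forall>f\<in>H. ip f k = f x)) y"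


section \<open>\<open>L\<^sup>2\<close> of the unit interval and integral operators\<close>

abbreviation II :: "real set" where
  "II \<equiv> {0..1}"

text \<open>Representatives of \<open>L\<^sup>2\<close> classes; no quotient by almost everywhere equality is taken.\<close>
definition L2 :: "(real \<Rightarrow> real) set" where
  "L2 = {f \<in> borel_measurable (lebesgue_on II). integrable (lebesgue_on II) (\<lambda>s. (f s)\<^sup>2)}"

definition L2_inner :: "(real \<Rightarrow> real) \<Rightarrow> (real \<Rightarrow> real) \<Rightarrow> real" where
  "L2_inner f g = (\<integral>s. f s * g s \<partial>lebesgue_on II)"

definition L2_proj :: "(real \<Rightarrow> real) set \<Rightarrow> (real \<Rightarrow> real) \<Rightarrow> real \<Rightarrow> real" where
  "L2_proj V f = (THE g. g \<in> V \<and> (\<forall>h\<in>V. L2_inner (\<lambda>s. f s - g s) h = 0))"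

definition integral_op :: "(real \<Rightarrow> real \<Rightarrow> real) \<Rightarrow> (real \<Rightarrow> real) \<Rightarrow> real \<Rightarrow> real" where
  "integral_op k \<phi> = (\<lambda>r\<in>II. \<integral>s. \<phi> s * k r s \<partial>lebesgue_on II)"

definition ker_perp :: "(real \<Rightarrow> real \<Rightarrow> real) \<Rightarrow> (real \<Rightarrow> real) set" where
  "ker_perp k = {\<phi> \<in> L2. \<forall>\<psi>\<in>L2. integral_op k \<psi> = (\<lambda>r\<in>II. 0) \<longrightarrow> L2_inner \<phi> \<psi> = 0}"

text \<open>
  The inner product on the range of the integral operator \<open>T\<close> with kernel \<open>k\<close> that is transported
  from \<open>L\<^sup>2 / ker T\<close>, i.e. the one making \<open>T\<close> an isometry on the orthogonal complement
  \<^term>\<open>ker_perp k\<close> of its null space.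
\<close>
definition range_inner :: "(real \<Rightarrow> real \<Rightarrow> real) \<Rightarrow> (real \<Rightarrow> real) \<Rightarrow> (real \<Rightarrow> real) \<Rightarrow> real" where
  "range_inner k f g = (THE c. \<exists>\<phi>\<in>ker_perp k. \<exists>\<psi>\<in>ker_perp k.
     integral_op k \<phi> = f \<and> integral_op k \<psi> = g \<and> c = L2_inner \<phi> \<psi>)"


section \<open>Polynomials on the unit interval\<close>

definition Pi0 :: "nat \<Rightarrow> (real \<Rightarrow> real) set" where
  "Pi0 n = {restrict (poly p) II | p :: real poly. degree p \<le> n \<and> poly p 0 = 0 \<and> poly p 1 = 0}"

definition K_Pi0 :: "nat \<Rightarrow> real \<Rightarrow> real \<Rightarrow> real" where
  "K_Pi0 n = reproducing_kernel (Pi0 n) L2_inner"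

text \<open>\<open>[:0, -1, 1:]\<close> is \<open>r\<^sup>2 - r\<close>.\<close>
definition shifted_legendre :: "nat \<Rightarrow> real poly" where
  "shifted_legendre k = smult (1 / fact k) ((pderiv ^^ k) ([:0, -1, 1:] ^ k))"

definition legendre_dd :: "nat \<Rightarrow> real \<Rightarrow> real" where
  "legendre_dd k r = poly (pderiv (pderiv (shifted_legendre k))) r"


section \<open>Moment spaces and the kernel \<open>H\<close>\<close>

text \<open>Vectors indexed by a finite set \<open>A\<close> of natural numbers are elements of \<open>A \<rightarrow>\<^sub>E UNIV\<close>, with
  Lebesgue measure \<^term>\<open>PiM A (\<lambda>_. lborel)\<close>.\<close>

definition moment_space :: "nat \<Rightarrow> (nat \<Rightarrow> real) set" where
  "moment_space n = {(\<lambda>i\<in>{1..n}. \<integral>t. t ^ i \<partial>\<mu>) | \<mu> :: real measure.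
     prob_space \<mu> \<and> sets \<mu> = sets (restrict_space borel II)}"

definition Vol_moment_space :: "nat \<Rightarrow> real" where
  "Vol_moment_space n = measure (Pi\<^sub>M {1..n} (\<lambda>_. lborel)) (moment_space n)"

definition Vdm :: "nat \<Rightarrow> (nat \<Rightarrow> real) \<Rightarrow> real" where
  "Vdm N t = (\<Prod>k\<in>{1..N}. \<Prod>j\<in>{1..<k}. t k - t j)"

definition J_ol :: "nat \<Rightarrow> real \<Rightarrow> (nat \<Rightarrow> real) \<Rightarrow> real" where
  "J_ol m r t = r * (\<Prod>j\<in>{1..m-1}. (t j - r)\<^sup>2) * (\<Prod>j\<in>{1..m-1}. (t j)\<^sup>2) * Vdm (m-1) t ^ 4"

definition J_ou :: "nat \<Rightarrow> real \<Rightarrow> (nat \<Rightarrow> real) \<Rightarrow> real" where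
  "J_ou m r t =
     (1 - r) * (\<Prod>j\<in>{1..m-1}. (t j - r)\<^sup>2) * (\<Prod>j\<in>{1..m-1}. (1 - t j)\<^sup>2) * Vdm (m-1) t ^ 4"

definition Hker :: "nat \<Rightarrow> real \<Rightarrow> (nat \<Rightarrow> real) \<Rightarrow> real" where
  "Hker m r t = J_ou m 0 t - J_ol m r t - J_ou m r t"

text \<open>For \<open>m = 2\<close> the index set \<open>{2..m-1}\<close> is empty, and the integral is evaluation at the only
  point of the empty product.\<close>
definition Hbar :: "nat \<Rightarrow> real \<Rightarrow> real \<Rightarrow> real" where
  "Hbar m r s = (LINT t : ({2..m-1} \<rightarrow>\<^sub>E II) | Pi\<^sub>M {2..m-1} (\<lambda>_. lborel). Hker m r (t(1 := s)))"

definition Hhat :: "nat \<Rightarrow> real \<Rightarrow> real \<Rightarrow> real" where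
  "Hhat m r s =
     1 / Vol_moment_space (2*m-1) * (2 / (fact (2*m-1) * fact (m-2))) * Hbar m r s"

definition K_Hhat :: "nat \<Rightarrow> real \<Rightarrow> real \<Rightarrow> real" where
  "K_Hhat m r1 r2 = (\<integral>s. Hhat m r1 s * Hhat m r2 s \<partial>lebesgue_on II)"

end

theory Submission
  imports Defs "HOL-Computational_Algebra.Fundamental_Theorem_Algebra"
begin

text \<open>
  Write \<open>N = m - 1\<close> and let \<open>W\<close> be the value of \<open>J_ou\<close> at \<open>t\<^sub>* = 0\<close>.  Hermite interpolation at the
  simple nodes \<open>0\<close>, \<open>1\<close> and the double nodes \<open>t\<^sub>1, \<dots>, t\<^sub>N\<close>, evaluated at \<open>r\<close> and multiplied by \<open>W\<close>,
  reads \<open>f r W = f 0 J_ou r + f 1 J_ol r + \<Sum>j. (f' (t\<^sub>j) g\<^sub>j - f (t\<^sub>j) \<partial>\<^sub>j g\<^sub>j)\<close> for \<open>f\<close> of degree at most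
  \<open>2m - 1\<close>, where the polynomials \<open>g\<^sub>j\<close> vanish for \<open>t\<^sub>j \<in> {0, 1}\<close>.  For \<open>f = 1\<close> this says that \<open>Hker\<close>
  is the divergence \<open>- \<Sum>j. \<partial>\<^sub>j g\<^sub>j\<close>; for \<open>f = \<phi>\<close> vanishing at \<open>0\<close> and \<open>1\<close>, integration by parts then
  gives \<open>2 N \<integral> \<phi> (t\<^sub>1) Hker = \<phi> r \<integral> W\<close>.  Once the constant is known, this says that \<open>Hhat\<close>
  reproduces \<open>Pi0 (2m - 1)\<close>: the projection of \<open>Hhat r\<close> is the section of the reproducing kernel
  at \<open>r\<close>, and the statements on kernels follow from the description of the range of an integral
  operator with a polynomial kernel.

  The constant requires \<open>\<integral> W = (2m - 1)! (m - 1)! Vol\<close>.  The left side is a Selberg integral; the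
  same interpolation formula, now applied to Legendre polynomials and to subsets of the nodes \<open>0\<close>, \<open>1\<close>,
  gives a recursion in \<open>N\<close> for it.  The volume is computed fibre by fibre: the range of the \<open>n\<close>-th
  moment given the previous ones is an interval of length \<open>l\<^sub>n\<close>, and if the \<open>n\<close>-th moment divides it into
  pieces \<open>u\<close> and \<open>v\<close>, then the next range has length \<open>u v / (u + v)\<close>.
\<close>

section \<open>Integrals of polynomials and Legendre polynomials\<close>

text \<open>Two obstacles shape the proof. First, the moment space is given by arbitrary measures,
  whereas the fibrewise volume needs an explicit region, namely \<open>canonical\<close>: all gaps
  positive. That its points come from measures is Gauss quadrature at the zeros of
  \<open>lower_poly\<close>; convexity and compactness then show that n + 1 atoms yield the whole
  moment space, which makes it measurable, and its points outside the region form a null set.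
  Second, interpolation has denominators t_i - t_j; the weight clears them, and at coincident nodes
  every term vanishes. In the Selberg recursion the interpolated function is f = P_n + 1. In the
  integral of f' g - f g', orthogonality removes P_n against g', and P_n(1) = 1, P_n(0) = (-1)^n
  leave (1 - (-1)^n) g(0): zero for even n, and zero for odd n if 0 is among the simple nodes. Hence
  the alternation of even and odd degrees. Volume and Selberg integral meet in a single identity,
  \<open>beta_int_choose\<close>, relating Beta values to the leading coefficients of Legendre
  polynomials. The same identity produces the constant of the Christoffel-Darboux formula.\<close>

definition pint :: "real poly \<Rightarrow> real" where
  "pint p = (LBINT s:II. poly p s)"

lemma poly_borel_measurable [measurable]: "poly (p::real poly) \<in> borel_measurable borel"
  by (rule borel_measurable_continuous_onI) (intro continuous_intros)

lemma set_integrable_poly: "set_integrable lborel II (poly (p::real poly))"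
  by (rule borel_integrable_atLeastAtMost') (intro continuous_intros)

lemma pint_add: "pint (p + q) = pint p + pint q"
proof -
  have "poly (p + q) = (\<lambda>s. poly p s + poly q s)" by auto
  then show ?thesis unfolding pint_def by (simp add: set_integrable_poly)
qed

lemma pint_smult: "pint (smult c p) = c * pint p"
proof -
  have "poly (smult c p) = (\<lambda>s. c * poly p s)" by auto
  then show ?thesis unfolding pint_def by simp
qed

lemma pint_0 [simp]: "pint 0 = 0"
  unfolding pint_def by (simp add: set_lebesgue_integral_def)

lemma pint_uminus: "pint (- p) = - pint p"
  using pint_smult[of "-1" p] by simp

lemma pint_diff: "pint (p - q) = pint p - pint q"
  using pint_add[of p "- q"] by (simp add: pint_uminus)

lemma pint_sum: "pint (\<Sum>i\<in>A. f i) = (\<Sum>i\<in>A. pint (f i))"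
  by (induction A rule: infinite_finite_induct) (auto simp: pint_add)

lemma pint_pderiv: "pint (pderiv p) = poly p 1 - poly p 0"
proof -
  have "(\<integral>x. indicator II x *\<^sub>R poly (pderiv p) x \<partial>lborel) = poly p 1 - poly p 0"
    by (rule integral_FTC_Icc)
      (auto intro!: continuous_intros has_field_derivative_at_within[OF poly_DERIV]
        simp: has_real_derivative_iff_has_vector_derivative[symmetric])
  then show ?thesis by (simp add: pint_def set_lebesgue_integral_def)
qed

lemma pint_parts: "pint (pderiv p * q) = poly p 1 * poly q 1 - poly p 0 * poly q 0 - pint (p * pderiv q)"
proof -
  have "pint (pderiv (p * q)) = poly p 1 * poly q 1 - poly p 0 * poly q 0"
    by (simp add: pint_pderiv)
  then show ?thesis by (simp add: pderiv_mult pint_add algebra_simps)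
qed

lemma pint_lebesgue_on: "(\<integral>s. poly p s \<partial>lebesgue_on II) = pint p"
proof -
  have "(\<integral>s. poly p s \<partial>lebesgue_on II) = (\<integral>s. indicator II s *\<^sub>R poly p s \<partial>lebesgue)"
    by (rule integral_restrict_space) simp
  also have "\<dots> = (\<integral>s. indicator II s *\<^sub>R poly p s \<partial>lborel)"
    by (rule integral_completion) simp
  finally show ?thesis by (simp add: pint_def set_lebesgue_integral_def)
qed

lemma pint_square_nonneg: "pint (p * p) \<ge> 0"
  unfolding pint_def set_lebesgue_integral_def by (rule integral_nonneg_AE) auto

text \<open>A continuous nonnegative function with integral 0 vanishes on the interval, and a
  polynomial with infinitely many zeros is 0. So \<open>pint (p * q)\<close> is a definite inner
  product on polynomials.\<close>

lemma pint_square_eq_0_iff: "pint (p * p) = 0 \<longleftrightarrow> p = 0"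
proof
  assume 0: "pint (p * p) = 0"
  have "(poly (p * p) has_integral pint (p * p)) II"
    unfolding pint_def
    by (metis has_integral_set_lebesgue set_borel_integral_eq_integral(2) set_integrable_poly
        has_integral_integral integrable_on_def set_borel_integral_eq_integral(1))
  then have "(poly (p * p) has_integral 0) (cbox 0 1)" using 0 by simp
  then have "poly p x = 0" if "x \<in> cbox 0 1" for x
    using has_integral_0_cbox_imp_0[of 0 1 "poly (p * p)" x] that
    by (fastforce intro: continuous_on_poly continuous_on_id)
  then have "II \<subseteq> {x. poly p x = 0}" by auto
  moreover have "infinite II" by (simp add: infinite_Icc)
  ultimately show "p = 0" using poly_roots_finite finite_subset by blast
qed auto

lemma pint_square_pos: "p \<noteq> 0 \<Longrightarrow> pint (p * p) > 0"
  using pint_square_nonneg[of p] pint_square_eq_0_iff[of p] by linarith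

section \<open>Beta integrals, the Rodrigues formula and shifted Legendre polynomials\<close>

lemma pint_Beta: "pint ([:0, 1:] ^ a * [:1, -1:] ^ b) = fact a * fact b / fact (a + b + 1)"
proof (induction b arbitrary: a)
  case 0
  have "pint (pderiv ([:0, 1:] ^ Suc a)) = 1" by (subst pint_pderiv) simp
  also have "pderiv ([:0, 1:] ^ Suc a) = smult (real (Suc a)) ([:0, 1::real:] ^ a)"
    by (subst pderiv_power_Suc) (simp add: pderiv_pCons one_pCons)
  finally have "real (Suc a) * pint ([:0, 1:] ^ a) = 1" by (simp only: pint_smult)
  then have "pint ([:0, 1:] ^ a) = 1 / real (Suc a)" by (simp add: field_simps)
  then show ?case by simp
next
  case (Suc b)
  have "pint (pderiv ([:0, 1:] ^ Suc a * [:1, -1:] ^ Suc b)) = 0" by (subst pint_pderiv) simp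
  also have "pderiv ([:0, 1:] ^ Suc a * [:1, -1:] ^ Suc b)
     = smult (real (Suc a)) ([:0, 1::real:] ^ a * [:1, -1:] ^ Suc b)
       - smult (real (Suc b)) ([:0, 1:] ^ Suc a * [:1, -1:] ^ b)"
    unfolding pderiv_mult pderiv_power_Suc pderiv_pCons
    by (rule poly_ext) (simp add: algebra_simps)
  finally have "real (Suc a) * pint ([:0, 1:] ^ a * [:1, -1:] ^ Suc b)
      = real (Suc b) * pint ([:0, 1:] ^ Suc a * [:1, -1:] ^ b)"
    by (simp only: pint_diff pint_smult right_minus_eq)
  also have "\<dots> = real (Suc b) * (fact (Suc a) * fact b / fact (Suc a + b + 1))"
    by (simp only: Suc.IH)
  also have "\<dots> = real (Suc a) * (fact a * fact (Suc b) / fact (a + Suc b + 1))"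
    by (simp add: field_simps)
  finally show ?case
    by (metis mult_left_cancel of_nat_eq_0_iff nat.distinct(1))
qed

text \<open>Each derivative lowers the order of the zeros at 0 and 1 by at most one. Thus
  derivatives of order below k vanish at both ends, and repeated integration by parts has no
  boundary terms.\<close>

lemma pderiv_funpow_vanish: "[:0, -1, 1::real:] ^ (k - j) dvd (pderiv ^^ j) ([:0, -1, 1:] ^ k)"
proof (induction j)
  case (Suc j)
  show ?case
  proof (cases "j < k")
    case True
    then obtain i where i: "k - j = Suc i" "k - Suc j = i" by (metis Suc_diff_Suc)
    with Suc obtain h where h: "(pderiv ^^ j) ([:0, -1, 1:] ^ k) = [:0, -1, 1::real:] ^ Suc i * h"
      by (metis dvdE)
    have "(pderiv ^^ Suc j) ([:0, -1, 1:] ^ k) = pderiv ([:0, -1, 1::real:] ^ Suc i * h)"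
      using h by simp
    also have "[:0, -1, 1::real:] ^ i dvd \<dots>"
      unfolding pderiv_mult pderiv_power_Suc by (intro dvd_add dvd_smult dvd_mult2 dvd_refl dvd_mult dvd_power_le) auto
    finally show ?thesis using i by simp
  qed auto
qed auto

lemma pint_Rodrigues:
  "j \<le> k \<Longrightarrow> pint ((pderiv ^^ j) ([:0, -1, 1:] ^ k) * q) = (-1) ^ j * pint ([:0, -1, 1:] ^ k * (pderiv ^^ j) q)"
proof (induction j arbitrary: q)
  case (Suc j)
  have "[:0, -1, 1::real:] dvd [:0, -1, 1::real:] ^ (k - j)"
    using Suc.prems by (simp add: dvd_power)
  then have "[:0, -1, 1::real:] dvd (pderiv ^^ j) ([:0, -1, 1:] ^ k)"
    using pderiv_funpow_vanish dvd_trans by blast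
  then obtain h where h: "(pderiv ^^ j) ([:0, -1, 1:] ^ k) = [:0, -1, 1::real:] * h" by (rule dvdE)
  have v: "poly ((pderiv ^^ j) ([:0, -1, 1:] ^ k)) (0::real) = 0" "poly ((pderiv ^^ j) ([:0, -1, 1:] ^ k)) (1::real) = 0"
    unfolding h poly_mult by simp_all
  have "pint ((pderiv ^^ Suc j) ([:0, -1, 1:] ^ k) * q)
      = - pint ((pderiv ^^ j) ([:0, -1, 1:] ^ k) * pderiv q)"
    using v by (simp add: pint_parts)
  also have "\<dots> = (-1) ^ Suc j * pint ([:0, -1, 1:] ^ k * (pderiv ^^ j) (pderiv q))"
    using Suc by simp
  finally show ?case by (simp add: funpow_swap1)
qed auto

lemma coeff_r_power: "degree ([:0, -1, 1::real:] ^ k) = 2 * k" "coeff ([:0, -1, 1::real:] ^ k) (2 * k) = 1"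
proof -
  show d: "degree ([:0, -1, 1::real:] ^ k) = 2 * k" by (simp add: degree_power_eq)
  show "coeff ([:0, -1, 1::real:] ^ k) (2 * k) = 1"
    using lead_coeff_power[of "[:0, -1, 1::real:]" k] d by simp
qed

lemma degree_funpow_pderiv: "degree ((pderiv ^^ j) (p::real poly)) = degree p - j"
  by (induction j) (auto simp: degree_pderiv)

lemma funpow_pderiv_eq_const:
  assumes "degree (p::real poly) \<le> n" shows "(pderiv ^^ n) p = [:fact n * coeff p n:]"
proof (rule poly_eqI)
  fix i show "coeff ((pderiv ^^ n) p) i = coeff [:fact n * coeff p n:] i"
    using assms by (cases i) (auto simp: coeff_higher_pderiv coeff_eq_0 pochhammer_fact)
qed

lemma degree_shifted_legendre_le: "degree (shifted_legendre n) \<le> n"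
  unfolding shifted_legendre_def
  by (rule order.trans[OF degree_smult_le]) (simp add: degree_funpow_pderiv coeff_r_power)

lemma coeff_shifted_legendre: "coeff (shifted_legendre n) n = real ((2 * n) choose n)"
proof -
  have "real ((2 * n) choose n) = fact (2 * n) / (fact n * fact n)"
    using binomial_fact[of n "2*n", where 'a = real] by simp
  moreover have "fact (n + n) = fact n * pochhammer (1 + real n) n"
    using pochhammer_product'[of 1 n n] by (metis pochhammer_fact of_nat_fact)
  ultimately show ?thesis
    unfolding shifted_legendre_def
    by (simp add: coeff_higher_pderiv mult_2[symmetric] coeff_r_power)
qed

text \<open>After n integrations by parts only the constant n! times \<open>coeff q n\<close> is
  left against (r^2 - r)^n, whose integral is a Beta value. The case of degree exactly n is the
  source of the constants in the Christoffel-Darboux part.\<close>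

lemma pint_shifted_legendre:
  assumes "degree q \<le> n"
  shows "pint (shifted_legendre n * q) = coeff q n * (fact n * fact n / fact (2 * n + 1))"
proof -
  have r: "[:0, -1, 1::real:] ^ n = smult ((-1) ^ n) ([:0, 1:] ^ n * [:1, -1:] ^ n)"
    unfolding smult_power[symmetric] power_mult_distrib[symmetric] by simp
  have "pint (shifted_legendre n * q) = (1 / fact n) * pint ((pderiv ^^ n) ([:0, -1, 1:] ^ n) * q)"
    unfolding shifted_legendre_def by (simp add: pint_smult)
  also have "\<dots> = (1 / fact n) * ((-1) ^ n * pint ([:0, -1, 1:] ^ n * [:fact n * coeff q n:]))"
    by (simp only: pint_Rodrigues[OF order.refl] funpow_pderiv_eq_const[OF assms])
  also have "pint ([:0, -1, 1:] ^ n * [:fact n * coeff q n:])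
      = fact n * coeff q n * ((-1) ^ n * (fact n * fact n / fact (2 * n + 1)))"
  proof -
    have "[:0, -1, 1:] ^ n * [:fact n * coeff q n:]
        = smult (fact n * coeff q n * (-1) ^ n) ([:0, 1::real:] ^ n * [:1, -1:] ^ n)"
      unfolding r by (rule poly_ext) (simp add: mult_ac)
    moreover have "n + n + 1 = 2 * n + 1" by simp
    ultimately show ?thesis using pint_Beta[of n n] by (simp only: pint_smult mult.assoc)
  qed
  finally have "pint (shifted_legendre n * q) = 1 / fact n * ((-1) ^ n * (fact n * coeff q n *
      ((-1) ^ n * (fact n * fact n / fact (2 * n + 1)))))" .
  also have "\<dots> = ((-1) ^ n * (-1) ^ n) * (fact n / fact n) * (coeff q n * (fact n * fact n / fact (2 * n + 1)))"
    by (simp only: times_divide_eq_left times_divide_eq_right mult_ac mult_1)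
  also have "\<dots> = coeff q n * (fact n * fact n / fact (2 * n + 1))"
    unfolding power_mult_distrib[symmetric] by simp
  finally show ?thesis .
qed

lemma pint_shifted_legendre_eq_0: "degree q < n \<Longrightarrow> pint (shifted_legendre n * q) = 0"
  by (simp add: pint_shifted_legendre coeff_eq_0)

text \<open>In the Leibniz rule only the term in which all k derivatives fall on (x - a)^k survives
  at a. Applied to the Rodrigues formula it gives the end point values of the Legendre
  polynomials.\<close>

lemma poly_funpow_pderiv_linear_power:
  "poly ((pderiv ^^ k) ([:- a, 1:] ^ k * q)) a = fact k * poly q (a::real)"
proof (induction k arbitrary: q)
  case (Suc k)
  have "pderiv ([:- a, 1:] ^ Suc k * q) = [:- a, 1:] ^ k * (smult (of_nat (Suc k)) q + [:- a, 1:] * pderiv q)"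
    unfolding pderiv_mult pderiv_power_Suc pderiv_pCons by (rule poly_ext) (simp add: algebra_simps)
  then have "(pderiv ^^ Suc k) ([:- a, 1:] ^ Suc k * q)
     = (pderiv ^^ k) ([:- a, 1:] ^ k * (smult (of_nat (Suc k)) q + [:- a, 1:] * pderiv q))"
    by (simp only: funpow_Suc_right o_apply)
  then show ?case by (simp only: Suc.IH) (simp add: algebra_simps)
qed auto

lemma shifted_legendre_at_0: "poly (shifted_legendre n) 0 = (-1) ^ n"
proof -
  have "[:0, -1, 1::real:] ^ n = [:- 0, 1:] ^ n * [:-1, 1:] ^ n"
    unfolding power_mult_distrib[symmetric] by simp
  then have "poly ((pderiv ^^ n) ([:0, -1, 1:] ^ n)) 0 = fact n * poly ([:-1, 1:] ^ n) (0::real)"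
    by (simp only: poly_funpow_pderiv_linear_power)
  then show ?thesis by (simp add: shifted_legendre_def)
qed

lemma shifted_legendre_at_1: "poly (shifted_legendre n) 1 = 1"
proof -
  have "[:0, -1, 1::real:] ^ n = [:- 1, 1:] ^ n * [:0, 1:] ^ n"
    unfolding power_mult_distrib[symmetric] by simp
  then have "poly ((pderiv ^^ n) ([:0, -1, 1:] ^ n)) 1 = fact n * poly ([:0, 1:] ^ n) (1::real)"
    by (simp only: poly_funpow_pderiv_linear_power)
  then show ?thesis by (simp add: shifted_legendre_def)
qed

section \<open>The volume of the moment space\<close>

text \<open>The substitution \<open>t = z\<^sup>2\<close> makes the moments \<open>x\<close> (with \<open>x 0\<close> read as 1) the even moments of a
  symmetric measure on \<open>[-1, 1]\<close>.  This removes the distinction between moments of even and odd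
  order, and a single recursion produces the orthogonal polynomials of the weights 1 and
  \<open>1 - z\<^sup>2\<close>.\<close>
definition moment_fun :: "(nat \<Rightarrow> real) \<Rightarrow> real poly \<Rightarrow> real" where
  "moment_fun x p = (\<Sum>i\<le>degree p. coeff p (2 * i) * (if i = 0 then 1 else x i))"

text \<open>Only even coefficients are read, so a degree up to 2 N + 1 involves no moment beyond
  \<open>x N\<close>. A summation limit independent of p makes linearity visible.\<close>

lemma moment_fun_eq:
  assumes "degree p \<le> 2 * N + 1"
  shows "moment_fun x p = (\<Sum>i\<le>N. coeff p (2 * i) * (if i = 0 then 1 else x i))"
proof -
  define f where "f i = coeff p (2 * i) * (if i = 0 then 1 else x i)" for i
  have 0: "f i = 0" if "degree p < 2 * i" for i using that by (simp add: f_def coeff_eq_0)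
  have "sum f {..degree p} = sum f {..max N (degree p)}"
    by (rule sum.mono_neutral_left) (auto intro!: 0)
  also have "\<dots> = sum f {..N}"
    by (rule sum.mono_neutral_right) (use assms in \<open>auto intro!: 0\<close>)
  finally show ?thesis by (simp add: moment_fun_def f_def)
qed

lemma moment_fun_add: "moment_fun x (p + q) = moment_fun x p + moment_fun x q"
proof -
  define N where "N = max (degree p) (degree q)"
  have "degree p \<le> 2 * N + 1" "degree q \<le> 2 * N + 1" by (auto simp: N_def)
  moreover have "degree (p + q) \<le> 2 * N + 1"
    using degree_add_le_max[of p q] by (auto simp: N_def)
  ultimately show ?thesis
    by (simp only: moment_fun_eq[where N = N] coeff_add distrib_right sum.distrib)
qed

lemma moment_fun_smult: "moment_fun x (smult c p) = c * moment_fun x p"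
  by (subst (1 2) moment_fun_eq[where N = "degree p"])
    (auto intro: order.trans[OF degree_smult_le] simp: sum_distrib_left algebra_simps)

lemma moment_fun_0 [simp]: "moment_fun x 0 = 0"
  by (simp add: moment_fun_def)

lemma moment_fun_1 [simp]: "moment_fun x 1 = 1"
  by (simp add: moment_fun_def)

lemma moment_fun_const [simp]: "moment_fun x [:c:] = c"
  by (simp add: moment_fun_def)

lemma moment_fun_diff: "moment_fun x (p - q) = moment_fun x p - moment_fun x q"
  using moment_fun_add[of x "p - q" q] by simp

lemma moment_fun_uminus: "moment_fun x (- q) = - moment_fun x q"
  using moment_fun_diff[of x 0 q] by simp

lemma moment_fun_sum: "moment_fun x (\<Sum>i\<in>A. f i) = (\<Sum>i\<in>A. moment_fun x (f i))"
  by (induction A rule: infinite_finite_induct) (auto simp: moment_fun_add)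

lemma moment_fun_cong:
  assumes "degree p \<le> 2 * n + 1" "\<And>i. 1 \<le> i \<Longrightarrow> i \<le> n \<Longrightarrow> x i = y i"
  shows "moment_fun x p = moment_fun y p"
  unfolding moment_fun_eq[OF assms(1)] using assms(2) by (intro sum.cong) auto

lemma moment_fun_upd:
  assumes "degree p \<le> 2 * Suc n + 1"
  shows "moment_fun (x(Suc n := y)) p = coeff p (2 * Suc n) * y + moment_fun (x(Suc n := 0)) p"
proof -
  have "(\<Sum>i\<le>n. coeff p (2 * i) * (if i = 0 then 1 else (x(Suc n := y)) i)) =
    (\<Sum>i\<le>n. coeff p (2 * i) * (if i = 0 then 1 else (x(Suc n := 0)) i))"
    by (rule sum.cong) auto
  then show ?thesis unfolding moment_fun_eq[OF assms] by simp
qed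

lemma moment_fun_convex:
  "moment_fun (\<lambda>i. (1 - a) * x i + a * y i) p = (1 - a) * moment_fun x p + a * moment_fun y p"
proof -
  have "(\<Sum>i\<le>degree p. coeff p (2 * i) * (if i = 0 then 1 else (1 - a) * x i + a * y i)) =
    (\<Sum>i\<le>degree p. (1 - a) * (coeff p (2 * i) * (if i = 0 then 1 else x i)) +
      a * (coeff p (2 * i) * (if i = 0 then 1 else y i)))"
    by (rule sum.cong) (auto simp: algebra_simps)
  then show ?thesis by (simp add: moment_fun_def sum.distrib sum_distrib_left)
qed

section \<open>Parity, and the orthogonal polynomials of the weights 1 and 1 - z^2\<close>

definition parity_poly :: "nat \<Rightarrow> real poly \<Rightarrow> bool" where
  "parity_poly n p \<longleftrightarrow> (\<forall>i. odd (i + n) \<longrightarrow> coeff p i = 0)"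

lemma parity_poly_mult:
  assumes "parity_poly n p" "parity_poly m q" shows "parity_poly (n + m) (p * q)"
  unfolding parity_poly_def
proof (intro allI impI)
  fix i assume i: "odd (i + (n + m))"
  have "coeff p j * coeff q (i - j) = 0" if "j \<le> i" for j
  proof (cases "odd (j + n)")
    case True then show ?thesis using assms by (simp add: parity_poly_def)
  next
    case False
    then have "odd (i - j + m)" using i that by presburger
    then show ?thesis using assms by (simp add: parity_poly_def)
  qed
  then show "coeff (p * q) i = 0" unfolding coeff_mult by (intro sum.neutral) auto
qed

lemma parity_poly_add: "parity_poly n p \<Longrightarrow> parity_poly n q \<Longrightarrow> parity_poly n (p + q)"
  by (simp add: parity_poly_def)

lemma parity_poly_diff: "parity_poly n p \<Longrightarrow> parity_poly n q \<Longrightarrow> parity_poly n (p - q)"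
  by (simp add: parity_poly_def)

lemma parity_poly_smult: "parity_poly n p \<Longrightarrow> parity_poly n (smult c p)"
  by (simp add: parity_poly_def)

lemma parity_poly_Suc_Suc: "parity_poly (Suc (Suc n)) p \<longleftrightarrow> parity_poly n p"
  by (simp add: parity_poly_def)

definition w_poly :: "real poly" where "w_poly = [:1, 0, -1:]"
definition z_poly :: "real poly" where "z_poly = [:0, 1:]"

lemma poly_ww [simp]: "poly w_poly x = 1 - x * x" and poly_zz [simp]: "poly z_poly x = x"
  by (simp_all add: w_poly_def z_poly_def)

lemma coeff_zz_mult [simp]: "coeff (z_poly * p) (Suc k) = coeff p k" "coeff (z_poly * p) 0 = 0"
  by (simp_all add: z_poly_def)

lemma coeff_ww_mult: "coeff (w_poly * p) (Suc (Suc k)) = coeff p (Suc (Suc k)) - coeff p k"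
    "coeff (w_poly * p) (Suc 0) = coeff p (Suc 0)"
  by (simp_all add: w_poly_def coeff_pCons)

lemma parity_poly_X: "parity_poly (Suc 0) z_poly"
  by (auto simp: z_poly_def parity_poly_def coeff_pCons split: nat.splits)

lemma parity_poly_w: "parity_poly 0 w_poly"
  by (auto simp: w_poly_def parity_poly_def coeff_pCons split: nat.splits)

lemma parity_poly_monom: "parity_poly n (monom c n)"
  by (auto simp: parity_poly_def)

text \<open>The functional belongs to a symmetric measure. In the orthogonality induction this
  disposes of the one monomial that the cancellation in the recursion does not reach.\<close>

lemma moment_fun_odd: "odd n \<Longrightarrow> parity_poly n p \<Longrightarrow> moment_fun x p = 0"
  by (simp add: moment_fun_def parity_poly_def)

text \<open>Index shift: the polynomials with index \<open>n\<close> depend on \<open>x 1, \<dots>, x n\<close> only, and their norms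
  \<open>lower_gap\<close> and \<open>upper_gap\<close> are the distances of \<open>x (n + 1)\<close> from the ends of its range.\<close>
fun canonical_polys :: "(nat \<Rightarrow> real) \<Rightarrow> nat \<Rightarrow> real poly \<times> real poly" where
  "canonical_polys x 0 = (z_poly, 1)"
| "canonical_polys x (Suc n) = (let A = fst (canonical_polys x n); B = snd (canonical_polys x n); u = moment_fun x (A * A); v = moment_fun x (w_poly * B * B) in
     (smult (1 / (u + v)) (smult v (z_poly * A) - smult u (w_poly * B)),
      smult (1 / (u + v)) (smult v A + smult u (z_poly * B))))"

definition lower_poly where "lower_poly x n = fst (canonical_polys x n)"
definition upper_poly where "upper_poly x n = snd (canonical_polys x n)"
definition lower_gap where "lower_gap x n = moment_fun x (lower_poly x n * lower_poly x n)"
definition upper_gap where "upper_gap x n = moment_fun x (w_poly * upper_poly x n * upper_poly x n)"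
definition mrange where "mrange x n = lower_gap x n + upper_gap x n"

lemma lower_poly_0: "lower_poly x 0 = z_poly" and upper_poly_0: "upper_poly x 0 = 1"
  by (simp_all add: lower_poly_def upper_poly_def)

lemma lower_poly_Suc: "lower_poly x (Suc n) = smult (1 / mrange x n) (smult (upper_gap x n) (z_poly * lower_poly x n) - smult (lower_gap x n) (w_poly * upper_poly x n))"
  and upper_poly_Suc: "upper_poly x (Suc n) = smult (1 / mrange x n) (smult (upper_gap x n) (lower_poly x n) + smult (lower_gap x n) (z_poly * upper_poly x n))"
  by (simp_all add: lower_poly_def upper_poly_def lower_gap_def upper_gap_def mrange_def Let_def)

lemma degree_zz_mult: "degree (z_poly * p) \<le> Suc (degree p)"
  by (rule order.trans[OF degree_mult_le]) (simp add: z_poly_def)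

lemma degree_ww_mult: "degree (w_poly * p) \<le> Suc (Suc (degree p))"
  by (rule order.trans[OF degree_mult_le]) (simp add: w_poly_def)

lemma degree_AB: "degree (lower_poly x n) \<le> Suc n \<and> degree (upper_poly x n) \<le> n"
proof (induction n)
  case (Suc n)
  have "degree (lower_poly x (Suc n)) \<le> Suc (Suc n)" unfolding lower_poly_Suc
    using Suc degree_zz_mult[of "lower_poly x n"] degree_ww_mult[of "upper_poly x n"]
    by (intro order.trans[OF degree_smult_le] degree_diff_le) auto
  moreover have "degree (upper_poly x (Suc n)) \<le> Suc n" unfolding upper_poly_Suc
    using Suc degree_zz_mult[of "upper_poly x n"]
    by (intro order.trans[OF degree_smult_le] degree_add_le order.trans[OF degree_smult_le]) auto
  ultimately show ?case by blast
qed (simp add: lower_poly_0 upper_poly_0 z_poly_def)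

lemmas degree_Ap = degree_AB[THEN conjunct1] and degree_Bp = degree_AB[THEN conjunct2]

lemma degree_AA: "degree (lower_poly x n * lower_poly x n) \<le> 2 * Suc n + 1"
  and degree_wBB: "degree (w_poly * upper_poly x n * upper_poly x n) \<le> 2 * Suc n + 1"
proof -
  have "degree (lower_poly x n) + degree (lower_poly x n) \<le> 2 * Suc n + 1" using degree_Ap[of x n] by simp
  then show "degree (lower_poly x n * lower_poly x n) \<le> 2 * Suc n + 1"
    using degree_mult_le order.trans by blast
  have "Suc (Suc (degree (upper_poly x n) + degree (upper_poly x n))) \<le> 2 * Suc n + 1" using degree_Bp[of x n] by simp
  moreover have "degree (w_poly * (upper_poly x n * upper_poly x n)) \<le> Suc (Suc (degree (upper_poly x n) + degree (upper_poly x n)))"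
    by (rule order.trans[OF degree_ww_mult]) (simp only: Suc_le_mono degree_mult_le)
  ultimately show "degree (w_poly * upper_poly x n * upper_poly x n) \<le> 2 * Suc n + 1" by (simp only: mult.assoc)
qed

lemma parity_AB: "parity_poly (Suc n) (lower_poly x n) \<and> parity_poly n (upper_poly x n)"
proof (induction n)
  case 0 show ?case
    using parity_poly_X by (auto simp: lower_poly_0 upper_poly_0 parity_poly_def coeff_1 intro: Nat.gr0I)
next
  case (Suc n)
  have "parity_poly (Suc (Suc n)) (z_poly * lower_poly x n)" "parity_poly (Suc n) (z_poly * upper_poly x n)"
       "parity_poly (Suc (Suc n)) (w_poly * upper_poly x n)"
    using Suc parity_poly_mult[OF parity_poly_X, of "Suc n" "lower_poly x n"] parity_poly_mult[OF parity_poly_X, of n "upper_poly x n"]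
      parity_poly_mult[OF parity_poly_w, of n "upper_poly x n"]
    by (simp_all add: parity_poly_Suc_Suc)
  then show ?case unfolding lower_poly_Suc upper_poly_Suc using Suc
    by (auto intro!: parity_poly_smult parity_poly_add parity_poly_diff)
qed

lemma canonical_polys_cong: "(\<And>i. 1 \<le> i \<Longrightarrow> i \<le> n \<Longrightarrow> x i = y i) \<Longrightarrow> lower_poly x n = lower_poly y n \<and> upper_poly x n = upper_poly y n"
proof (induction n)
  case (Suc n)
  have IH: "lower_poly x n = lower_poly y n" "upper_poly x n = upper_poly y n" using Suc by auto
  note d = degree_AA[of y n] degree_wBB[of y n]
  have "lower_gap x n = lower_gap y n" "upper_gap x n = upper_gap y n"
    unfolding lower_gap_def upper_gap_def IH by (rule moment_fun_cong[OF d(1)] moment_fun_cong[OF d(2)], use Suc.prems in simp)+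
  then show ?case by (simp add: lower_poly_Suc upper_poly_Suc mrange_def IH)
qed (simp add: lower_poly_0 upper_poly_0)

lemma uv_cong:
  assumes "\<And>i. 1 \<le> i \<Longrightarrow> i \<le> Suc n \<Longrightarrow> x i = y i" shows "lower_gap x n = lower_gap y n \<and> upper_gap x n = upper_gap y n"
proof -
  have IH: "lower_poly x n = lower_poly y n" "upper_poly x n = upper_poly y n" using canonical_polys_cong[of n x y] assms by auto
  note d = degree_AA[of y n] degree_wBB[of y n]
  show ?thesis
    unfolding lower_gap_def upper_gap_def IH by (intro conjI) (rule moment_fun_cong[OF d(1)] moment_fun_cong[OF d(2)], use assms in simp)+
qed

text \<open>A positive pair of gaps of index k says that \<open>x (k + 1)\<close> lies strictly
  inside its range given the earlier moments. Up to a null set this region is the moment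
  space.\<close>

definition canonical :: "(nat \<Rightarrow> real) \<Rightarrow> nat \<Rightarrow> bool" where
  "canonical x n \<longleftrightarrow> (\<forall>k<n. lower_gap x k > 0 \<and> upper_gap x k > 0)"

lemma canonical_Suc: "canonical x (Suc n) \<longleftrightarrow> canonical x n \<and> lower_gap x n > 0 \<and> upper_gap x n > 0"
  by (auto simp: canonical_def less_Suc_eq)

lemma canonical_cong:
  assumes "\<And>i. 1 \<le> i \<Longrightarrow> i \<le> n \<Longrightarrow> x i = y i" shows "canonical x n = canonical y n"
proof -
  have "lower_gap x k = lower_gap y k \<and> upper_gap x k = upper_gap y k" if "k < n" for k
    by (rule uv_cong) (use that assms in auto)
  then show ?thesis by (auto simp: canonical_def)
qed

lemma degree_minus_monom:
  assumes "degree (g::real poly) \<le> Suc n" shows "degree (g - monom (coeff g (Suc n)) (Suc n)) \<le> n"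
  by (rule degree_le) (use assms in \<open>auto simp: coeff_eq_0\<close>)

lemma degree_minus_lead:
  assumes "degree (g::real poly) \<le> Suc k" "degree P \<le> Suc k" "coeff P (Suc k) = 1"
  shows "degree (g - smult (coeff g (Suc k)) P) \<le> k"
proof (rule degree_le, intro allI impI)
  fix i assume "k < i"
  then consider "i = Suc k" | "Suc k < i" by linarith
  then show "coeff (g - smult (coeff g (Suc k)) P) i = 0"
    using assms by cases (auto simp: coeff_eq_0)
qed

text \<open>The two relations have to be proved together. In the numerator v z A - u w B of the new
  \<open>A'\<close>, a test polynomial of degree n with leading coefficient c yields v u c - u v c =
  0; in that of \<open>B'\<close> the sign comes from the leading coefficient -1 of
  \<open>w_poly\<close>. The remaining top monomial of the test polynomial is removed by
  parity.\<close>

lemma canonical_orthogonal: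
  assumes "canonical x n"
  shows "coeff (lower_poly x n) (Suc n) = 1 \<and> coeff (upper_poly x n) n = 1 \<and>
    (\<forall>g. degree g \<le> Suc n \<longrightarrow> moment_fun x (lower_poly x n * g) = lower_gap x n * coeff g (Suc n)) \<and>
    (\<forall>g. degree g \<le> n \<longrightarrow> moment_fun x (w_poly * upper_poly x n * g) = upper_gap x n * coeff g n)"
  using assms
proof (induction n)
  case 0
  have A: "moment_fun x (z_poly * g) = moment_fun x (z_poly * z_poly) * coeff g 1" if "degree g \<le> 1" for g
  proof -
    have "g = [:coeff g 0, coeff g 1:]"
      by (rule poly_eqI) (use that in \<open>auto simp: coeff_pCons coeff_eq_0 split: nat.splits\<close>)
    then have "poly g t = coeff g 0 + t * coeff g 1" for t
      by (metis poly_pCons mult_zero_right poly_0 add_0_right)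
    then have "z_poly * g = smult (coeff g 0) z_poly + smult (coeff g 1) (z_poly * z_poly)"
      by (intro poly_ext) (simp add: algebra_simps)
    moreover have "moment_fun x z_poly = 0" by (rule moment_fun_odd[OF _ parity_poly_X]) simp
    ultimately show ?thesis by (simp add: moment_fun_add moment_fun_smult)
  qed
  have B: "moment_fun x (w_poly * 1 * g) = moment_fun x (w_poly * 1 * 1) * coeff g 0" if dg: "degree g \<le> 0" for g
  proof -
    obtain a where a: "g = [:a:]" using dg degree_eq_zeroE[of g] by blast
    then have "w_poly * 1 * g = smult a (w_poly * 1 * 1)" by simp
    then have "moment_fun x (w_poly * 1 * g) = a * moment_fun x (w_poly * 1 * 1)" by (simp only: moment_fun_smult)
    then show ?thesis using a by simp
  qed
  show ?case using A B by (simp add: lower_poly_0 upper_poly_0 lower_gap_def upper_gap_def) (simp add: z_poly_def)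
next
  case (Suc n)
  define A B u v l where defs: "A = lower_poly x n" "B = upper_poly x n" "u = lower_gap x n" "v = upper_gap x n" "l = mrange x n"
  have pos: "u > 0" "v > 0" and l: "l = u + v" using Suc.prems by (auto simp: defs canonical_Suc mrange_def)
  have l0: "l \<noteq> 0" using pos l by simp
  have IH: "coeff A (Suc n) = 1" "coeff B n = 1"
      "\<And>g. degree g \<le> Suc n \<Longrightarrow> moment_fun x (A * g) = u * coeff g (Suc n)"
      "\<And>g. degree g \<le> n \<Longrightarrow> moment_fun x (w_poly * B * g) = v * coeff g n"
    using Suc by (auto simp: canonical_Suc defs)
  have dA: "degree A \<le> Suc n" and dB: "degree B \<le> n" using degree_AB by (auto simp: defs)
  define A' B' where "A' = lower_poly x (Suc n)" "B' = upper_poly x (Suc n)"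
  have A': "A' = smult (1 / l) (smult v (z_poly * A) - smult u (w_poly * B))"
    and B': "B' = smult (1 / l) (smult v A + smult u (z_poly * B))"
    by (simp_all add: A'_B'_def lower_poly_Suc upper_poly_Suc defs)
  have dA': "degree A' \<le> Suc (Suc n)" and dB': "degree B' \<le> Suc n"
    using degree_AB[of x "Suc n"] by (auto simp: A'_B'_def)
  have monicA: "coeff A' (Suc (Suc n)) = 1"
    using IH dB l0 unfolding A' by (simp add: coeff_eq_0 coeff_ww_mult l divide_simps add.commute)
  have monicB: "coeff B' (Suc n) = 1"
    using IH l0 unfolding B' by (simp add: l divide_simps add.commute)
  have oA: "moment_fun x (A' * g) = 0" if g: "degree g \<le> Suc n" for g
  proof -
    define g0 where "g0 = g - monom (coeff g (Suc n)) (Suc n)"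
    have dg0: "degree g0 \<le> n" unfolding g0_def by (rule degree_minus_monom[OF g])
    have "A' * g0 = smult (1 / l) (smult v (A * (z_poly * g0)) - smult u (w_poly * B * g0))"
      unfolding A' by (rule poly_ext) (simp add: algebra_simps)
    also have "moment_fun x \<dots> = (1 / l) * (v * moment_fun x (A * (z_poly * g0)) - u * moment_fun x (w_poly * B * g0))"
      by (simp only: moment_fun_smult moment_fun_diff)
    also have "moment_fun x (A * (z_poly * g0)) = u * coeff (z_poly * g0) (Suc n)"
      by (rule IH(3)) (use dg0 degree_zz_mult[of g0] in simp)
    also have "moment_fun x (w_poly * B * g0) = v * coeff g0 n" by (rule IH(4)[OF dg0])
    finally have 1: "moment_fun x (A' * g0) = 0" by simp
    have "parity_poly (Suc (Suc n) + Suc n) (A' * monom (coeff g (Suc n)) (Suc n))"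
      using parity_AB[of "Suc n" x] by (intro parity_poly_mult parity_poly_monom) (auto simp: A'_B'_def)
    then have 2: "moment_fun x (A' * monom (coeff g (Suc n)) (Suc n)) = 0" by (rule moment_fun_odd[rotated]) simp
    have "A' * g = A' * g0 + A' * monom (coeff g (Suc n)) (Suc n)" by (simp add: g0_def algebra_simps)
    then show ?thesis using 1 2 by (simp add: moment_fun_add)
  qed
  have oB: "moment_fun x (w_poly * B' * g) = 0" if g: "degree g \<le> n" for g
  proof -
    define g0 where "g0 = g - monom (coeff g n) n"
    have 1: "moment_fun x (w_poly * B' * g0) = 0"
    proof (cases n)
      case 0
      then have "g0 = 0" using g unfolding g0_def
        by (metis degree_eq_zeroE diff_self coeff_pCons_0 le_zero_eq monom_0)
      then show ?thesis by simp
    next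
      case (Suc k)
      then have dg0: "degree g0 \<le> k" unfolding g0_def using degree_minus_monom g by blast
      have "w_poly * B' * g0 = smult (1 / l) (smult v (A * (w_poly * g0)) + smult u (w_poly * B * (z_poly * g0)))"
        unfolding B' by (rule poly_ext) (simp add: algebra_simps)
      also have "moment_fun x \<dots> = (1 / l) * (v * moment_fun x (A * (w_poly * g0)) + u * moment_fun x (w_poly * B * (z_poly * g0)))"
        by (simp only: moment_fun_smult moment_fun_add)
      also have "moment_fun x (A * (w_poly * g0)) = u * coeff (w_poly * g0) (Suc n)"
        by (rule IH(3)) (use dg0 degree_ww_mult[of g0] Suc in simp)
      also have "coeff (w_poly * g0) (Suc n) = - coeff g0 k"
        unfolding Suc using dg0 by (cases k) (simp_all add: coeff_eq_0 coeff_ww_mult)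
      also have "moment_fun x (w_poly * B * (z_poly * g0)) = v * coeff (z_poly * g0) n"
        by (rule IH(4)) (use dg0 degree_zz_mult[of g0] Suc in simp)
      also have "coeff (z_poly * g0) n = coeff g0 k" by (simp add: Suc)
      finally show ?thesis by simp
    qed
    have "parity_poly (0 + Suc n + n) (w_poly * B' * monom (coeff g n) n)"
      using parity_AB[of "Suc n" x] by (intro parity_poly_mult parity_poly_monom parity_poly_w) (auto simp: A'_B'_def)
    then have 2: "moment_fun x (w_poly * B' * monom (coeff g n) n) = 0" by (rule moment_fun_odd[rotated]) simp
    have "w_poly * B' * g = w_poly * B' * g0 + w_poly * B' * monom (coeff g n) n" by (simp add: g0_def algebra_simps)
    then show ?thesis using 1 2 by (simp add: moment_fun_add)
  qed
  \<comment> \<open>As \<open>A'\<close> is monic, subtracting a multiple of it from g lowers the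
    degree; what remains is orthogonal, and the multiple contributes the norm of
    \<open>A'\<close>.\<close>
  have "moment_fun x (A' * g) = lower_gap x (Suc n) * coeff g (Suc (Suc n))" if g: "degree g \<le> Suc (Suc n)" for g
  proof -
    have "moment_fun x (A' * (g - smult (coeff g (Suc (Suc n))) A')) = 0"
      by (intro oA degree_minus_lead g dA' monicA)
    then show ?thesis
      by (simp add: right_diff_distrib moment_fun_diff moment_fun_smult lower_gap_def A'_B'_def mult.commute)
  qed
  moreover have "moment_fun x (w_poly * B' * g) = upper_gap x (Suc n) * coeff g (Suc n)" if g: "degree g \<le> Suc n" for g
  proof -
    have "moment_fun x (w_poly * B' * (g - smult (coeff g (Suc n)) B')) = 0"
      by (intro oB degree_minus_lead g dB' monicB)
    then show ?thesis
      by (simp add: right_diff_distrib moment_fun_diff moment_fun_smult upper_gap_def A'_B'_def mult.commute)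
  qed
  ultimately show ?case using monicA monicB by (simp add: A'_B'_def)
qed

text \<open>From z^2 + w = 1 the recursion gives z A' + w B' = (v / l) A. Since A' - z A and B' - A
  have too low a degree to be seen by A' and w B', the sum of the two new norms is the functional of
  A (z A' + w B'), that is, v u / l.\<close>

lemma mrange_Suc:
  assumes "canonical x (Suc n)" shows "mrange x (Suc n) = lower_gap x n * upper_gap x n / mrange x n"
proof -
  have can: "canonical x n" and pos: "lower_gap x n > 0" "upper_gap x n > 0" using assms by (auto simp: canonical_Suc)
  define A B u v l where defs: "A = lower_poly x n" "B = upper_poly x n" "u = lower_gap x n" "v = upper_gap x n" "l = mrange x n"
  define A' B' where "A' = lower_poly x (Suc n)" "B' = upper_poly x (Suc n)"
  have l0: "l \<noteq> 0" using pos by (simp add: defs mrange_def)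
  have A': "A' = smult (1 / l) (smult v (z_poly * A) - smult u (w_poly * B))"
    and B': "B' = smult (1 / l) (smult v A + smult u (z_poly * B))"
    by (simp_all add: A'_B'_def lower_poly_Suc upper_poly_Suc defs)
  have dA: "degree A \<le> Suc n" and dA': "degree A' \<le> Suc (Suc n)" and dB': "degree B' \<le> Suc n"
    using degree_AB[of x "Suc n"] degree_AB[of x n] by (auto simp: A'_B'_def defs)
  have monic: "coeff A (Suc n) = 1" "coeff A' (Suc (Suc n)) = 1" "coeff B' (Suc n) = 1"
    using canonical_orthogonal[OF assms] canonical_orthogonal[OF can] by (auto simp: A'_B'_def defs)
  have A0: "moment_fun x (A' * g) = 0" if "degree g \<le> Suc n" for g
    using canonical_orthogonal[OF assms] that by (simp add: A'_B'_def coeff_eq_0)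
  have B0: "moment_fun x (w_poly * B' * g) = 0" if "degree g \<le> n" for g
    using canonical_orthogonal[OF assms] that by (simp add: A'_B'_def coeff_eq_0)
  have "degree (A' - smult (coeff A' (Suc (Suc n))) (z_poly * A)) \<le> Suc n"
    by (rule degree_minus_lead) (use dA' monic degree_zz_mult[of A] dA in auto)
  then have 1: "moment_fun x (A' * (A' - z_poly * A)) = 0" using monic by (intro A0) simp
  have "degree (B' - smult (coeff B' (Suc n)) A) \<le> n"
    by (rule degree_minus_lead) (use dB' monic dA in auto)
  then have 2: "moment_fun x (w_poly * B' * (B' - A)) = 0" using monic by (intro B0) simp
  have "mrange x (Suc n) = moment_fun x (A' * A' + w_poly * B' * B')"
    by (simp add: mrange_def lower_gap_def upper_gap_def A'_B'_def moment_fun_add)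
  also have "A' * A' + w_poly * B' * B' = A' * (A' - z_poly * A) + w_poly * B' * (B' - A) + smult (v / l) (A * A)"
    unfolding B' A' by (rule poly_ext) (use l0 in \<open>simp add: field_simps power2_eq_square\<close>)
  also have "moment_fun x \<dots> = v / l * u"
    using 1 2 by (simp add: moment_fun_add moment_fun_smult defs lower_gap_def)
  finally show ?thesis by (simp add: defs)
qed

lemma canonical_ll_pos: "canonical x n \<Longrightarrow> mrange x n > 0"
proof (cases n)
  case 0
  have "z_poly * z_poly + w_poly = 1" by (rule poly_ext) simp
  then have "moment_fun x (z_poly * z_poly) + moment_fun x w_poly = 1" by (metis moment_fun_1 moment_fun_add)
  then show ?thesis using 0 by (simp add: mrange_def lower_gap_def upper_gap_def lower_poly_0 upper_poly_0)
next
  case (Suc k)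
  moreover assume "canonical x n"
  ultimately have *: "canonical x (Suc k)" by simp
  then show ?thesis unfolding Suc mrange_Suc[OF *] by (simp add: canonical_Suc mrange_def)
qed

lemma mrange_0: "mrange x 0 = 1"
proof -
  have "z_poly * z_poly + w_poly = 1" by (rule poly_ext) simp
  then have "moment_fun x (z_poly * z_poly) + moment_fun x w_poly = 1" by (metis moment_fun_1 moment_fun_add)
  then show ?thesis by (simp add: mrange_def lower_gap_def upper_gap_def lower_poly_0 upper_poly_0)
qed

text \<open>Split g = c P + h with P the monic \<open>lower_poly\<close> (or
  \<open>upper_poly\<close>) and h of lower degree. The mixed term vanishes by orthogonality, so
  positive gaps give positive definite forms.\<close>

lemma canonical_imp_positive:
  assumes "canonical x n" "g \<noteq> 0"
  shows "(degree g \<le> n \<longrightarrow> moment_fun x (g * g) > 0) \<and> (degree g < n \<longrightarrow> moment_fun x (w_poly * g * g) > 0)"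
  using assms
proof (induction n arbitrary: g)
  case 0
  have "moment_fun x (g * g) > 0" if d: "degree g \<le> 0"
  proof -
    obtain a where a: "g = [:a:]" using d degree_eq_zeroE[of g] by blast
    then have "moment_fun x (g * g) = a * a" by simp
    moreover have "a \<noteq> 0" using a 0 by auto
    ultimately show ?thesis by (simp add: zero_less_mult_iff) linarith
  qed
  then show ?case by simp
next
  case (Suc n)
  then have can: "canonical x n" and pos: "lower_gap x n > 0" "upper_gap x n > 0" by (auto simp: canonical_Suc)
  note orth = canonical_orthogonal[OF can]
  have "moment_fun x (g * g) > 0" if d: "degree g \<le> Suc n"
  proof -
    define c where "c = coeff g (Suc n)"
    define h where "h = g - smult c (lower_poly x n)"
    have dh: "degree h \<le> n" unfolding h_def c_def
      by (rule degree_minus_lead) (use d orth degree_Ap in auto)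
    have o: "moment_fun x (lower_poly x n * h) = 0" using orth dh by (simp add: coeff_eq_0)
    have "g * g = smult (c * c) (lower_poly x n * lower_poly x n) + smult (2 * c) (lower_poly x n * h) + h * h"
      by (rule poly_ext) (simp add: h_def algebra_simps)
    then have e: "moment_fun x (g * g) = c * c * lower_gap x n + moment_fun x (h * h)"
      using o by (simp add: moment_fun_add moment_fun_smult lower_gap_def)
    show ?thesis
    proof (cases "h = 0")
      case True
      then have "c \<noteq> 0" using Suc.prems by (auto simp: h_def)
      then have "c * c * lower_gap x n > 0" using pos by (metis mult_pos_pos not_real_square_gt_zero)
      then show ?thesis using e True by simp
    next
      case False
      then have "moment_fun x (h * h) > 0" using Suc.IH[OF can] dh by blast
      moreover have "c * c * lower_gap x n \<ge> 0" using pos by simp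
      ultimately show ?thesis using e by linarith
    qed
  qed
  moreover have "moment_fun x (w_poly * g * g) > 0" if d: "degree g < Suc n"
  proof -
    define c where "c = coeff g n"
    define h where "h = g - smult c (upper_poly x n)"
    have hz: "h = 0 \<or> degree h < n"
    proof (cases n)
      case 0
      obtain a b where "g = [:a:]" "upper_poly x n = [:b:]"
        using 0 d degree_Bp[of x n] degree_eq_zeroE[of g] degree_eq_zeroE[of "upper_poly x n"] by (metis le_zero_eq less_Suc0)
      then show ?thesis using orth 0 by (simp add: h_def c_def)
    next
      case (Suc k)
      have "degree h \<le> k" unfolding h_def c_def Suc
        by (rule degree_minus_lead) (use d orth degree_Bp[of x n] Suc in auto)
      then show ?thesis using Suc by auto
    qed
    have o: "moment_fun x (w_poly * upper_poly x n * h) = 0" using orth hz by (auto simp: coeff_eq_0)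
    have "w_poly * g * g = smult (c * c) (w_poly * upper_poly x n * upper_poly x n) + smult (2 * c) (w_poly * upper_poly x n * h) + w_poly * h * h"
      by (rule poly_ext) (simp add: h_def algebra_simps)
    then have e: "moment_fun x (w_poly * g * g) = c * c * upper_gap x n + moment_fun x (w_poly * h * h)"
      using o by (simp add: moment_fun_add moment_fun_smult upper_gap_def)
    show ?thesis
    proof (cases "h = 0")
      case True
      then have "c \<noteq> 0" using Suc.prems by (auto simp: h_def)
      then have "c * c * upper_gap x n > 0" using pos by (metis mult_pos_pos not_real_square_gt_zero)
      then show ?thesis using e True by simp
    next
      case False
      then have "moment_fun x (w_poly * h * h) > 0" using Suc.IH[OF can] hz by blast
      moreover have "c * c * upper_gap x n \<ge> 0" using pos by simp
      ultimately show ?thesis using e by linarith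
    qed
  qed
  ultimately show ?case by blast
qed

text \<open>The gaps are values of the two quadratic forms at \<open>lower_poly\<close> and
  \<open>upper_poly\<close>, which are nonzero because they are monic; monicity needs the smaller
  gaps, hence the induction. The conditions on the forms are convex in x, which the gaps do not
  show.\<close>

lemma positive_imp_canon:
  assumes "\<And>g. g \<noteq> 0 \<Longrightarrow> degree g \<le> n \<Longrightarrow> moment_fun x (g * g) > 0"
    and "\<And>g. g \<noteq> 0 \<Longrightarrow> degree g < n \<Longrightarrow> moment_fun x (w_poly * g * g) > 0"
  shows "canonical x n"
proof -
  have "canonical x k" if "k \<le> n" for k
    using that
  proof (induction k)
    case (Suc k)
    then have can: "canonical x k" by simp
    have "lower_poly x k \<noteq> 0" "upper_poly x k \<noteq> 0" using canonical_orthogonal[OF can] by auto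
    then show ?case using can assms Suc degree_AB[of x k] by (auto simp: canonical_Suc lower_gap_def upper_gap_def)
  qed (simp add: canonical_def)
  then show ?thesis by simp
qed

text \<open>The moment \<open>x (n + 1)\<close> enters only through the top coefficient: 1 for the
  square of the monic \<open>lower_poly\<close>, and -1 for the weighted square of
  \<open>upper_poly\<close> because of the sign in w. So the two gaps trade length and their sum is
  constant on the fibre.\<close>

lemma uv_upd:
  assumes "canonical x n"
  shows "lower_gap (x(Suc n := y)) n = lower_gap (x(Suc n := 0)) n + y"
    and "upper_gap (x(Suc n := y)) n = upper_gap (x(Suc n := 0)) n - y"
    and "mrange (x(Suc n := y)) n = mrange x n"
proof -
  have canonical_polys: "lower_poly (x(Suc n := t)) n = lower_poly x n \<and> upper_poly (x(Suc n := t)) n = upper_poly x n" for t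
    by (rule canonical_polys_cong) auto
  have m: "coeff (lower_poly x n) (Suc n) = 1" "coeff (upper_poly x n) n = 1" using canonical_orthogonal[OF assms] by auto
  then have d: "degree (lower_poly x n) = Suc n" "degree (upper_poly x n) = n"
    using degree_AB[of x n] by (metis le_antisym le_degree zero_neq_one)+
  have cA: "coeff (lower_poly x n * lower_poly x n) (2 * Suc n) = 1"
    using coeff_mult_degree_sum[of "lower_poly x n" "lower_poly x n"] m d by (simp add: mult_2)
  have BB: "coeff (upper_poly x n * upper_poly x n) (2 * n) = 1"
    using coeff_mult_degree_sum[of "upper_poly x n" "upper_poly x n"] m d by (simp add: mult_2)
  have "degree (upper_poly x n * upper_poly x n) \<le> 2 * n"
    using degree_mult_le[of "upper_poly x n" "upper_poly x n"] d by simp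
  then have cB: "coeff (w_poly * upper_poly x n * upper_poly x n) (2 * Suc n) = -1"
    using BB coeff_ww_mult(1)[where p = "upper_poly x n * upper_poly x n" and k = "2 * n"] by (simp add: coeff_eq_0 mult.assoc)
  show u: "lower_gap (x(Suc n := t)) n = lower_gap (x(Suc n := 0)) n + t" for t
    using moment_fun_upd[OF degree_AA[of x n], of x t] cA by (simp add: lower_gap_def canonical_polys)
  show v: "upper_gap (x(Suc n := t)) n = upper_gap (x(Suc n := 0)) n - t" for t
    using moment_fun_upd[OF degree_wBB[of x n], of x t] cB by (simp add: upper_gap_def canonical_polys)
  show "mrange (x(Suc n := y)) n = mrange x n"
    using u[of y] v[of y] u[of "x (Suc n)"] v[of "x (Suc n)"] by (simp add: mrange_def)
qed

text \<open>Each new moment is placed at the midpoint of its range, where both gaps are half of a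
  positive length. The point serves as the end of a segment when the moment space is approximated
  from inside.\<close>

lemma canonical_exists: "\<exists>x. canonical x n"
proof (induction n)
  case (Suc n)
  then obtain x where x: "canonical x n" by blast
  define y where "y = mrange x n / 2 - lower_gap (x(Suc n := 0)) n"
  let ?x = "x(Suc n := y)"
  have c: "canonical ?x n" using x canonical_cong[of n ?x x] by simp
  have u: "lower_gap ?x n = mrange x n / 2" using uv_upd(1)[OF x, of y] by (simp add: y_def)
  have "mrange ?x n = mrange x n" by (rule uv_upd(3)[OF x])
  then have "lower_gap ?x n + upper_gap ?x n = mrange x n" by (simp add: mrange_def[of ?x])
  then have "upper_gap ?x n = mrange x n / 2" using u by linarith
  then have "canonical ?x (Suc n)" using c u canonical_ll_pos[OF x] by (simp add: canonical_Suc)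
  then show ?case by blast
qed (simp add: canonical_def)

section \<open>Zeros of real polynomials, Lagrange interpolation and Gauss quadrature\<close>

definition complex_poly :: "real poly \<Rightarrow> complex \<Rightarrow> complex" where
  "complex_poly p z = poly (map_poly of_real p) z"

lemma complex_poly_pCons: "complex_poly (pCons a p) z = of_real a + z * complex_poly p z"
  by (simp add: complex_poly_def map_poly_pCons)

lemma complex_poly_0 [simp]: "complex_poly 0 z = 0"
  by (simp add: complex_poly_def)

lemma complex_poly_add: "complex_poly (p + q) z = complex_poly p z + complex_poly q z"
proof (induction p arbitrary: q)
  case (pCons a p)
  obtain b r where "q = pCons b r" by (cases q)
  then show ?case by (simp add: complex_poly_pCons pCons.IH algebra_simps)
qed auto

lemma complex_poly_smult: "complex_poly (smult c p) z = of_real c * complex_poly p z"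
  by (induction p) (simp_all add: complex_poly_pCons algebra_simps)

lemma complex_poly_mult: "complex_poly (p * q) z = complex_poly p z * complex_poly q z"
  by (induction p) (simp_all add: complex_poly_pCons complex_poly_add complex_poly_smult algebra_simps)

text \<open>The case \<open>b = 0\<close> of the hypothesis excludes multiple real roots, the others exclude pairs of
  conjugate roots \<open>a \<plusminus> \<i> b\<close>.\<close>
lemma card_roots_eq_degree:
  fixes p :: "real poly"
  assumes "p \<noteq> 0" "\<And>a b. \<not> [:a\<^sup>2 + b\<^sup>2, - 2 * a, 1:] dvd p"
  shows "card {x. poly p x = 0} = degree p"
  using assms
proof (induction "degree p" arbitrary: p)
  case 0
  then obtain c where "p = [:c:]" "c \<noteq> 0" by (metis degree_eq_zeroE pCons_0_0)
  then show ?case by simp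
next
  case (Suc k)
  have "degree (map_poly complex_of_real p) = degree p" by (rule degree_map_poly) simp
  then have "\<not> constant (poly (map_poly complex_of_real p))"
    using Suc(2) by (simp add: constant_degree)
  then obtain z where z: "complex_poly p z = 0" using fundamental_theorem_of_algebra unfolding complex_poly_def by blast
  define a b where "a = Re z" "b = Im z"
  have zab: "z = Complex a b" by (simp add: a_b_def)
  have b: "b = 0"
  proof (rule ccontr)
    assume b: "b \<noteq> 0"
    \<comment> \<open>The real quadratic with roots z and its conjugate. The remainder of p modulo
      it is a real polynomial of degree at most 1 that vanishes at the nonreal z, hence is
      0.\<close>
    define q where "q = [:a\<^sup>2 + b\<^sup>2, - 2 * a, 1:]"
    define r where "r = p mod q"
    have "degree q = 2" "q \<noteq> 0" by (auto simp: q_def)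
    then have "r = 0 \<or> degree r < 2" using degree_mod_less[of q p] by (simp add: r_def)
    then have "degree r \<le> 1" by auto
    then have r: "r = [:coeff r 0, coeff r 1:]"
      by (intro poly_eqI) (auto simp: coeff_pCons coeff_eq_0 split: nat.splits)
    have "complex_poly q z = 0" unfolding q_def zab
      by (simp add: complex_poly_pCons complex_eq_iff power2_eq_square algebra_simps)
    moreover have "p = q * (p div q) + r" by (simp add: r_def)
    ultimately have "complex_poly r z = 0" using z by (metis complex_poly_add complex_poly_mult add_0 mult_zero_left)
    then have "complex_of_real (coeff r 0) + z * complex_of_real (coeff r 1) = 0"
      by (subst (asm) r) (simp add: complex_poly_pCons)
    then have "coeff r 1 = 0" "coeff r 0 = 0" using b by (auto simp: zab complex_eq_iff)
    then have "r = 0" using r by simp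
    then have "q dvd p" unfolding r_def by (rule mod_0_imp_dvd)
    then show False using Suc.prems by (simp add: q_def)
  qed
  have "complex_poly p (of_real a) = of_real (poly p a)" for p
    by (induction p) (simp_all add: complex_poly_pCons)
  then have "poly p a = 0" using z zab b by (metis complex_of_real_def of_real_eq_0_iff)
  then obtain g where g: "p = [:- a, 1:] * g" using poly_eq_0_iff_dvd by (metis dvdE)
  have g0: "g \<noteq> 0" using g Suc.prems by auto
  have dg: "degree p = Suc (degree g)" unfolding g using g0 by (subst degree_mult_eq) auto
  have "card {x. poly g x = 0} = degree g"
  proof (rule Suc.hyps(1))
    show "k = degree g" using dg Suc.hyps(2) by simp
    show "g \<noteq> 0" by (rule g0)
    show "\<not> [:a\<^sup>2 + b\<^sup>2, - 2 * a, 1:] dvd g" for a b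
      using Suc.prems(2)[of a b] unfolding g by (meson dvd_mult)
  qed
  moreover have "poly g a \<noteq> 0"
  proof
    assume "poly g a = 0"
    then obtain h where "g = [:- a, 1:] * h" using poly_eq_0_iff_dvd by (metis dvdE)
    then have "p = ([:- a, 1:] * [:- a, 1:]) * h" unfolding g by (simp only: mult.assoc)
    also have "[:- a, 1:] * [:- a, 1:] = [:a\<^sup>2 + 0\<^sup>2, - 2 * a, 1:]" by (simp add: power2_eq_square)
    finally have "p = [:a\<^sup>2 + 0\<^sup>2, - 2 * a, 1:] * h" .
    then show False using Suc.prems(2)[of a 0] by (metis dvdI)
  qed
  moreover have "{x. poly p x = 0} = insert a {x. poly g x = 0}" unfolding g by auto
  ultimately show ?case using dg by (simp add: poly_roots_finite[OF g0])
qed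

definition lagr_poly :: "real set \<Rightarrow> real \<Rightarrow> real poly" where
  "lagr_poly R z = (\<Prod>y\<in>R - {z}. smult (1 / (z - y)) [:- y, 1:])"

lemma poly_lagr:
  assumes "finite R" "z \<in> R" "y \<in> R" shows "poly (lagr_poly R z) y = (if y = z then 1 else 0)"
proof (cases "y = z")
  case True
  have "1 / (z - x) * (z - x) = 1" if "x \<in> R - {z}" for x using that by simp
  then show ?thesis using True by (simp add: lagr_poly_def poly_prod prod.neutral flip: diff_divide_distrib)
next
  case False
  then show ?thesis using assms by (auto simp: lagr_poly_def poly_prod prod_zero_iff intro!: bexI[of _ y])
qed

lemma degree_lagr: "finite R \<Longrightarrow> z \<in> R \<Longrightarrow> degree (lagr_poly R z) < card R"
proof -
  assume R: "finite R" "z \<in> R"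
  have "degree (lagr_poly R z) \<le> sum (degree \<circ> (\<lambda>y. smult (1 / (z - y)) [:- y, 1:])) (R - {z})"
    unfolding lagr_poly_def by (rule degree_prod_sum_le) (use R in simp)
  also have "\<dots> \<le> (\<Sum>y\<in>R - {z}. 1)" by (rule sum_mono) simp
  also have "\<dots> < card R" using R card_Diff1_less[of R z] by simp
  finally show ?thesis .
qed

lemma lagr_poly_expand:
  assumes "finite R" "degree p < card R"
  shows "p = (\<Sum>z\<in>R. smult (poly p z) (lagr_poly R z))"
proof (rule poly_eqI_degree[where A = R])
  show "poly p y = poly (\<Sum>z\<in>R. smult (poly p z) (lagr_poly R z)) y" if "y \<in> R" for y
    using assms(1) that by (simp add: poly_sum poly_lagr if_distrib cong: if_cong)
  show "degree p < card R" by fact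
  have "degree (\<Sum>z\<in>R. smult (poly p z) (lagr_poly R z)) \<le> card R - 1"
  proof (rule degree_sum_le[OF assms(1)])
    show "degree (smult (poly p z) (lagr_poly R z)) \<le> card R - 1" if "z \<in> R" for z
      using degree_lagr[OF assms(1) that] degree_smult_le[of "poly p z" "lagr_poly R z"] by linarith
  qed
  then show "degree (\<Sum>z\<in>R. smult (poly p z) (lagr_poly R z)) < card R" using assms(2) by linarith
qed

text \<open>The nodes are the zeros of \<open>lower_poly x n\<close>. Positivity of the two forms
  excludes nonreal and multiple zeros, confines the zeros to (-1, 1), and makes the coefficients
  positive, since they are the functional at squares of Lagrange polynomials.\<close>

lemma canonical_quadrature:
  assumes can: "canonical x n"
  shows "\<exists>R c. finite R \<and> card R = Suc n \<and> R \<subseteq> {-1<..<1} \<and> (\<forall>z\<in>R. c z > (0::real)) \<and>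
    (\<forall>p. degree p \<le> 2 * n + 1 \<longrightarrow> moment_fun x p = (\<Sum>z\<in>R. c z * poly p z))"
proof -
  define A where "A = lower_poly x n"
  have mA: "coeff A (Suc n) = 1" and oA: "\<And>g. degree g \<le> n \<Longrightarrow> moment_fun x (A * g) = 0"
    using canonical_orthogonal[OF can] by (auto simp: A_def coeff_eq_0)
  have dA: "degree A = Suc n" using mA degree_Ap[of x n] unfolding A_def
    by (metis le_antisym le_degree zero_neq_one)
  have A0: "A \<noteq> 0" using mA by auto
  define R where "R = {z. poly A z = 0}"
  have fR: "finite R" unfolding R_def by (rule poly_roots_finite[OF A0])
  have cofactor: "g \<noteq> 0 \<and> degree g + degree q = Suc n" if "A = q * g" for q g
    using that dA A0 degree_mult_eq[of q g] by auto
  have sq: "moment_fun x (g * g) > 0" if "g \<noteq> 0" "degree g \<le> n" for g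
    using canonical_imp_positive[OF can] that by blast
  have sqw: "moment_fun x (w_poly * g * g) > 0" if "g \<noteq> 0" "degree g < n" for g
    using canonical_imp_positive[OF can] that by blast
  have "card R = degree A" unfolding R_def
  proof (rule card_roots_eq_degree[OF A0], rule notI)
    \<comment> \<open>If g is the cofactor of the quadratic, A g = ((z - a) g)^2 + b^2 g^2 has
      positive functional, although g has low enough degree to be orthogonal to A.\<close>
    fix a b :: real assume "[:a\<^sup>2 + b\<^sup>2, - 2 * a, 1:] dvd A"
    then obtain g where g: "A = [:a\<^sup>2 + b\<^sup>2, - 2 * a, 1:] * g" by (elim dvdE)
    have dg: "degree g + 2 = Suc n" "g \<noteq> 0" using cofactor[OF g] by auto
    have "A * g = ([:- a, 1:] * g) * ([:- a, 1:] * g) + smult (b\<^sup>2) (g * g)"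
      unfolding g by (rule poly_ext) (simp add: power2_eq_square algebra_simps)
    then have "moment_fun x (([:- a, 1:] * g) * ([:- a, 1:] * g)) + b\<^sup>2 * moment_fun x (g * g) = 0"
      using oA[of g] dg by (simp add: moment_fun_add moment_fun_smult)
    moreover have "moment_fun x (([:- a, 1:] * g) * ([:- a, 1:] * g)) > 0"
    proof (rule sq)
      show "[:- a, 1:] * g \<noteq> 0" unfolding mult_eq_0_iff using dg by simp
      show "degree ([:- a, 1:] * g) \<le> n" using dg by (subst degree_mult_eq) auto
    qed
    moreover have "b\<^sup>2 * moment_fun x (g * g) \<ge> 0" using sq[of g] dg by (intro mult_nonneg_nonneg) auto
    ultimately show False by linarith
  qed
  then have cR: "card R = Suc n" using dA by simp
  have parA: "poly A (- a) = (-1) ^ Suc n * poly A a" for a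
  proof -
    have "poly A (- a) = (\<Sum>i\<le>Suc n. coeff A i * (- a) ^ i)" using dA by (simp add: poly_altdef)
    also have "\<dots> = (\<Sum>i\<le>Suc n. (-1) ^ Suc n * (coeff A i * a ^ i))"
    proof (rule sum.cong[OF refl])
      fix i
      show "coeff A i * (- a) ^ i = (-1) ^ Suc n * (coeff A i * a ^ i)"
      proof (cases "odd (i + Suc n)")
        case True
        then show ?thesis using parity_AB[of n x] by (simp add: A_def parity_poly_def)
      next
        case False
        then have "(-1::real) ^ i = (-1) ^ Suc n" by (simp add: minus_one_power_iff)
        then show ?thesis by (subst power_minus) simp
      qed
    qed
    also have "\<dots> = (-1) ^ Suc n * poly A a" using dA by (simp only: sum_distrib_left[symmetric] poly_altdef)
    finally show ?thesis .
  qed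
  have Rin: "R \<subseteq> {-1<..<1}"
  proof
    fix a assume a: "a \<in> R"
    show "a \<in> {-1<..<1}"
    proof (rule ccontr)
      assume "a \<notin> {-1<..<1}"
      then have a1: "\<bar>a\<bar> \<ge> 1" by auto
      obtain h where h: "A = [:- a, 1:] * h" using a poly_eq_0_iff_dvd unfolding R_def by (metis dvdE mem_Collect_eq)
      \<comment> \<open>By parity the zeros come in pairs, so A = (z^2 - a^2) g. Then A g = - w g^2
        - (a^2 - 1) g^2 has negative functional, again contradicting orthogonality.\<close>
      have "poly A (- a) = 0" using a parA by (simp add: R_def)
      then have "poly h (- a) = 0" using a1 unfolding h by auto
      then obtain g where g: "h = [:a, 1:] * g" using poly_eq_0_iff_dvd by (metis dvdE minus_minus)
      have Ag: "A = [:- (a\<^sup>2), 0, 1:] * g" unfolding h g by (rule poly_ext) (simp add: power2_eq_square algebra_simps)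
      have dg: "degree g + 2 = Suc n" "g \<noteq> 0" using cofactor[OF Ag] by auto
      have "A * g = - (w_poly * g * g) - smult (a\<^sup>2 - 1) (g * g)"
        unfolding Ag by (rule poly_ext) (simp add: power2_eq_square algebra_simps)
      also have "\<dots> = smult (-1) (w_poly * g * g) - smult (a\<^sup>2 - 1) (g * g)" by simp
      finally have "0 = - moment_fun x (w_poly * g * g) - (a\<^sup>2 - 1) * moment_fun x (g * g)"
        using oA[of g] dg by (simp add: moment_fun_diff moment_fun_smult moment_fun_uminus)
      moreover have "moment_fun x (w_poly * g * g) > 0" using sqw[of g] dg by auto
      moreover have "a\<^sup>2 \<ge> 1" using a1 by (metis abs_ge_zero one_power2 power2_abs power_mono zero_le_one)
      then have "(a\<^sup>2 - 1) * moment_fun x (g * g) \<ge> 0" using sq[of g] dg by (intro mult_nonneg_nonneg) auto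
      ultimately show False by linarith
    qed
  qed
  have quad: "moment_fun x p = (\<Sum>z\<in>R. moment_fun x (lagr_poly R z) * poly p z)" if p: "degree p \<le> 2 * n + 1" for p
  proof -
    \<comment> \<open>Division by A: the quotient has degree at most n, so A annihilates it, and the
      remainder is determined by its values at the n + 1 nodes, where it agrees with p.\<close>
    have dr: "degree (p mod A) \<le> n" using degree_mod_less[OF A0, of p] dA by auto
    have dq: "degree (p div A) \<le> n"
    proof (cases "p div A = 0")
      case False
      have "p div A * A = p - p mod A" by (simp add: minus_mod_eq_div_mult)
      moreover have "degree (p - p mod A) \<le> 2 * n + 1" using p dr by (intro degree_diff_le) auto
      ultimately show ?thesis using degree_mult_eq[OF False A0] dA by simp
    qed simp
    have p_eq: "p = A * (p div A) + p mod A" by simp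
    have "moment_fun x p = moment_fun x (p mod A)" using oA[OF dq] by (subst p_eq) (simp only: moment_fun_add add_0)
    also have "\<dots> = moment_fun x (\<Sum>z\<in>R. smult (poly (p mod A) z) (lagr_poly R z))"
      using lagr_poly_expand[OF fR, of "p mod A"] dr cR by simp
    also have "\<dots> = (\<Sum>z\<in>R. moment_fun x (lagr_poly R z) * poly (p mod A) z)"
      by (simp add: moment_fun_sum moment_fun_smult mult.commute)
    also have "\<dots> = (\<Sum>z\<in>R. moment_fun x (lagr_poly R z) * poly p z)"
    proof (rule sum.cong[OF refl])
      fix z assume "z \<in> R"
      have "poly p z = poly (A * (p div A) + p mod A) z" by simp
      also have "\<dots> = poly (p mod A) z" using \<open>z \<in> R\<close> unfolding poly_add poly_mult by (simp add: R_def)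
      finally have "poly p z = poly (p mod A) z" .
      then show "moment_fun x (lagr_poly R z) * poly (p mod A) z = moment_fun x (lagr_poly R z) * poly p z" by simp
    qed
    finally show ?thesis .
  qed
  have "moment_fun x (lagr_poly R z) > 0" if z: "z \<in> R" for z
  proof -
    have d: "degree (lagr_poly R z) \<le> n" using degree_lagr[OF fR z] cR by simp
    then have "degree (lagr_poly R z * lagr_poly R z) \<le> 2 * n + 1" using degree_mult_le[of "lagr_poly R z" "lagr_poly R z"] by simp
    then have "moment_fun x (lagr_poly R z * lagr_poly R z) = (\<Sum>y\<in>R. moment_fun x (lagr_poly R y) * poly (lagr_poly R z * lagr_poly R z) y)"
      by (rule quad)
    also have "\<dots> = (\<Sum>y\<in>R. if y = z then moment_fun x (lagr_poly R z) else 0)"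
      by (rule sum.cong) (auto simp: poly_lagr[OF fR z])
    also have "\<dots> = moment_fun x (lagr_poly R z)" using fR z by simp
    moreover have "lagr_poly R z \<noteq> 0" using poly_lagr[OF fR z z] by auto
    ultimately show ?thesis using sq[OF _ d] by simp
  qed
  then show ?thesis using fR cR Rin quad
    by (intro exI[of _ R] exI[of _ "\<lambda>z. moment_fun x (lagr_poly R z)"] conjI ballI allI impI) simp_all
qed

section \<open>Measurability of the gaps and integration over the fibres\<close>

abbreviation leb_on :: "nat set \<Rightarrow> (nat \<Rightarrow> real) measure" where
  "leb_on A \<equiv> Pi\<^sub>M A (\<lambda>_. lborel)"

abbreviation leb_upto :: "nat \<Rightarrow> (nat \<Rightarrow> real) measure" where
  "leb_upto n \<equiv> leb_on {1..n}"

text \<open>Points of the product are extensional, so a coordinate outside A is constantly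
  \<open>undefined\<close>. Having no side condition on i allows moments of any index to occur in
  the measurability proofs.\<close>

lemma coord_measurable [measurable]: "(\<lambda>x. x i) \<in> borel_measurable (leb_on A)"
proof (cases "i \<in> A")
  case True
  then have "(\<lambda>x. x i) \<in> measurable (leb_on A) lborel" by (rule measurable_component_singleton)
  then show ?thesis by simp
next
  case False
  then have "(\<lambda>x. x i) \<in> borel_measurable (leb_on A) \<longleftrightarrow> (\<lambda>x. undefined :: real) \<in> borel_measurable (leb_on A)"
    by (intro measurable_cong) (auto simp: space_PiM PiE_def extensional_def)
  then show ?thesis by simp
qed

text \<open>Measurability of a polynomial-valued map is taken coefficientwise, which is preserved by
  the ring operations of the recursion.\<close>

definition coeff_measurable :: "nat set \<Rightarrow> ((nat \<Rightarrow> real) \<Rightarrow> real poly) \<Rightarrow> bool" where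
  "coeff_measurable A p \<longleftrightarrow> (\<forall>i. (\<lambda>x. coeff (p x) i) \<in> borel_measurable (leb_on A))"

lemma coeff_measurable_const: "coeff_measurable A (\<lambda>x. p)"
  by (simp add: coeff_measurable_def)

lemma coeff_measurable_mult: "coeff_measurable A p \<Longrightarrow> coeff_measurable A q \<Longrightarrow> coeff_measurable A (\<lambda>x. p x * q x)"
  by (auto simp: coeff_measurable_def coeff_mult intro!: borel_measurable_sum borel_measurable_times)

lemma coeff_measurable_add: "coeff_measurable A p \<Longrightarrow> coeff_measurable A q \<Longrightarrow> coeff_measurable A (\<lambda>x. p x + q x)"
  by (auto simp: coeff_measurable_def intro!: borel_measurable_add)

lemma coeff_measurable_diff: "coeff_measurable A p \<Longrightarrow> coeff_measurable A q \<Longrightarrow> coeff_measurable A (\<lambda>x. p x - q x)"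
  by (auto simp: coeff_measurable_def intro!: borel_measurable_diff)

lemma coeff_measurable_smult:
  "c \<in> borel_measurable (leb_on A) \<Longrightarrow> coeff_measurable A q \<Longrightarrow> coeff_measurable A (\<lambda>x. smult (c x) (q x))"
  by (auto simp: coeff_measurable_def intro!: borel_measurable_times)

lemma moment_fun_measurable:
  assumes "coeff_measurable A p" "\<And>x. degree (p x) \<le> 2 * N + 1"
  shows "(\<lambda>x. moment_fun x (p x)) \<in> borel_measurable (leb_on A)"
proof -
  have [measurable]: "(\<lambda>x. coeff (p x) i) \<in> borel_measurable (leb_on A)" for i
    using assms by (simp add: coeff_measurable_def)
  have "(\<lambda>x. if i = 0 then 1 else x i) \<in> borel_measurable (leb_on A)" for i
    by (cases i) simp_all
  then show ?thesis unfolding moment_fun_eq[OF assms(2)] by measurable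
qed

lemma canonical_polys_measurable:
  "coeff_measurable A (\<lambda>x. lower_poly x k) \<and> coeff_measurable A (\<lambda>x. upper_poly x k)
   \<and> (\<lambda>x. lower_gap x k) \<in> borel_measurable (leb_on A) \<and> (\<lambda>x. upper_gap x k) \<in> borel_measurable (leb_on A)"
proof -
  have step: "(\<lambda>x. lower_gap x k) \<in> borel_measurable (leb_on A) \<and> (\<lambda>x. upper_gap x k) \<in> borel_measurable (leb_on A)"
    if "coeff_measurable A (\<lambda>x. lower_poly x k)" "coeff_measurable A (\<lambda>x. upper_poly x k)" for k
    unfolding lower_gap_def upper_gap_def
    using moment_fun_measurable[OF coeff_measurable_mult[OF that(1) that(1)] degree_AA]
      moment_fun_measurable[OF coeff_measurable_mult[OF coeff_measurable_mult[OF coeff_measurable_const that(2)] that(2)] degree_wBB]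
    by blast
  have "coeff_measurable A (\<lambda>x. lower_poly x k) \<and> coeff_measurable A (\<lambda>x. upper_poly x k)"
  proof (induction k)
    case (Suc k)
    have [measurable]: "(\<lambda>x. lower_gap x k) \<in> borel_measurable (leb_on A)" "(\<lambda>x. upper_gap x k) \<in> borel_measurable (leb_on A)"
      using step Suc by auto
    show ?case unfolding lower_poly_Suc upper_poly_Suc mrange_def using Suc
      by (intro conjI coeff_measurable_smult coeff_measurable_add coeff_measurable_diff
          coeff_measurable_mult coeff_measurable_const) auto
  qed (simp add: lower_poly_0 upper_poly_0 coeff_measurable_const)
  then show ?thesis using step by blast
qed

lemma lower_gap_measurable [measurable]: "(\<lambda>x. lower_gap x k) \<in> borel_measurable (leb_on A)"
  and upper_gap_measurable [measurable]: "(\<lambda>x. upper_gap x k) \<in> borel_measurable (leb_on A)"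
  using canonical_polys_measurable by auto

lemma mrange_measurable [measurable]: "(\<lambda>x. mrange x k) \<in> borel_measurable (leb_on A)"
  unfolding mrange_def by measurable

lemma canonical_measurable [measurable]: "Measurable.pred (leb_on A) (\<lambda>x. canonical x k)"
  unfolding canonical_def by measurable

interpretation lb: product_sigma_finite "\<lambda>_::nat. lborel :: real measure"
  by standard

text \<open>Euler's Beta value B(a + 1, a + 1), the integral of (s (1 - s))^a over the unit
  interval.\<close>

definition beta_int :: "nat \<Rightarrow> real" where
  "beta_int a = fact a * fact a / fact (2 * a + 1)"

lemma beta_int_pos: "beta_int a > 0"
  by (simp add: beta_int_def)

lemma nn_integral_bet:
  "(\<integral>\<^sup>+s. (if 0 < s \<and> s < 1 then ennreal ((s * (1 - s)) ^ a) else 0) \<partial>lborel) = ennreal (beta_int a)"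
proof -
  define p :: "real poly" where "p = [:0, 1:] ^ a * [:1, -1:] ^ a"
  have p: "poly p s = (s * (1 - s)) ^ a" for s
    by (simp add: p_def poly_power power_mult_distrib)
  have "AE s in lborel. s \<noteq> (0::real) \<and> s \<noteq> 1"
    using AE_lborel_singleton[of "0::real"] AE_lborel_singleton[of "1::real"] by eventually_elim simp
  then have "(\<integral>\<^sup>+s. (if 0 < s \<and> s < 1 then ennreal ((s * (1 - s)) ^ a) else 0) \<partial>lborel)
     = (\<integral>\<^sup>+s. ennreal (indicator II s *\<^sub>R poly p s) \<partial>lborel)"
    by (intro nn_integral_cong_AE, eventually_elim) (auto simp: p indicator_def)
  also have "\<dots> = ennreal (LBINT s:II. poly p s)"
    unfolding set_lebesgue_integral_def
    by (rule nn_integral_eq_integral)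
      (use set_integrable_poly[of p] in \<open>auto simp: set_integrable_def p indicator_def intro!: AE_I2\<close>)
  also have "(LBINT s:II. poly p s) = pint p" by (simp add: pint_def)
  also have "pint p = beta_int a" unfolding p_def pint_Beta beta_int_def by (simp only: mult_2)
  finally show ?thesis .
qed

text \<open>The power a makes the fibre integration inductive: integrating out the last moment turns
  the exponent a into a + 1 one level below. The volume is the case a = 0.\<close>

definition range_power :: "nat \<Rightarrow> nat \<Rightarrow> (nat \<Rightarrow> real) \<Rightarrow> ennreal" where
  "range_power n a x = (if canonical x n then ennreal (mrange x n ^ a) else 0)"

lemma range_power_measurable [measurable]: "range_power n a \<in> borel_measurable (leb_on A)"
  unfolding range_power_def by measurable

text \<open>Put s = (c + y) / l. Then s runs through the unit interval, the next range has length l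
  s (1 - s), and the Jacobian l raises the exponent of l by one.\<close>

lemma range_power_inner: "(\<integral>\<^sup>+y. range_power (Suc n) a (x(Suc n := y)) \<partial>lborel) = ennreal (beta_int a) * range_power n (Suc a) x"
proof (cases "canonical x n")
  case False
  have "canonical (x(Suc n := y)) n = canonical x n" for y by (rule canonical_cong) simp
  then show ?thesis using False by (simp add: range_power_def canonical_Suc)
next
  case True
  define c l where "c = lower_gap (x(Suc n := 0)) n" and "l = mrange x n"
  have l: "l > 0" using canonical_ll_pos[OF True] by (simp add: l_def)
  have can: "canonical (x(Suc n := y)) n" for y
  proof -
    have "canonical (x(Suc n := y)) n = canonical x n" by (rule canonical_cong) simp
    then show ?thesis using True by simp
  qed
  have u: "lower_gap (x(Suc n := y)) n = c + y" for y using uv_upd(1)[OF True, of y] by (simp add: c_def)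
  have v: "upper_gap (x(Suc n := y)) n = l - (c + y)" for y
    using uv_upd(3)[OF True, of y] u[of y] by (simp add: l_def mrange_def)
  define G where "G = (\<lambda>y. if 0 < c + y \<and> 0 < l - (c + y) then ennreal (((c + y) * (l - (c + y)) / l) ^ a) else 0)"
  have G: "range_power (Suc n) a (x(Suc n := y)) = G y" for y
  proof (cases "canonical (x(Suc n := y)) (Suc n)")
    case True
    then have "mrange (x(Suc n := y)) (Suc n) = (c + y) * (l - (c + y)) / l"
      using mrange_Suc[OF True] uv_upd(3)[OF \<open>canonical x n\<close>, of y] by (simp add: u v l_def)
    then show ?thesis using True by (simp add: range_power_def canonical_Suc G_def u v)
  next
    case False
    then have "\<not> (0 < c + y \<and> 0 < l - (c + y))" using can[of y] unfolding canonical_Suc u v by blast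
    then show ?thesis using False by (simp only: range_power_def G_def if_False)
  qed
  have [measurable]: "G \<in> borel_measurable borel" unfolding G_def by measurable
  have "(\<integral>\<^sup>+y. G y \<partial>lborel) = ennreal \<bar>l\<bar> * (\<integral>\<^sup>+s. G (- c + l * s) \<partial>lborel)"
    using nn_integral_real_affine[of G l "- c"] l by simp
  also have "(\<lambda>s. G (- c + l * s)) = (\<lambda>s. ennreal (l ^ a) * (if 0 < s \<and> s < 1 then ennreal ((s * (1 - s)) ^ a) else 0))"
  proof
    fix s
    have "l - l * s = l * (1 - s)" by (simp add: algebra_simps)
    moreover have "l * s * (l * (1 - s)) / l = l * (s * (1 - s))" using l by simp
    ultimately show "G (- c + l * s) = ennreal (l ^ a) * (if 0 < s \<and> s < 1 then ennreal ((s * (1 - s)) ^ a) else 0)"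
      using l by (auto simp: G_def zero_less_mult_iff power_mult_distrib ennreal_mult mult_ac)
  qed
  also have "(\<integral>\<^sup>+s. ennreal (l ^ a) * (if 0 < s \<and> s < 1 then ennreal ((s * (1 - s)) ^ a) else 0) \<partial>lborel)
      = ennreal (l ^ a) * ennreal (beta_int a)"
    by (subst nn_integral_cmult) (auto simp: nn_integral_bet)
  also have "ennreal \<bar>l\<bar> * (ennreal (l ^ a) * ennreal (beta_int a)) = ennreal (beta_int a) * ennreal (l ^ Suc a)"
    using l by (simp add: ennreal_mult mult_ac beta_int_pos less_imp_le)
  finally have "(\<integral>\<^sup>+y. G y \<partial>lborel) = ennreal (beta_int a) * range_power n (Suc a) x" using True by (simp add: range_power_def l_def)
  then show ?thesis unfolding G .
qed

lemma range_power_integral: "(\<integral>\<^sup>+x. range_power n a x \<partial>leb_upto n) = ennreal (\<Prod>j<n. beta_int (a + j))"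
proof (induction n arbitrary: a)
  case 0
  have "(\<integral>\<^sup>+x. range_power 0 a x \<partial>leb_upto 0) = (\<integral>\<^sup>+x. 1 \<partial>leb_upto 0)"
    by (rule nn_integral_cong) (simp add: range_power_def canonical_def mrange_0)
  also have "\<dots> = 1" by (simp add: PiM_empty nn_integral_count_space_finite)
  finally show ?case by simp
next
  case (Suc n)
  have ins: "{1..Suc n} = insert (Suc n) {1..n}" by auto
  have "(\<integral>\<^sup>+x. range_power (Suc n) a x \<partial>leb_upto (Suc n)) = (\<integral>\<^sup>+x. (\<integral>\<^sup>+y. range_power (Suc n) a (x(Suc n := y)) \<partial>lborel) \<partial>leb_upto n)"
    using range_power_measurable[of "Suc n" a] unfolding ins by (intro lb.product_nn_integral_insert) auto
  also have "\<dots> = ennreal (beta_int a) * (\<integral>\<^sup>+x. range_power n (Suc a) x \<partial>leb_upto n)"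
    by (simp only: range_power_inner) (rule nn_integral_cmult, measurable)
  also have "\<dots> = ennreal (beta_int a * (\<Prod>j<n. beta_int (Suc a + j)))"
    by (simp add: Suc.IH[of "Suc a"] ennreal_mult beta_int_pos less_imp_le prod_nonneg del: One_nat_def add_Suc)
  also have "beta_int a * (\<Prod>j<n. beta_int (Suc a + j)) = (\<Prod>j<Suc n. beta_int (a + j))"
    by (subst prod.lessThan_Suc_shift) simp
  finally show ?case .
qed

section \<open>Representing measures and the volume of the moment space\<close>

lemma sum_even_odd:
  fixes f :: "nat \<Rightarrow> real" and n :: nat
  shows "(\<Sum>k\<le>2*n+1. f k) = (\<Sum>i\<le>n. f (2*i) + f (2*i+1))"
  by (induction n) simp_all

text \<open>The symmetric measure behind the moments splits the mass at t equally between the two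
  square roots of t; odd powers cancel and even ones give powers of t.\<close>

lemma moment_fun_moments:
  assumes "prob_space \<mu>" and s: "sets \<mu> = sets (restrict_space borel II)"
    and x: "\<And>i. 1 \<le> i \<Longrightarrow> i \<le> n \<Longrightarrow> x i = (\<integral>t. t ^ i \<partial>\<mu>)" and d: "degree p \<le> 2 * n + 1"
  shows "moment_fun x p = (\<integral>t. (poly p (sqrt t) + poly p (- sqrt t)) / 2 \<partial>\<mu>)"
proof -
  interpret prob_space \<mu> by fact
  have sp: "space \<mu> = II" using sets_eq_imp_space_eq[OF s] by (simp add: space_restrict_space)
  have [measurable]: "(\<lambda>t. t ^ i) \<in> borel_measurable \<mu>" for i :: nat
    unfolding measurable_cong_sets[OF s refl] by (intro measurable_restrict_space1) measurable
  have int: "integrable \<mu> (\<lambda>t. t ^ i)" for i :: nat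
    by (rule integrable_const_bound[where B = 1]) (auto simp: sp power_le_one intro!: AE_I2)
  have "(poly p (sqrt t) + poly p (- sqrt t)) / 2 = (\<Sum>i\<le>n. coeff p (2 * i) * t ^ i)" if "t \<in> space \<mu>" for t
  proof -
    have t: "t \<ge> 0" using that sp by simp
    have P: "poly p y = (\<Sum>k\<le>2*n+1. coeff p k * y ^ k)" for y
      unfolding poly_altdef by (rule sum.mono_neutral_left) (use d in \<open>auto simp: coeff_eq_0\<close>)
    have "(sqrt t) ^ (2 * i) = t ^ i" "(- sqrt t) ^ (2 * i) = t ^ i" for i using t by (simp_all add: power_mult)
    then show ?thesis unfolding P sum_even_odd
      by (simp add: sum.distrib[symmetric] sum_divide_distrib algebra_simps)
  qed
  then have "(\<integral>t. (poly p (sqrt t) + poly p (- sqrt t)) / 2 \<partial>\<mu>) = (\<integral>t. (\<Sum>i\<le>n. coeff p (2 * i) * t ^ i) \<partial>\<mu>)"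
    by (intro Bochner_Integration.integral_cong) auto
  also have "\<dots> = (\<Sum>i\<le>n. coeff p (2 * i) * (\<integral>t. t ^ i \<partial>\<mu>))"
    using int by simp
  also have "\<dots> = moment_fun x p" unfolding moment_fun_eq[OF d]
    using x by (intro sum.cong) (auto simp: prob_space)
  finally show ?thesis by simp
qed

lemma moment_space_positive:
  assumes "x \<in> moment_space n"
  shows "degree g \<le> n \<Longrightarrow> moment_fun x (g * g) \<ge> 0" "degree g < n \<Longrightarrow> moment_fun x (w_poly * g * g) \<ge> 0"
proof -
  obtain \<mu> :: "real measure" where \<mu>: "prob_space \<mu>" "sets \<mu> = sets (restrict_space borel II)"
    and x: "x = (\<lambda>i\<in>{1..n}. \<integral>t. t ^ i \<partial>\<mu>)" using assms unfolding moment_space_def by blast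
  have xi: "1 \<le> i \<Longrightarrow> i \<le> n \<Longrightarrow> x i = (\<integral>t. t ^ i \<partial>\<mu>)" for i by (simp add: x)
  have sp: "space \<mu> = II" using sets_eq_imp_space_eq[OF \<mu>(2)] by (simp add: space_restrict_space)
  show "moment_fun x (g * g) \<ge> 0" if "degree g \<le> n"
  proof -
    have "degree (g * g) \<le> 2 * n + 1" using degree_mult_le[of g g] that by simp
    from moment_fun_moments[OF \<mu> xi this] show ?thesis
      by (simp only:) (rule Bochner_Integration.integral_nonneg, simp)
  qed
  show "moment_fun x (w_poly * g * g) \<ge> 0" if "degree g < n"
  proof -
    have "degree (w_poly * g * g) \<le> 2 * n + 1"
      using degree_ww_mult[of "g * g"] degree_mult_le[of g g] that by (simp add: mult.assoc)
    from moment_fun_moments[OF \<mu> xi this] have "moment_fun x (w_poly * g * g) =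
      (\<integral>t. (poly (w_poly * g * g) (sqrt t) + poly (w_poly * g * g) (- sqrt t)) / 2 \<partial>\<mu>)" .
    also have "\<dots> \<ge> 0"
    proof (rule Bochner_Integration.integral_nonneg)
      fix t assume "t \<in> space \<mu>"
      then have t: "0 \<le> t" "t \<le> 1" using sp by auto
      have "poly (w_poly * g * g) (sqrt t) = (1 - t) * (poly g (sqrt t))\<^sup>2"
           "poly (w_poly * g * g) (- sqrt t) = (1 - t) * (poly g (- sqrt t))\<^sup>2"
        using t by (simp_all add: power2_eq_square mult.assoc)
      then have e: "(poly (w_poly * g * g) (sqrt t) + poly (w_poly * g * g) (- sqrt t)) / 2
          = (1 - t) * ((poly g (sqrt t))\<^sup>2 + (poly g (- sqrt t))\<^sup>2) / 2"
        by (simp only: distrib_left)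
      show "(poly (w_poly * g * g) (sqrt t) + poly (w_poly * g * g) (- sqrt t)) / 2 \<ge> 0"
        unfolding e using t by simp
    qed
    finally show ?thesis .
  qed
qed

text \<open>Measures with n + 1 atoms, as many as there are Gauss nodes. Weights and nodes are
  sequences in the unit interval over all of \<open>nat\<close>, so the parameters form a closed
  part of a product of compact intervals and the image is compact.\<close>

definition atomic_moments :: "nat \<Rightarrow> (nat \<Rightarrow> real) set" where
  "atomic_moments n = (\<lambda>(w, t). \<lambda>k\<in>{1..n}. \<Sum>i\<le>n. w i * t i ^ k) `
     (({w. \<forall>i. w i \<in> II} \<inter> {w. (\<Sum>i\<le>n. w i) = 1}) \<times> {t. \<forall>i. t i \<in> II})"

lemma compact_cube: "compact {f :: nat \<Rightarrow> real. \<forall>i. f i \<in> II}"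
proof -
  have "compactin (product_topology (\<lambda>i. euclideanreal) (UNIV :: nat set)) (PiE UNIV (\<lambda>i. II))"
    by (simp add: compactin_PiE)
  moreover have "PiE UNIV (\<lambda>i. II) = {f :: nat \<Rightarrow> real. \<forall>i. f i \<in> II}" by (auto simp: PiE_def)
  ultimately show ?thesis by (simp add: euclidean_product_topology)
qed

lemma coordinate_continuous_on: "continuous_on S g \<Longrightarrow> continuous_on S (\<lambda>p. g p (i::nat) :: real)"
  by (rule continuous_on_product_then_coordinatewise)

lemma closed_atomic_moments: "closed (atomic_moments n)"
proof -
  have "closed {w :: nat \<Rightarrow> real. (\<Sum>i\<le>n. w i) = 1}"
    by (intro closed_Collect_eq continuous_on_sum coordinate_continuous_on continuous_on_id continuous_on_const)
  then have "compact (({w :: nat \<Rightarrow> real. \<forall>i. w i \<in> II} \<inter> {w. (\<Sum>i\<le>n. w i) = 1}) \<times> {t :: nat \<Rightarrow> real. \<forall>i. t i \<in> II})"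
    by (intro compact_Times compact_Int_closed compact_cube)
  moreover have "continuous_on S (\<lambda>(w, t). \<lambda>k\<in>{1..n}. \<Sum>i\<le>n. w i * t i ^ k :: real)" for S :: "((nat \<Rightarrow> real) \<times> (nat \<Rightarrow> real)) set"
    unfolding case_prod_beta
  proof (rule continuous_on_coordinatewise_then_product)
    fix k show "continuous_on S (\<lambda>p. (\<lambda>k\<in>{1..n}. \<Sum>i\<le>n. fst p i * snd p i ^ k :: real) k)"
    proof (cases "k \<in> {1..n}")
      case True
      then have "(\<lambda>p. (\<lambda>k\<in>{1..n}. \<Sum>i\<le>n. fst p i * snd p i ^ k :: real) k) =
        (\<lambda>p::(nat \<Rightarrow> real) \<times> (nat \<Rightarrow> real). \<Sum>i\<le>n. fst p i * snd p i ^ k)" by simp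
      then show ?thesis
        by (simp only:) (intro continuous_on_sum continuous_on_mult continuous_on_power coordinate_continuous_on
          continuous_on_fst continuous_on_snd continuous_on_id)
    next
      case False
      then have "(\<lambda>p. (\<lambda>k\<in>{1..n}. \<Sum>i\<le>n. fst p i * snd p i ^ k :: real) k) =
        (\<lambda>p::(nat \<Rightarrow> real) \<times> (nat \<Rightarrow> real). undefined)" by auto
      then show ?thesis by (simp only: continuous_on_const)
    qed
  qed
  ultimately show ?thesis unfolding atomic_moments_def
    by (intro compact_imp_closed compact_continuous_image)
qed

lemma atomic_moments_subset: "atomic_moments n \<subseteq> moment_space n"
proof
  fix x assume "x \<in> atomic_moments n"
  then obtain w t where w: "\<And>i. w i \<in> II" "(\<Sum>i\<le>n. w i) = 1" and t: "\<And>i. t i \<in> II"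
    and x: "x = (\<lambda>k\<in>{1..n}. \<Sum>i\<le>n. w i * t i ^ k)" unfolding atomic_moments_def by auto
  define P where "P = point_measure {..n} w"
  interpret P: prob_space P unfolding P_def using w by (intro prob_space_point_measure) auto
  have [measurable]: "t \<in> measurable P (restrict_space borel II)"
    unfolding P_def using t by (auto simp: space_restrict_space)
  define \<mu> where "\<mu> = distr P (restrict_space borel II) t"
  have "prob_space \<mu>" unfolding \<mu>_def by (rule P.prob_space_distr) measurable
  moreover have "sets \<mu> = sets (restrict_space borel II)" by (simp add: \<mu>_def)
  moreover have "(\<integral>s. s ^ k \<partial>\<mu>) = (\<Sum>i\<le>n. w i * t i ^ k)" for k
  proof -
    have "(\<lambda>s. s ^ k :: real) \<in> borel_measurable (restrict_space borel II)"
      by (intro measurable_restrict_space1) measurable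
    then have "(\<integral>s. s ^ k \<partial>\<mu>) = (\<integral>i. t i ^ k \<partial>P)"
      unfolding \<mu>_def by (rule integral_distr[OF \<open>t \<in> measurable P (restrict_space borel II)\<close>])
    also have "\<dots> = (\<Sum>i\<le>n. w i * t i ^ k)" unfolding P_def
      using w by (subst lebesgue_integral_point_measure_finite) auto
    finally show ?thesis .
  qed
  then have "x = (\<lambda>i\<in>{1..n}. \<integral>s. s ^ i \<partial>\<mu>)" by (simp add: x)
  ultimately show "x \<in> moment_space n" unfolding moment_space_def by blast
qed

lemma moment_fun_zz_power: "1 \<le> k \<Longrightarrow> moment_fun x (z_poly ^ (2 * k)) = x k"
proof -
  assume "1 \<le> k"
  have m: "z_poly ^ (2 * k) = monom 1 (2 * k)"
    by (rule poly_ext) (simp add: poly_monom)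
  have "moment_fun x (monom 1 (2 * k)) = (\<Sum>i\<le>k. coeff (monom 1 (2 * k)) (2 * i) * (if i = 0 then 1 else x i))"
    by (rule moment_fun_eq) (simp add: degree_monom_eq)
  also have "\<dots> = (\<Sum>i\<le>k. if i = k then x k else 0)"
    using \<open>1 \<le> k\<close> by (intro sum.cong) auto
  finally show ?thesis using m by simp
qed

text \<open>The quadrature nodes z become atoms at t = z^2. Testing on 1 gives total mass 1, and
  testing on z^(2k) gives the k-th moment.\<close>

lemma canonical_imp_atomic:
  assumes "canonical x n" shows "restrict x {1..n} \<in> atomic_moments n"
proof -
  obtain R c where R: "finite R" "card R = Suc n" "R \<subseteq> {-1<..<1}" "\<And>z. z \<in> R \<Longrightarrow> c z > (0::real)"
    and q: "\<And>p. degree p \<le> 2 * n + 1 \<Longrightarrow> moment_fun x p = (\<Sum>z\<in>R. c z * poly p z)"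
    using canonical_quadrature[OF assms] by blast
  obtain h where "bij_betw h {0..<card R} R" using ex_bij_betw_nat_finite[OF R(1)] by blast
  then have h: "bij_betw h {..n} R" using R(2) by (simp add: atLeast0LessThan lessThan_Suc_atMost)
  have hR: "h i \<in> R" if "i \<le> n" for i using h that by (auto simp: bij_betw_def)
  have sum_h: "(\<Sum>z\<in>R. f z) = (\<Sum>i\<le>n. f (h i))" for f :: "real \<Rightarrow> real"
    using sum.reindex_bij_betw[OF h, of f] by simp
  define w t where "w = (\<lambda>i. if i \<le> n then c (h i) else 0)" and "t = (\<lambda>i. if i \<le> n then (h i)\<^sup>2 else 0)"
  have s1: "(\<Sum>i\<le>n. w i) = 1" using q[of 1] by (simp add: sum_h w_def)
  have w0: "w i \<ge> 0" for i using R(4)[OF hR] by (auto simp: w_def less_imp_le)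
  have "w i \<le> 1" for i
  proof (cases "i \<le> n")
    case True
    then have "w i \<le> (\<Sum>i\<le>n. w i)" by (intro member_le_sum) (auto simp: w0)
    then show ?thesis using s1 by simp
  qed (simp add: w_def)
  moreover have "t i \<in> II" for i
  proof (cases "i \<le> n")
    case True
    then have "\<bar>h i\<bar> < 1" using hR[OF True] R(3) by (auto simp: abs_less_iff)
    then have "(h i)\<^sup>2 \<le> 1" by (simp add: abs_square_le_1)
    then show ?thesis using True by (simp add: t_def)
  qed (simp add: t_def)
  moreover have "x k = (\<Sum>i\<le>n. w i * t i ^ k)" if k: "1 \<le> k" "k \<le> n" for k
  proof -
    have "degree (z_poly ^ (2 * k)) \<le> 2 * n + 1"
      using degree_power_le[of z_poly "2 * k"] k by (simp add: z_poly_def)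
    from q[OF this] have "x k = (\<Sum>z\<in>R. c z * poly (z_poly ^ (2 * k)) z)" using moment_fun_zz_power[OF k(1)] by simp
    also have "\<dots> = (\<Sum>i\<le>n. w i * t i ^ k)" unfolding sum_h
      by (rule sum.cong) (auto simp: w_def t_def poly_power power_mult)
    finally show ?thesis .
  qed
  then have "restrict x {1..n} = (\<lambda>k\<in>{1..n}. \<Sum>i\<le>n. w i * t i ^ k)" by (auto simp: restrict_def)
  ultimately show ?thesis unfolding atomic_moments_def using w0 s1
    by (intro image_eqI[of _ _ "(w, t)"]) auto
qed

text \<open>Join x to a canonical point y by a segment. The forms are nonnegative at x and positive
  at y, hence positive inside the segment, so the inner points are canonical and thus atomic;
  closedness gives x itself. In this way the moment space is seen to be closed.\<close>

lemma moment_space_eq_atomic: "moment_space n = atomic_moments n"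
proof
  show "moment_space n \<subseteq> atomic_moments n"
  proof
    fix x assume x: "x \<in> moment_space n"
    obtain y where y: "canonical y n" using canonical_exists by blast
    define g where "g = (\<lambda>a. \<lambda>i\<in>{1..n}. (1 - a) * x i + a * y i)"
    have "continuous_on UNIV g" unfolding g_def
    proof (rule continuous_on_coordinatewise_then_product)
      fix i show "continuous_on UNIV (\<lambda>a. (\<lambda>i\<in>{1..n}. (1 - a) * x i + a * y i) i)"
        by (cases "i \<in> {1..n}") (auto intro!: continuous_intros)
    qed
    then have cl: "closed (g -` atomic_moments n)" by (rule closed_vimage[OF closed_atomic_moments])
    have "g a \<in> atomic_moments n" if a: "a \<in> {0<..<1}" for a
    proof -
      have "canonical (\<lambda>i. (1 - a) * x i + a * y i) n"
      proof (rule positive_imp_canon)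
        fix g :: "real poly" assume g: "g \<noteq> 0"
        show "moment_fun (\<lambda>i. (1 - a) * x i + a * y i) (g * g) > 0" if "degree g \<le> n"
          unfolding moment_fun_convex using a canonical_imp_positive[OF y g] that moment_space_positive(1)[OF x that]
          by (intro add_nonneg_pos mult_pos_pos mult_nonneg_nonneg) auto
        show "moment_fun (\<lambda>i. (1 - a) * x i + a * y i) (w_poly * g * g) > 0" if "degree g < n"
          unfolding moment_fun_convex using a canonical_imp_positive[OF y g] that moment_space_positive(2)[OF x that]
          by (intro add_nonneg_pos mult_pos_pos mult_nonneg_nonneg) auto
      qed
      from canonical_imp_atomic[OF this] show ?thesis by (simp add: g_def)
    qed
    then have "{0<..<1} \<subseteq> g -` atomic_moments n" by auto
    then have "closure {0<..<1} \<subseteq> g -` atomic_moments n" using cl by (rule closure_minimal)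
    moreover have "0 \<in> closure {0<..<1::real}" by simp
    ultimately have "g 0 \<in> atomic_moments n" by blast
    moreover have "g 0 = x" using x by (auto simp: g_def moment_space_def)
    ultimately show "x \<in> atomic_moments n" by simp
  qed
qed (rule atomic_moments_subset)

lemma moment_space_extensional: "moment_space n \<subseteq> space (leb_upto n)"
  by (auto simp: moment_space_def space_PiM)

lemma moment_space_sets [measurable]: "moment_space n \<in> sets (leb_upto n)"
proof -
  \<comment> \<open>Closed sets of the function space with its product topology pull back along the
    identity to measurable sets of the finite product measure space.\<close>
  have "(\<lambda>x. x) \<in> borel_measurable (leb_upto n)"
    by (rule measurable_coordinatewise_then_product) (rule coord_measurable)
  then have "(\<lambda>x. x) -` atomic_moments n \<inter> space (leb_upto n) \<in> sets (leb_upto n)"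
    by (rule measurable_sets) (simp add: closed_atomic_moments)
  moreover have "(\<lambda>x. x) -` atomic_moments n \<inter> space (leb_upto n) = moment_space n"
    using moment_space_eq_atomic moment_space_extensional by auto
  ultimately show ?thesis by simp
qed

lemma moment_space_Suc:
  assumes "x \<in> space (leb_upto n)" "x(Suc n := y) \<in> moment_space (Suc n)"
  shows "x \<in> moment_space n"
proof -
  obtain \<mu> :: "real measure" where \<mu>: "prob_space \<mu>" "sets \<mu> = sets (restrict_space borel II)"
    and x: "x(Suc n := y) = (\<lambda>i\<in>{1..Suc n}. \<integral>t. t ^ i \<partial>\<mu>)" using assms(2) unfolding moment_space_def by blast
  have "x i = (\<lambda>i\<in>{1..n}. \<integral>t. t ^ i \<partial>\<mu>) i" for i
  proof (cases "i \<in> {1..n}")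
    case True
    then show ?thesis using fun_cong[OF x, of i] by auto
  next
    case False
    then show ?thesis using assms(1) by (auto simp: space_PiM PiE_def extensional_def)
  qed
  then have "x = (\<lambda>i\<in>{1..n}. \<integral>t. t ^ i \<partial>\<mu>)" by blast
  then show ?thesis unfolding moment_space_def using \<mu> by blast
qed

text \<open>Over a canonical base point both gaps are nonnegative at a point of the moment space, so
  failing to be canonical means that one of them is 0. Being affine in the last moment with slope 1
  or -1, they leave two exceptional values. Other base points are null by induction.\<close>

lemma emeasure_moment_space_diff:
  "emeasure (leb_upto n) {x \<in> moment_space n. \<not> canonical x n} = 0"
proof (induction n)
  case 0
  have "{x \<in> moment_space 0. \<not> canonical x 0} = {}" by (simp add: canonical_def)
  then show ?case by (metis emeasure_empty)
next
  case (Suc n)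
  define N where "N k = {x \<in> moment_space k. \<not> canonical x k}" for k
  have N: "N k \<in> sets (leb_upto k)" for k
  proof -
    have "{x \<in> space (leb_upto k). x \<in> moment_space k \<and> \<not> canonical x k} \<in> sets (leb_upto k)" by measurable
    moreover have "{x \<in> space (leb_upto k). x \<in> moment_space k \<and> \<not> canonical x k} = N k"
      using moment_space_extensional[of k] by (auto simp: N_def)
    ultimately show ?thesis by metis
  qed
  have ins: "{1..Suc n} = insert (Suc n) {1..n}" by auto
  have "emeasure (leb_upto (Suc n)) (N (Suc n)) = (\<integral>\<^sup>+x. indicator (N (Suc n)) x \<partial>leb_upto (Suc n))"
    using N by simp
  also have "\<dots> = (\<integral>\<^sup>+x. (\<integral>\<^sup>+y. indicator (N (Suc n)) (x(Suc n := y)) \<partial>lborel) \<partial>leb_upto n)"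
    using N[of "Suc n"] unfolding ins by (intro lb.product_nn_integral_insert) auto
  also have "\<dots> = (\<integral>\<^sup>+x. 0 \<partial>leb_upto n)"
  proof (rule nn_integral_cong_AE)
    have "AE x in leb_upto n. x \<notin> N n"
      using Suc N[of n] by (intro AE_not_in) (auto simp: null_sets_def N_def)
    moreover have "AE x in leb_upto n. x \<in> space (leb_upto n)" by (rule AE_space)
    ultimately show "AE x in leb_upto n. (\<integral>\<^sup>+y. indicator (N (Suc n)) (x(Suc n := y)) \<partial>lborel) = 0"
    proof eventually_elim
      case (elim x)
      define c l where "c = lower_gap (x(Suc n := 0)) n" and "l = upper_gap (x(Suc n := 0)) n"
      have "x(Suc n := y) \<notin> N (Suc n)" if y: "y \<noteq> - c" "y \<noteq> l" for y
      proof
        let ?x = "x(Suc n := y)"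
        assume a: "?x \<in> N (Suc n)"
        then have M: "?x \<in> moment_space (Suc n)" and nc: "\<not> canonical ?x (Suc n)" by (auto simp: N_def)
        have "x \<in> moment_space n" by (rule moment_space_Suc[OF elim(2) M])
        then have can: "canonical x n" using elim(1) by (simp add: N_def)
        have "canonical ?x n = canonical x n" by (rule canonical_cong) simp
        then have can': "canonical ?x n" using can by simp
        have "lower_gap ?x n \<ge> 0" unfolding lower_gap_def by (rule moment_space_positive(1)[OF M degree_Ap])
        moreover have "upper_gap ?x n \<ge> 0" unfolding upper_gap_def
          by (rule moment_space_positive(2)[OF M]) (use degree_Bp[of ?x n] in simp)
        moreover have "lower_gap ?x n = c + y" "upper_gap ?x n = l - y"
          using uv_upd(1)[OF can, of y] uv_upd(2)[OF can, of y] by (simp_all add: c_def l_def)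
        ultimately have "lower_gap ?x n > 0" "upper_gap ?x n > 0" using y by linarith+
        then show False using nc can' by (simp add: canonical_Suc)
      qed
      then have *: "indicator (N (Suc n)) (x(Suc n := y)) = (0::ennreal)" if "y \<noteq> - c \<and> y \<noteq> l" for y
        using that by (simp add: indicator_def)
      have "AE y in lborel. y \<noteq> - c \<and> y \<noteq> l"
        using AE_lborel_singleton[of "- c"] AE_lborel_singleton[of l] by eventually_elim simp
      then have "AE y in lborel. indicator (N (Suc n)) (x(Suc n := y)) = (0::ennreal)"
        by (rule eventually_mono) (rule *)
      then have "(\<integral>\<^sup>+y. indicator (N (Suc n)) (x(Suc n := y)) \<partial>lborel) = (\<integral>\<^sup>+y. 0 \<partial>(lborel :: real measure))"
        by (rule nn_integral_cong_AE)
      then show ?case by simp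
    qed
  qed
  finally show ?case by (simp add: N_def)
qed

lemma Vol_moment_space_eq: "Vol_moment_space n = (\<Prod>j<n. beta_int j)"
proof -
  let ?C = "{x \<in> space (leb_upto n). canonical x n}"
  have C: "?C \<in> sets (leb_upto n)" by measurable
  have sub: "?C \<subseteq> moment_space n"
  proof
    fix x assume x: "x \<in> ?C"
    then have "restrict x {1..n} = x" by (auto simp: space_PiM PiE_def intro: extensional_restrict)
    then show "x \<in> moment_space n" using canonical_imp_atomic[of x n] x moment_space_eq_atomic by auto
  qed
  have D: "moment_space n - ?C = {x \<in> moment_space n. \<not> canonical x n}"
    using moment_space_extensional[of n] by auto
  have "emeasure (leb_upto n) (moment_space n) = emeasure (leb_upto n) ?C + emeasure (leb_upto n) (moment_space n - ?C)"
  proof -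
    have "moment_space n = ?C \<union> (moment_space n - ?C)" using sub by blast
    moreover have "emeasure (leb_upto n) (?C \<union> (moment_space n - ?C)) = emeasure (leb_upto n) ?C + emeasure (leb_upto n) (moment_space n - ?C)"
      by (rule plus_emeasure[symmetric]) (use C moment_space_sets[of n] in auto)
    ultimately show ?thesis by metis
  qed
  also have "\<dots> = emeasure (leb_upto n) ?C" unfolding D emeasure_moment_space_diff by simp
  also have "\<dots> = (\<integral>\<^sup>+x. indicator ?C x \<partial>leb_upto n)" using C by simp
  also have "\<dots> = (\<integral>\<^sup>+x. range_power n 0 x \<partial>leb_upto n)"
    by (rule nn_integral_cong) (auto simp: range_power_def indicator_def)
  also have "\<dots> = ennreal (\<Prod>j<n. beta_int j)" by (simp only: range_power_integral add_0)
  finally show ?thesis unfolding Vol_moment_space_def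
    by (simp add: measure_def prod_nonneg beta_int_pos less_imp_le)
qed

section \<open>Hermite interpolation and integrals over the cube\<close>

lemma double_root_dvd:
  fixes p :: "real poly"
  assumes "poly p a = 0" "poly (pderiv p) a = 0"
  shows "[:- a, 1:]\<^sup>2 dvd p"
proof -
  obtain q where q: "p = [:- a, 1:] * q" using assms(1) poly_eq_0_iff_dvd by (metis dvdE)
  have "poly (pderiv p) a = poly q a" unfolding q pderiv_mult by (simp add: pderiv_pCons)
  then obtain s where s: "q = [:- a, 1:] * s" using assms(2) poly_eq_0_iff_dvd by (metis dvdE)
  show ?thesis unfolding q s power2_eq_square by (simp only: mult.assoc[symmetric] dvd_triv_left)
qed

lemma double_root_mult:
  fixes p :: "real poly"
  assumes "poly q a = 0" "poly (pderiv q) a = 0"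
  shows "poly (p * q) a = 0" "poly (pderiv (p * q)) a = 0"
  using assms by (simp_all add: pderiv_mult)

lemma square_double_root: "poly ([:- a, 1:]\<^sup>2) a = (0::real)" "poly (pderiv ([:- a, 1:]\<^sup>2)) a = (0::real)"
  by (simp_all add: power2_eq_square pderiv_mult pderiv_pCons)

lemma prod_double_roots_dvd:
  fixes p :: "real poly"
  assumes "finite A" "inj_on t A" "\<And>j. j \<in> A \<Longrightarrow> poly p (t j) = 0" "\<And>j. j \<in> A \<Longrightarrow> poly (pderiv p) (t j) = 0"
  shows "(\<Prod>j\<in>A. [:- t j, 1:]\<^sup>2) dvd p"
  using assms
proof (induction A rule: finite_induct)
  case (insert k A)
  define P where "P = (\<Prod>j\<in>A. [:- t j, 1:]\<^sup>2)"
  have "P dvd p" unfolding P_def using insert by (intro insert.IH) (auto simp: inj_on_def)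
  then obtain q where q: "p = P * q" by (elim dvdE)
  have P0: "poly P (t k) \<noteq> 0" unfolding P_def poly_prod using insert by (auto simp: prod_zero_iff inj_on_def)
  have "poly q (t k) = 0" using insert.prems(2)[of k] P0 by (simp add: q)
  moreover have "poly (pderiv q) (t k) = 0"
    using insert.prems(3)[of k] P0 \<open>poly q (t k) = 0\<close> by (simp add: q pderiv_mult)
  ultimately have "[:- t k, 1:]\<^sup>2 dvd q" by (rule double_root_dvd)
  then show ?case unfolding prod.insert[OF insert(1,2)] q P_def[symmetric]
    by (subst mult.commute) (intro mult_dvd_mono dvd_refl)
qed simp

lemma dvd_r_iff: "[:0, -1, 1:] dvd p \<longleftrightarrow> poly p 0 = 0 \<and> poly p (1::real) = 0"
proof
  assume "poly p 0 = 0 \<and> poly p 1 = 0"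
  then have 0: "[:- 0, 1:] dvd p" and 1: "poly p 1 = 0" by (simp_all only: poly_eq_0_iff_dvd)
  then obtain q where q: "p = [:- 0, 1:] * q" by (elim dvdE)
  then have "poly q 1 = 0" using 1 by simp
  then obtain s where s: "q = [:- 1, 1:] * s" using poly_eq_0_iff_dvd by (metis dvdE)
  have "p = [:0, -1, 1:] * s" unfolding q s by (rule poly_ext) (simp add: algebra_simps)
  then show "[:0, -1, 1:] dvd p" by (rule dvdI)
qed (auto elim!: dvdE)

text \<open>The pairs are ordered, so each difference occurs to the fourth power: this is the fourth
  power of the Vandermonde product. Arbitrary finite index sets permit the removal of a
  node.\<close>

definition discr_sq :: "nat set \<Rightarrow> (nat \<Rightarrow> real) \<Rightarrow> real" where
  "discr_sq A t = (\<Prod>i\<in>A. \<Prod>j\<in>A - {i}. (t i - t j)\<^sup>2)"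

text \<open>A Selberg density for double nodes t_i and simple nodes at the roots of e. The recursion
  uses e = 1, e = z and e = z^2 - z; the last one gives W.\<close>

definition weight :: "real poly \<Rightarrow> nat set \<Rightarrow> (nat \<Rightarrow> real) \<Rightarrow> real" where
  "weight e A t = discr_sq A t * (\<Prod>i\<in>A. (poly e (t i))\<^sup>2)"

definition node_poly :: "real poly \<Rightarrow> nat set \<Rightarrow> (nat \<Rightarrow> real) \<Rightarrow> real poly" where
  "node_poly e B t = e * (\<Prod>i\<in>B. [:- t i, 1:]\<^sup>2)"

lemma poly_node_poly: "poly (node_poly e B t) s = poly e s * (\<Prod>i\<in>B. (s - t i)\<^sup>2)"
  by (simp add: node_poly_def poly_prod)

lemma discr_sq_insert:
  assumes "finite B" "k \<notin> B"
  shows "discr_sq (insert k B) t = discr_sq B t * (\<Prod>i\<in>B. (t k - t i)\<^sup>2)\<^sup>2"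
proof -
  have "(\<Prod>j\<in>insert k B - {i}. (t i - t j)\<^sup>2) = (t k - t i)\<^sup>2 * (\<Prod>j\<in>B - {i}. (t i - t j)\<^sup>2)" if "i \<in> B" for i
  proof -
    have "insert k B - {i} = insert k (B - {i})" using that assms by auto
    then show ?thesis using assms by (simp add: power2_commute)
  qed
  then have "discr_sq (insert k B) t
      = (\<Prod>j\<in>B. (t k - t j)\<^sup>2) * (\<Prod>i\<in>B. (t k - t i)\<^sup>2 * (\<Prod>j\<in>B - {i}. (t i - t j)\<^sup>2))"
    unfolding discr_sq_def prod.insert[OF assms] using assms by simp
  then show ?thesis by (simp add: discr_sq_def prod.distrib power2_eq_square mult_ac)
qed

text \<open>The node k contributes the node polynomial twice. The interpolation terms keep one
  factor at \<open>t k\<close> and evaluate the other at r, which is why no denominators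
  arise.\<close>

lemma weight_insert:
  assumes "finite B" "k \<notin> B"
  shows "weight e (insert k B) t = weight e B t * (poly (node_poly e B t) (t k))\<^sup>2"
  by (simp add: weight_def discr_sq_insert[OF assms] assms poly_node_poly power_mult_distrib mult_ac)

lemma discr_sq_eq_0:
  assumes "finite A" "discr_sq A t = 0" obtains i j where "i \<in> A" "j \<in> A" "i \<noteq> j" "t i = t j"
  using assms by (auto simp: discr_sq_def prod_zero_iff)

text \<open>With B = A - {j} this is the polynomial g_j, its variable s standing for t_j. It
  vanishes at the roots of e.\<close>

definition hermite_term :: "real poly \<Rightarrow> nat set \<Rightarrow> real \<Rightarrow> (nat \<Rightarrow> real) \<Rightarrow> real poly" where
  "hermite_term e B r t = smult (weight e B t * poly (node_poly e B t) r) ([:r, -1:] * node_poly e B t)"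

lemma poly_gam: "poly (hermite_term e B r t) s
    = weight e B t * poly (node_poly e B t) r * ((r - s) * poly (node_poly e B t) s)"
  by (simp add: hermite_term_def algebra_simps)

lemma poly_pderiv_gam: "poly (pderiv (hermite_term e B r t)) s
    = weight e B t * poly (node_poly e B t) r *
      ((r - s) * poly (pderiv (node_poly e B t)) s - poly (node_poly e B t) s)"
  unfolding hermite_term_def pderiv_smult pderiv_mult by (simp add: pderiv_pCons algebra_simps)

lemma node_poly_double_root:
  assumes "finite B" "i \<in> B" "t i = s"
  shows "poly (node_poly e B t) s = 0" "poly (pderiv (node_poly e B t)) s = 0"
proof -
  have "node_poly e B t = (e * (\<Prod>i\<in>B - {i}. [:- t i, 1:]\<^sup>2)) * [:- s, 1:]\<^sup>2"
    unfolding node_poly_def prod.remove[OF assms(1,2)] using assms(3) by (simp only: mult_ac)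
  then show "poly (node_poly e B t) s = 0" "poly (pderiv (node_poly e B t)) s = 0"
    using double_root_mult[OF square_double_root, where a = s] by (simp_all only:)
qed

lemma degree_node_poly: "finite B \<Longrightarrow> degree (node_poly e B t) \<le> degree e + 2 * card B"
proof -
  assume "finite B"
  have "degree (\<Prod>i\<in>B. [:- t i, 1:]\<^sup>2) \<le> sum (degree \<circ> (\<lambda>i. [:- t i, 1:]\<^sup>2)) B"
    by (rule degree_prod_sum_le) fact
  also have "\<dots> = (\<Sum>i\<in>B. 2)" by (rule sum.cong) (auto simp: degree_power_eq)
  finally show ?thesis unfolding node_poly_def
    using degree_mult_le[of e "\<Prod>i\<in>B. [:- t i, 1:]\<^sup>2"] by simp
qed

lemma degree_gam: "finite B \<Longrightarrow> degree (hermite_term e B r t) \<le> degree e + 2 * card B + 1"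
  unfolding hermite_term_def
  using degree_node_poly[of B e t] degree_mult_le[of "[:r, -1:]" "node_poly e B t"]
  by (intro order.trans[OF degree_smult_le]) (auto split: if_splits)

lemma pderiv_sum: "pderiv (\<Sum>i\<in>A. f i) = (\<Sum>i\<in>A. pderiv (f i))"
  by (induction A rule: infinite_finite_induct) (auto simp: pderiv_add)

text \<open>The interpolation formula at the double nodes \<open>t j\<close> (and at the roots of \<open>e\<close>, where the
  difference vanishes by assumption), multiplied by the weight so that no division occurs.\<close>
lemma Hermite_interpolation:
  fixes f X e :: "real poly"
  assumes A: "finite A" and e: "e \<noteq> 0" "\<And>j. j \<in> A \<Longrightarrow> poly e (t j) \<noteq> 0"
    and X: "\<And>j. j \<in> A \<Longrightarrow> poly X (t j) = 0" "\<And>j. j \<in> A \<Longrightarrow> poly (pderiv X) (t j) = 0"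
    and X0: "discr_sq A t = 0 \<Longrightarrow> poly X r = 0"
    and edvd: "e dvd smult (weight e A t) f - X"
    and deg: "degree (smult (weight e A t) f - X) < 2 * card A + degree e"
  shows "poly f r * weight e A t = poly X r +
    (\<Sum>j\<in>A. poly (pderiv f) (t j) * poly (hermite_term e (A - {j}) r t) (t j)
         - poly f (t j) * poly (pderiv (hermite_term e (A - {j}) r t)) (t j))"
proof (cases "discr_sq A t = 0")
  case True
  then have "weight e A t = 0" by (simp add: weight_def)
  moreover obtain a b where ab: "a \<in> A" "b \<in> A" "a \<noteq> b" "t a = t b"
    using discr_sq_eq_0[OF A True] by blast
  \<comment> \<open>Nodes a and b coincide. If j is one of them, the other makes \<open>t j\<close>
    a double zero of the node polynomial; otherwise both remain in A - {j} and the weight there is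
    0.\<close>
  have "poly (hermite_term e (A - {j}) r t) (t j) = 0 \<and> poly (pderiv (hermite_term e (A - {j}) r t)) (t j) = 0" if "j \<in> A" for j
  proof (cases "j = a \<or> j = b")
    case True
    then obtain i where "i \<in> A - {j}" "t i = t j"
    proof
      assume "j = a" then show ?thesis using ab that[of b] by auto
    next
      assume "j = b" then show ?thesis using ab that[of a] by auto
    qed
    then show ?thesis using node_poly_double_root[of "A - {j}" i t "t j" e] A
      by (simp add: poly_gam poly_pderiv_gam)
  next
    case False
    have "(\<Prod>i\<in>A - {j} - {a}. (t a - t i)\<^sup>2) = 0"
      by (rule prod_zero) (use ab A False in \<open>auto intro!: bexI[of _ b]\<close>)
    moreover have "a \<in> A - {j}" using ab False by simp
    ultimately have "discr_sq (A - {j}) t = 0" unfolding discr_sq_def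
      using A by (meson finite_Diff prod_zero)
    then show ?thesis by (simp add: poly_gam poly_pderiv_gam weight_def)
  qed
  ultimately show ?thesis using X0[OF True] by simp
next
  case False
  then have inj: "inj_on t A" unfolding discr_sq_def inj_on_def using A by (auto simp: prod_zero_iff)
  \<comment> \<open>Let N be the node polynomial without j. The linear factor is N(t_j)^2 times the
    first-order Taylor polynomial of f / N at t_j. So \<open>T j\<close> has the value and slope of
    the weighted f at t_j, and double zeros at the other nodes.\<close>
  define T where "T j = smult (weight e (A - {j}) t) (node_poly e (A - {j}) t *
      [:poly f (t j) * poly (node_poly e (A - {j}) t) (t j)
        - t j * (poly (pderiv f) (t j) * poly (node_poly e (A - {j}) t) (t j)
            - poly f (t j) * poly (pderiv (node_poly e (A - {j}) t)) (t j)),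
        poly (pderiv f) (t j) * poly (node_poly e (A - {j}) t) (t j)
            - poly f (t j) * poly (pderiv (node_poly e (A - {j}) t)) (t j):])" for j
  have T_r: "poly (T j) r = poly (pderiv f) (t j) * poly (hermite_term e (A - {j}) r t) (t j)
         - poly f (t j) * poly (pderiv (hermite_term e (A - {j}) r t)) (t j)" for j
    unfolding T_def poly_gam poly_pderiv_gam by (simp add: algebra_simps)
  have W: "weight e A t = weight e (A - {k}) t * (poly (node_poly e (A - {k}) t) (t k))\<^sup>2" if "k \<in> A" for k
    using weight_insert[of "A - {k}" k e t] A that by (simp add: insert_absorb)
  have T_diag: "poly (T k) (t k) = poly f (t k) * weight e A t"
      "poly (pderiv (T k)) (t k) = poly (pderiv f) (t k) * weight e A t" if "k \<in> A" for k
    unfolding W[OF that] T_def pderiv_smult pderiv_mult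
    by (simp_all add: pderiv_pCons power2_eq_square algebra_simps)
  have T_off: "poly (T j) (t k) = 0" "poly (pderiv (T j)) (t k) = 0" if "k \<in> A" "j \<noteq> k" for j k
    using node_poly_double_root[of "A - {j}" k t "t k" e] A that
    unfolding T_def pderiv_smult pderiv_mult by simp_all
  \<comment> \<open>The interpolation error. It is divisible by e and by every (x - t_j)^2, hence by
    a polynomial of degree 2 \<open>card A\<close> + \<open>degree e\<close>, which is more than its
    own degree allows.\<close>
  define D where "D = smult (weight e A t) f - X - (\<Sum>j\<in>A. T j)"
  have sumT: "poly (\<Sum>j\<in>A. T j) (t k) = poly f (t k) * weight e A t"
      "poly (pderiv (\<Sum>j\<in>A. T j)) (t k) = poly (pderiv f) (t k) * weight e A t" if k: "k \<in> A" for k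
  proof -
    have "(\<Sum>j\<in>A. poly (T j) (t k)) = (\<Sum>j\<in>A. if j = k then poly f (t k) * weight e A t else 0)"
      by (rule sum.cong) (auto simp: T_off(1)[OF k] T_diag(1)[OF k])
    then show "poly (\<Sum>j\<in>A. T j) (t k) = poly f (t k) * weight e A t" using A k by (simp add: poly_sum)
    have "(\<Sum>j\<in>A. poly (pderiv (T j)) (t k)) = (\<Sum>j\<in>A. if j = k then poly (pderiv f) (t k) * weight e A t else 0)"
      by (rule sum.cong) (auto simp: T_off(2)[OF k] T_diag(2)[OF k])
    then show "poly (pderiv (\<Sum>j\<in>A. T j)) (t k) = poly (pderiv f) (t k) * weight e A t"
      using A k by (simp add: poly_sum pderiv_sum)
  qed
  have D0: "poly D (t k) = 0" "poly (pderiv D) (t k) = 0" if "k \<in> A" for k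
    using sumT[OF that] X(1)[OF that] X(2)[OF that] by (simp_all add: D_def pderiv_diff pderiv_smult)
  have "e dvd (\<Sum>j\<in>A. T j)"
  proof (rule dvd_sum)
    fix j
    have "e dvd node_poly e (A - {j}) t" by (simp add: node_poly_def)
    then show "e dvd T j" unfolding T_def by (intro dvd_smult dvd_mult2)
  qed
  then have "e dvd D" unfolding D_def using edvd by (rule dvd_diff[rotated])
  then obtain D1 where D1: "D = e * D1" by (elim dvdE)
  have D10: "poly D1 (t k) = 0" if "k \<in> A" for k using D0(1)[OF that] e(2)[OF that] by (simp add: D1)
  have "poly (pderiv D1) (t k) = 0" if "k \<in> A" for k
    using D0(2)[OF that] e(2)[OF that] D10[OF that] by (simp add: D1 pderiv_mult)
  then have dvd: "(\<Prod>j\<in>A. [:- t j, 1:]\<^sup>2) dvd D1" by (intro prod_double_roots_dvd A inj D10)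
  have "D1 = 0"
  proof (rule ccontr)
    assume D1n: "D1 \<noteq> 0"
    have "degree (\<Prod>j\<in>A. [:- t j, 1:]\<^sup>2) = (\<Sum>j\<in>A. degree ([:- t j, 1:]\<^sup>2))"
      by (rule degree_prod_sum_eq) auto
    also have "\<dots> = 2 * card A" by (simp add: degree_power_eq)
    finally have "2 * card A \<le> degree D1" using dvd_imp_degree_le[OF dvd D1n] by simp
    then have 1: "2 * card A + degree e \<le> degree D" using D1n e(1) by (simp add: D1 degree_mult_eq)
    have "degree (T j) \<le> 2 * card A + degree e - 1" if "j \<in> A" for j
    proof -
      have c: "card A = Suc (card (A - {j}))" using A that by (metis card_Suc_Diff1)
      show ?thesis unfolding T_def using degree_node_poly[of "A - {j}" e t] A c
        by (intro order.trans[OF degree_smult_le] order.trans[OF degree_mult_le]) auto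
    qed
    then have "degree (\<Sum>j\<in>A. T j) \<le> 2 * card A + degree e - 1" by (intro degree_sum_le A)
    then have "degree D \<le> 2 * card A + degree e - 1" unfolding D_def
      using deg by (intro degree_diff_le[where p = "smult (weight e A t) f - X"]) simp_all
    then show False using 1 deg by linarith
  qed
  then have "poly D r = 0" by (simp add: D1)
  then show ?thesis by (simp add: D_def poly_sum T_r algebra_simps)
qed

section \<open>Integration over the unit cube\<close>

definition cube_int :: "nat set \<Rightarrow> ((nat \<Rightarrow> real) \<Rightarrow> real) \<Rightarrow> real" where
  "cube_int A f = (LINT t : (A \<rightarrow>\<^sub>E II) | leb_on A. f t)"

text \<open>A sufficient condition for integrability over the cube that is closed under the ring
  operations and holds for coordinates.\<close>

definition cube_bounded :: "nat set \<Rightarrow> ((nat \<Rightarrow> real) \<Rightarrow> real) \<Rightarrow> bool" where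
  "cube_bounded A f \<longleftrightarrow> f \<in> borel_measurable (leb_on A) \<and> (\<exists>C. \<forall>t\<in>A \<rightarrow>\<^sub>E II. \<bar>f t\<bar> \<le> C)"

lemma cube_bounded_const: "cube_bounded A (\<lambda>t. c)"
  by (auto simp: cube_bounded_def)

lemma cube_bounded_coord: "i \<in> A \<Longrightarrow> cube_bounded A (\<lambda>t. t i)"
proof -
  assume i: "i \<in> A"
  have "\<bar>t i\<bar> \<le> 1" if "t \<in> A \<rightarrow>\<^sub>E II" for t
  proof -
    have "t i \<in> II" using PiE_mem[OF that i] .
    then show ?thesis by simp
  qed
  then show ?thesis unfolding cube_bounded_def using coord_measurable by blast
qed

lemma cube_bounded_add: assumes "cube_bounded A f" "cube_bounded A g" shows "cube_bounded A (\<lambda>t. f t + g t)"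
proof -
  obtain C D where "\<forall>t\<in>A \<rightarrow>\<^sub>E II. \<bar>f t\<bar> \<le> C" "\<forall>t\<in>A \<rightarrow>\<^sub>E II. \<bar>g t\<bar> \<le> D"
    using assms by (auto simp: cube_bounded_def)
  then have "\<forall>t\<in>A \<rightarrow>\<^sub>E II. \<bar>f t + g t\<bar> \<le> C + D"
    by (meson abs_triangle_ineq add_mono order.trans)
  then show ?thesis using assms by (auto simp: cube_bounded_def)
qed

lemma cube_bounded_mult: assumes "cube_bounded A f" "cube_bounded A g" shows "cube_bounded A (\<lambda>t. f t * g t)"
proof -
  obtain C D where CD: "\<forall>t\<in>A \<rightarrow>\<^sub>E II. \<bar>f t\<bar> \<le> C" "\<forall>t\<in>A \<rightarrow>\<^sub>E II. \<bar>g t\<bar> \<le> D"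
    using assms by (auto simp: cube_bounded_def)
  have "\<forall>t\<in>A \<rightarrow>\<^sub>E II. \<bar>f t * g t\<bar> \<le> \<bar>C\<bar> * \<bar>D\<bar>"
  proof
    fix t assume "t \<in> A \<rightarrow>\<^sub>E II"
    then have "\<bar>f t\<bar> \<le> C" "\<bar>g t\<bar> \<le> D" using CD by auto
    then have "\<bar>f t\<bar> \<le> \<bar>C\<bar>" "\<bar>g t\<bar> \<le> \<bar>D\<bar>" by linarith+
    then show "\<bar>f t * g t\<bar> \<le> \<bar>C\<bar> * \<bar>D\<bar>" unfolding abs_mult by (intro mult_mono) auto
  qed
  then show ?thesis using assms by (auto simp: cube_bounded_def)
qed

lemma cube_bounded_diff: assumes "cube_bounded A f" "cube_bounded A g" shows "cube_bounded A (\<lambda>t. f t - g t)"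
  using cube_bounded_add[OF assms(1) cube_bounded_mult[OF cube_bounded_const[of A "-1"] assms(2)]] by simp

lemma cube_bounded_sum: "(\<And>i. i \<in> I \<Longrightarrow> cube_bounded A (f i)) \<Longrightarrow> cube_bounded A (\<lambda>t. \<Sum>i\<in>I. f i t)"
  by (induction I rule: infinite_finite_induct) (auto intro: cube_bounded_const cube_bounded_add)

lemma cube_bounded_prod: "(\<And>i. i \<in> I \<Longrightarrow> cube_bounded A (f i)) \<Longrightarrow> cube_bounded A (\<lambda>t. \<Prod>i\<in>I. f i t)"
  by (induction I rule: infinite_finite_induct) (auto intro: cube_bounded_const cube_bounded_mult)

lemma cube_bounded_power: "cube_bounded A f \<Longrightarrow> cube_bounded A (\<lambda>t. f t ^ k)"
  by (induction k) (auto intro: cube_bounded_const cube_bounded_mult)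

lemmas cube_bounded_intros = cube_bounded_const cube_bounded_coord cube_bounded_add cube_bounded_mult cube_bounded_diff cube_bounded_sum cube_bounded_prod cube_bounded_power

text \<open>The degree bound uniform in t turns evaluating or integrating such a polynomial into a
  sum of fixed finite length.\<close>

definition coeffs_bounded :: "nat set \<Rightarrow> ((nat \<Rightarrow> real) \<Rightarrow> real poly) \<Rightarrow> bool" where
  "coeffs_bounded A q \<longleftrightarrow> (\<forall>i. cube_bounded A (\<lambda>t. coeff (q t) i)) \<and> (\<exists>D. \<forall>t. degree (q t) \<le> D)"

lemma coeffs_bounded_const: "coeffs_bounded A (\<lambda>t. p)"
  by (auto simp: coeffs_bounded_def intro: cube_bounded_const)

lemma coeffs_bounded_linear: "cube_bounded A f \<Longrightarrow> cube_bounded A g \<Longrightarrow> coeffs_bounded A (\<lambda>t. [:f t, g t:])"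
proof -
  assume fg: "cube_bounded A f" "cube_bounded A g"
  have "cube_bounded A (\<lambda>t. coeff [:f t, g t:] i)" for i
  proof -
    consider "i = 0" | "i = 1" | k where "i = Suc (Suc k)" by (metis One_nat_def not0_implies_Suc)
    then show ?thesis using fg by cases (simp_all add: cube_bounded_const)
  qed
  then show ?thesis by (auto simp: coeffs_bounded_def intro!: exI[of _ 1])
qed

lemma coeffs_bounded_mult: assumes "coeffs_bounded A p" "coeffs_bounded A q" shows "coeffs_bounded A (\<lambda>t. p t * q t)"
proof -
  obtain C D where "\<forall>t. degree (p t) \<le> C" "\<forall>t. degree (q t) \<le> D" using assms by (auto simp: coeffs_bounded_def)
  then have "\<forall>t. degree (p t * q t) \<le> C + D" by (meson add_mono degree_mult_le order.trans)
  then show ?thesis using assms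
    by (auto simp: coeffs_bounded_def coeff_mult intro!: cube_bounded_sum cube_bounded_mult)
qed

lemma coeffs_bounded_diff: assumes "coeffs_bounded A p" "coeffs_bounded A q" shows "coeffs_bounded A (\<lambda>t. p t - q t)"
proof -
  obtain C D where "\<forall>t. degree (p t) \<le> C" "\<forall>t. degree (q t) \<le> D" using assms by (auto simp: coeffs_bounded_def)
  then have "\<forall>t. degree (p t - q t) \<le> max C D" by (intro allI degree_diff_le) (auto simp: le_max_iff_disj)
  then show ?thesis using assms by (auto simp: coeffs_bounded_def intro!: cube_bounded_diff)
qed

lemma coeffs_bounded_prod: "(\<And>i. i \<in> I \<Longrightarrow> coeffs_bounded A (f i)) \<Longrightarrow> coeffs_bounded A (\<lambda>t. \<Prod>i\<in>I. f i t)"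
  by (induction I rule: infinite_finite_induct) (auto intro: coeffs_bounded_const coeffs_bounded_mult)

lemma coeffs_bounded_power: "coeffs_bounded A f \<Longrightarrow> coeffs_bounded A (\<lambda>t. f t ^ k)"
  by (induction k) (auto intro: coeffs_bounded_const coeffs_bounded_mult)

lemma coeffs_bounded_smult: "cube_bounded A c \<Longrightarrow> coeffs_bounded A p \<Longrightarrow> coeffs_bounded A (\<lambda>t. smult (c t) (p t))"
  by (auto simp: coeffs_bounded_def intro!: cube_bounded_mult)

lemma coeffs_bounded_pderiv: "coeffs_bounded A p \<Longrightarrow> coeffs_bounded A (\<lambda>t. pderiv (p t))"
proof -
  assume p: "coeffs_bounded A p"
  then obtain D where "\<forall>t. degree (p t) \<le> D" by (auto simp: coeffs_bounded_def)
  then have "\<forall>t. degree (pderiv (p t)) \<le> D" by (metis degree_pderiv diff_le_self order.trans)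
  then show ?thesis using p by (auto simp: coeffs_bounded_def coeff_pderiv intro!: cube_bounded_mult cube_bounded_const)
qed

lemma cube_bounded_poly: assumes "coeffs_bounded A p" "cube_bounded A g" shows "cube_bounded A (\<lambda>t. poly (p t) (g t))"
proof -
  obtain D where D: "\<And>t. degree (p t) \<le> D" using assms by (auto simp: coeffs_bounded_def)
  have "poly (p t) (g t) = (\<Sum>i\<le>D. coeff (p t) i * g t ^ i)" for t
    unfolding poly_altdef by (rule sum.mono_neutral_left) (use D[of t] in \<open>auto simp: coeff_eq_0\<close>)
  then show ?thesis using assms by (auto simp: coeffs_bounded_def intro!: cube_bounded_intros)
qed

lemmas coeffs_bounded_intros = coeffs_bounded_const coeffs_bounded_linear coeffs_bounded_mult coeffs_bounded_prod coeffs_bounded_power coeffs_bounded_smult coeffs_bounded_pderiv cube_bounded_poly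

lemma cube_bounded_discr: "A \<subseteq> B \<Longrightarrow> cube_bounded B (discr_sq A)"
  unfolding discr_sq_def by (auto intro!: cube_bounded_intros)

lemma cube_bounded_weight: "A \<subseteq> B \<Longrightarrow> cube_bounded B (weight e A)"
  unfolding weight_def by (auto intro!: cube_bounded_intros coeffs_bounded_intros cube_bounded_discr)

lemma coeffs_bounded_node_poly: "A \<subseteq> B \<Longrightarrow> coeffs_bounded B (node_poly e A)"
  unfolding node_poly_def using cube_bounded_diff[OF cube_bounded_const[of B 0] cube_bounded_coord[of _ B]]
  by (intro coeffs_bounded_mult coeffs_bounded_prod coeffs_bounded_power coeffs_bounded_linear coeffs_bounded_const cube_bounded_const) auto

lemma coeffs_bounded_gam: "A \<subseteq> B \<Longrightarrow> coeffs_bounded B (hermite_term e A r)"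
  unfolding hermite_term_def by (intro coeffs_bounded_smult coeffs_bounded_mult coeffs_bounded_const coeffs_bounded_node_poly cube_bounded_mult cube_bounded_weight cube_bounded_poly cube_bounded_const)

lemma cube_sets [measurable]: "finite A \<Longrightarrow> (A \<rightarrow>\<^sub>E II) \<in> sets (leb_on A)"
  by (rule sets_PiM_I_finite) auto

lemma emeasure_cube: "finite A \<Longrightarrow> emeasure (leb_on A) (A \<rightarrow>\<^sub>E II) = 1"
  by (subst lb.emeasure_PiM) auto

lemma cube_bounded_integrable:
  assumes "finite A" "cube_bounded A f" shows "set_integrable (leb_on A) (A \<rightarrow>\<^sub>E II) f"
proof -
  obtain C where C: "\<forall>t\<in>A \<rightarrow>\<^sub>E II. \<bar>f t\<bar> \<le> C" using assms by (auto simp: cube_bounded_def)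
  have [measurable]: "f \<in> borel_measurable (leb_on A)" using assms by (simp add: cube_bounded_def)
  have "(\<integral>\<^sup>+t. ennreal \<bar>C\<bar> * indicator (A \<rightarrow>\<^sub>E II) t \<partial>leb_on A) < \<infinity>"
    using assms by (simp add: nn_integral_cmult emeasure_cube)
  then show ?thesis unfolding set_integrable_def
    by (intro integrableI_bounded_set_indicator[where B = "\<bar>C\<bar>"])
      (use assms C in \<open>auto simp: emeasure_cube intro!: AE_I2\<close>)
qed

lemma cube_int_add: "finite A \<Longrightarrow> cube_bounded A f \<Longrightarrow> cube_bounded A g \<Longrightarrow> cube_int A (\<lambda>t. f t + g t) = cube_int A f + cube_int A g"
  unfolding cube_int_def by (simp add: cube_bounded_integrable)

lemma cube_int_cmult: "cube_int A (\<lambda>t. c * f t) = c * cube_int A f"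
  unfolding cube_int_def by simp

lemma cube_int_uminus: "cube_int A (\<lambda>t. - f t) = - cube_int A f"
  using cube_int_cmult[of A "-1" f] by simp

lemma cube_int_0: "cube_int A (\<lambda>t. 0) = 0"
  unfolding cube_int_def by (simp add: set_lebesgue_integral_def)

lemma cube_int_sum:
  "finite A \<Longrightarrow> finite I \<Longrightarrow> (\<And>i. i \<in> I \<Longrightarrow> cube_bounded A (f i)) \<Longrightarrow> cube_int A (\<lambda>t. \<Sum>i\<in>I. f i t) = (\<Sum>i\<in>I. cube_int A (f i))"
proof (induction I rule: infinite_finite_induct)
  case (insert i I)
  then have "cube_int A (\<lambda>t. \<Sum>i\<in>insert i I. f i t) = cube_int A (\<lambda>t. f i t + (\<Sum>i\<in>I. f i t))" by simp
  also have "\<dots> = cube_int A (f i) + cube_int A (\<lambda>t. \<Sum>i\<in>I. f i t)"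
    by (rule cube_int_add) (use insert in \<open>auto intro: cube_bounded_sum\<close>)
  finally show ?case using insert by simp
qed (simp_all add: cube_int_0)

lemma cube_int_cong_AE:
  assumes "finite A" "cube_bounded A f" "cube_bounded A g" "AE t in leb_on A. f t = g t"
  shows "cube_int A f = cube_int A g"
  unfolding cube_int_def set_lebesgue_integral_def
  using assms by (intro integral_cong_AE) (auto simp: cube_bounded_def elim!: eventually_mono)

lemma AE_coord_neq:
  assumes "finite A" "i \<in> A" shows "AE t in leb_on A. t i \<noteq> c"
proof -
  have "emeasure (leb_on A) (PiE A (\<lambda>k. if k = i then {c} else UNIV)) = (\<Prod>k\<in>A. emeasure lborel (if k = i then {c} else UNIV))"
    using assms by (intro lb.emeasure_PiM) auto
  also have "\<dots> = 0" using assms by (intro prod_zero bexI[of _ i]) auto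
  finally have "PiE A (\<lambda>k. if k = i then {c} else UNIV) \<in> null_sets (leb_on A)"
    using assms by (auto intro!: null_setsI sets_PiM_I_finite)
  moreover have "{t \<in> space (leb_on A). \<not> t i \<noteq> c} \<subseteq> PiE A (\<lambda>k. if k = i then {c} else UNIV)"
    by (auto simp: space_PiM PiE_def)
  ultimately show ?thesis by (rule AE_I')
qed

lemma AE_poly_nonzero:
  assumes "finite A" "e \<noteq> 0" shows "AE t in leb_on A. \<forall>i\<in>A. poly e (t i) \<noteq> 0"
proof -
  have "AE t in leb_on A. \<forall>c\<in>{x. poly e x = 0}. t i \<noteq> c" if "i \<in> A" for i
    by (rule AE_finite_allI[OF poly_roots_finite[OF assms(2)]]) (rule AE_coord_neq[OF assms(1) that])
  then have "AE t in leb_on A. \<forall>i\<in>A. \<forall>c\<in>{x. poly e x = 0}. t i \<noteq> c"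
    by (rule AE_finite_allI[OF assms(1)])
  then show ?thesis by (rule eventually_mono) auto
qed

lemma cube_int_insert:
  assumes "finite A" "j \<notin> A" "cube_bounded (insert j A) f"
  shows "cube_int (insert j A) f = cube_int A (\<lambda>t. LBINT s:II. f (t(j := s)))"
proof -
  have "cube_int (insert j A) f = (\<integral>t. (\<integral>s. indicator (insert j A \<rightarrow>\<^sub>E II) (t(j := s)) *\<^sub>R f (t(j := s)) \<partial>lborel) \<partial>leb_on A)"
    unfolding cube_int_def set_lebesgue_integral_def
    by (rule lb.product_integral_insert) (use assms cube_bounded_integrable[of "insert j A" f] in \<open>auto simp: set_integrable_def\<close>)
  also have "\<dots> = (\<integral>t. indicator (A \<rightarrow>\<^sub>E II) t *\<^sub>R (\<integral>s. indicator II s *\<^sub>R f (t(j := s)) \<partial>lborel) \<partial>leb_on A)"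
  proof (rule Bochner_Integration.integral_cong[OF refl])
    fix t assume t: "t \<in> space (leb_on A)"
    have "indicator (insert j A \<rightarrow>\<^sub>E II) (t(j := s)) = (indicator (A \<rightarrow>\<^sub>E II) t * indicator II s :: real)" for s
    proof -
      have "t(j := s) \<in> insert j A \<rightarrow>\<^sub>E II \<longleftrightarrow> t \<in> A \<rightarrow>\<^sub>E II \<and> s \<in> II"
        using t assms(2) by (auto simp: space_PiM PiE_def Pi_def extensional_def split: if_splits)
      then show ?thesis by (auto simp: indicator_def)
    qed
    then show "(\<integral>s. indicator (insert j A \<rightarrow>\<^sub>E II) (t(j := s)) *\<^sub>R f (t(j := s)) \<partial>lborel) =
       indicator (A \<rightarrow>\<^sub>E II) t *\<^sub>R (\<integral>s. indicator II s *\<^sub>R f (t(j := s)) \<partial>lborel)"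
      by (simp add: mult.assoc)
  qed
  finally show ?thesis by (simp add: cube_int_def set_lebesgue_integral_def)
qed

text \<open>Fubini with t_j innermost. One-variable facts, such as integration by parts and Legendre
  orthogonality, act on the j-th interpolation term through this lemma.\<close>

lemma cube_int_poly_coord:
  assumes "finite A" "j \<in> A" "coeffs_bounded A q" "\<And>t s. q (t(j := s)) = q t"
  shows "cube_int A (\<lambda>t. poly (q t) (t j)) = cube_int (A - {j}) (\<lambda>t. pint (q t))"
proof -
  have A: "insert j (A - {j}) = A" using assms by auto
  have "cube_int (insert j (A - {j})) (\<lambda>t. poly (q t) (t j))
      = cube_int (A - {j}) (\<lambda>t. LBINT s:II. poly (q (t(j := s))) ((t(j := s)) j))"
    by (rule cube_int_insert) (use assms in \<open>auto simp: insert_absorb intro!: cube_bounded_poly cube_bounded_coord\<close>)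
  then show ?thesis unfolding A assms(4) pint_def fun_upd_same .
qed

lemma cube_bounded_LBINT:
  assumes "coeffs_bounded A q" shows "cube_bounded A (\<lambda>t. pint (q t))"
proof -
  obtain D where D: "\<And>t. degree (q t) \<le> D" using assms by (auto simp: coeffs_bounded_def)
  have "q t = (\<Sum>i\<le>D. smult (coeff (q t) i) (monom 1 i))" for t
  proof -
    have "q t = (\<Sum>i\<le>D. monom (coeff (q t) i) i)" by (rule poly_as_sum_of_monoms'[OF D, symmetric])
    then show ?thesis by (simp add: smult_monom)
  qed
  then have "pint (q t) = (\<Sum>i\<le>D. coeff (q t) i * pint (monom 1 i))" for t
    by (metis (no_types, lifting) pint_smult pint_sum sum.cong)
  then show ?thesis using assms by (auto simp: coeffs_bounded_def intro!: cube_bounded_intros)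
qed

lemma node_poly_upd: "j \<notin> B \<Longrightarrow> node_poly e B (t(j := s)) = node_poly e B t"
  unfolding node_poly_def by (metis (mono_tags, lifting) fun_upd_other prod.cong)

lemma weight_upd: "j \<notin> B \<Longrightarrow> weight e B (t(j := s)) = weight e B t"
proof -
  assume j: "j \<notin> B"
  then have "\<And>i. i \<in> B \<Longrightarrow> (t(j := s)) i = t i" by auto
  then show ?thesis unfolding weight_def discr_sq_def
    by (intro arg_cong2[where f = "(*)"] prod.cong refl) auto
qed

lemma hermite_term_upd: "j \<notin> B \<Longrightarrow> hermite_term e B r (t(j := s)) = hermite_term e B r t"
  by (simp add: hermite_term_def node_poly_upd weight_upd)

text \<open>The pointwise formula holds off the null set where a node hits a root of e. In its j-th
  summand t_j is only the point of evaluation, so that variable can be integrated first.\<close>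

lemma cube_int_interpolation:
  fixes f e :: "real poly"
  assumes A: "finite A" and e: "e \<noteq> 0"
    and nice: "cube_bounded A (\<lambda>t. poly (X t) r)"
    and X: "\<And>t j. j \<in> A \<Longrightarrow> poly (X t) (t j) = 0 \<and> poly (pderiv (X t)) (t j) = 0"
    and X0: "\<And>t. discr_sq A t = 0 \<Longrightarrow> poly (X t) r = 0"
    and edvd: "\<And>t. e dvd smult (weight e A t) f - X t"
    and deg: "\<And>t. degree (smult (weight e A t) f - X t) < 2 * card A + degree e"
  shows "poly f r * cube_int A (weight e A) = cube_int A (\<lambda>t. poly (X t) r) +
    (\<Sum>j\<in>A. cube_int (A - {j}) (\<lambda>t. pint (pderiv f * hermite_term e (A - {j}) r t - f * pderiv (hermite_term e (A - {j}) r t))))"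
proof -
  define q where "q j t = pderiv f * hermite_term e (A - {j}) r t - f * pderiv (hermite_term e (A - {j}) r t)" for j t
  have pq: "coeffs_bounded A (q j)" for j
    unfolding q_def by (intro coeffs_bounded_diff coeffs_bounded_mult coeffs_bounded_const coeffs_bounded_pderiv coeffs_bounded_gam) auto
  then have cq: "cube_bounded A (\<lambda>t. poly (q j t) (t j))" if "j \<in> A" for j
    using that by (intro cube_bounded_poly cube_bounded_coord)
  have "poly f r * cube_int A (weight e A) = cube_int A (\<lambda>t. poly f r * weight e A t)"
    by (simp add: cube_int_cmult)
  also have "\<dots> = cube_int A (\<lambda>t. poly (X t) r + (\<Sum>j\<in>A. poly (q j t) (t j)))"
  proof (rule cube_int_cong_AE[OF A])
    show "cube_bounded A (\<lambda>t. poly f r * weight e A t)" by (intro cube_bounded_mult cube_bounded_const cube_bounded_weight) simp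
    show "cube_bounded A (\<lambda>t. poly (X t) r + (\<Sum>j\<in>A. poly (q j t) (t j)))" by (intro cube_bounded_add nice cube_bounded_sum cq)
    show "AE t in leb_on A. poly f r * weight e A t = poly (X t) r + (\<Sum>j\<in>A. poly (q j t) (t j))"
      using AE_poly_nonzero[OF A e]
    proof (rule eventually_mono)
      fix t assume t: "\<forall>i\<in>A. poly e (t i) \<noteq> 0"
      have "poly f r * weight e A t = poly (X t) r +
        (\<Sum>j\<in>A. poly (pderiv f) (t j) * poly (hermite_term e (A - {j}) r t) (t j)
             - poly f (t j) * poly (pderiv (hermite_term e (A - {j}) r t)) (t j))"
        by (rule Hermite_interpolation[OF A e]) (use t X X0 edvd deg in auto)
      then show "poly f r * weight e A t = poly (X t) r + (\<Sum>j\<in>A. poly (q j t) (t j))"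
        by (simp add: q_def)
    qed
  qed
  also have "\<dots> = cube_int A (\<lambda>t. poly (X t) r) + (\<Sum>j\<in>A. cube_int A (\<lambda>t. poly (q j t) (t j)))"
    by (subst cube_int_add) (auto intro!: A nice cube_bounded_sum cq cube_int_sum)
  also have "(\<Sum>j\<in>A. cube_int A (\<lambda>t. poly (q j t) (t j))) = (\<Sum>j\<in>A. cube_int (A - {j}) (\<lambda>t. pint (q j t)))"
    by (intro sum.cong refl cube_int_poly_coord A pq) (auto simp: q_def hermite_term_upd)
  finally show ?thesis by (simp only: q_def)
qed

section \<open>The recursion for the Selberg integral\<close>

lemma pint_legendre_plus_one:
  assumes "degree (pderiv g) < n"
  shows "pint (pderiv (shifted_legendre n + 1) * g - (shifted_legendre n + 1) * pderiv g) = (1 - (-1) ^ n) * poly g 0"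
proof -
  have 0: "pint (shifted_legendre n * pderiv g) = 0" by (rule pint_shifted_legendre_eq_0[OF assms])
  have "pint (pderiv (shifted_legendre n) * g) = poly g 1 - (-1) ^ n * poly g 0"
    using 0 by (simp add: pint_parts shifted_legendre_at_0 shifted_legendre_at_1)
  moreover have "pint ((shifted_legendre n + 1) * pderiv g) = poly g 1 - poly g 0"
    using 0 by (simp add: distrib_right pint_add pint_pderiv)
  ultimately show ?thesis by (simp add: pderiv_add pint_diff algebra_simps)
qed

lemma node_poly_insert: "finite B \<Longrightarrow> k \<notin> B \<Longrightarrow> node_poly e (insert k B) t = node_poly e B t * [:- t k, 1:]\<^sup>2"
  by (simp add: node_poly_def mult_ac)

lemma monic_node_poly:
  assumes "finite A" "lead_coeff e = 1"
  shows "lead_coeff (node_poly e A t) = 1 \<and> degree (node_poly e A t) = degree e + 2 * card A"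
  using assms(1)
proof (induction A rule: finite_induct)
  case empty
  then show ?case using assms by (simp add: node_poly_def)
next
  case (insert k A)
  have "node_poly e A t \<noteq> 0" using insert by auto
  moreover have "lead_coeff ([:- t k, 1:]\<^sup>2) = 1" by (simp add: lead_coeff_power)
  ultimately show ?case using insert(1,2) insert.IH[THEN conjunct1] insert.IH[THEN conjunct2, symmetric]
    unfolding node_poly_insert[OF insert(1,2)] lead_coeff_mult by (simp add: degree_mult_eq degree_power_eq)
qed

lemma degree_diff_less:
  fixes p q :: "real poly"
  assumes "degree p \<le> n" "degree q \<le> n" "coeff p n = coeff q n" "n > 0"
  shows "degree (p - q) < n"
proof -
  obtain k where k: "n = Suc k" using assms(4) by (cases n) auto
  have "degree (p - q) \<le> k"
  proof (rule degree_le, intro allI impI)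
    fix i assume "k < i"
    then consider "i = n" | "n < i" using k by linarith
    then show "coeff (p - q) i = 0" using assms by cases (auto simp: coeff_eq_0)
  qed
  then show ?thesis using k by simp
qed

text \<open>Take f = P_n + 1 with n the degree of the monic node polynomial. Subtracting the leading
  coefficient of P_n times the node polynomial lowers the degree below n without changing the data
  at the nodes, so this multiple is the remainder \<open>X\<close>. The interpolation terms
  integrate to 0 by \<open>pint_legendre_plus_one\<close>; the assumption \<open>bd\<close> kills
  the boundary value at 0.\<close>

lemma cube_int_node_poly_legendre:
  assumes A: "finite A" and e: "lead_coeff e = 1" and n: "n = 2 * card A + degree e" "n > 0"
    and edvd: "e dvd shifted_legendre n + 1" and bd: "even n \<or> poly e 0 = 0"
  shows "poly (shifted_legendre n + 1) r * cube_int A (weight e A)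
     = real ((2 * n) choose n) * cube_int A (\<lambda>t. weight e A t * poly (node_poly e A t) r)"
proof -
  let ?f = "shifted_legendre n + 1"
  define c where "c = real ((2 * n) choose n)"
  define X where "X t = smult (weight e A t * c) (node_poly e A t)" for t
  have e0: "e \<noteq> 0" using e by auto
  have df: "degree ?f \<le> n" using degree_shifted_legendre_le[of n] by (intro degree_add_le) auto
  have cf: "coeff ?f n = c" using n(2) by (simp add: coeff_shifted_legendre c_def coeff_1)
  have mon: "coeff (node_poly e A t) n = 1" "degree (node_poly e A t) = n" for t
    using monic_node_poly[OF A e, of t] n by (auto simp: add.commute)
  have "poly ?f r * cube_int A (weight e A) = cube_int A (\<lambda>t. poly (X t) r) +
    (\<Sum>j\<in>A. cube_int (A - {j}) (\<lambda>t. pint (pderiv ?f * hermite_term e (A - {j}) r t - ?f * pderiv (hermite_term e (A - {j}) r t))))"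
  proof (rule cube_int_interpolation[OF A e0])
    show "cube_bounded A (\<lambda>t. poly (X t) r)" unfolding X_def
      by (intro cube_bounded_poly coeffs_bounded_smult cube_bounded_mult cube_bounded_const cube_bounded_weight coeffs_bounded_node_poly) auto
    show "poly (X t) (t j) = 0 \<and> poly (pderiv (X t)) (t j) = 0" if "j \<in> A" for t j
      using node_poly_double_root[OF A that refl, of e t] by (simp add: X_def pderiv_smult)
    show "poly (X t) r = 0" if "discr_sq A t = 0" for t using that by (simp add: X_def weight_def)
    show "e dvd smult (weight e A t) ?f - X t" for t
      unfolding X_def by (intro dvd_diff dvd_smult edvd) (simp add: node_poly_def)
    have "degree (smult (weight e A t) ?f - X t) < n" for t
      by (rule degree_diff_less)
        (use df mon[of t] cf n in \<open>auto simp: X_def intro: order.trans[OF degree_smult_le]\<close>)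
    then show "degree (smult (weight e A t) ?f - X t) < 2 * card A + degree e" for t using n by simp
  qed
  also have "(\<Sum>j\<in>A. cube_int (A - {j}) (\<lambda>t. pint (pderiv ?f * hermite_term e (A - {j}) r t - ?f * pderiv (hermite_term e (A - {j}) r t)))) = 0"
  proof (rule sum.neutral, rule ballI)
    fix j assume j: "j \<in> A"
    have c: "card A = Suc (card (A - {j}))" using A j by (metis card_Suc_Diff1)
    have "degree (pderiv (hermite_term e (A - {j}) r t)) < n" for t
      using degree_gam[of "A - {j}" e r t] A c n by (auto simp: degree_pderiv)
    moreover have "(1 - (-1) ^ n) * poly (hermite_term e (A - {j}) r t) 0 = 0" for t
      using bd by (auto simp: poly_gam poly_node_poly)
    ultimately show "cube_int (A - {j}) (\<lambda>t. pint (pderiv ?f * hermite_term e (A - {j}) r t - ?f * pderiv (hermite_term e (A - {j}) r t))) = 0"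
      by (simp only: pint_legendre_plus_one cube_int_0)
  qed
  also have "cube_int A (\<lambda>t. poly (X t) r) = c * cube_int A (\<lambda>t. weight e A t * poly (node_poly e A t) r)"
    unfolding X_def by (simp add: mult_ac flip: cube_int_cmult)
  finally show ?thesis by (simp add: c_def)
qed

text \<open>Case e = 1 at r = 0 in even degree: f(0) = 2, and the node polynomial at 0 is the
  product of the t_i^2, which adds the simple node 0 to the weight.\<close>

lemma cube_int_weight_step1:
  assumes "finite A" "A \<noteq> {}"
  shows "2 * cube_int A (weight 1 A) = real ((4 * card A) choose (2 * card A)) * cube_int A (weight [:0, 1:] A)"
proof -
  have N: "2 * card A > 0" using assms by (simp add: card_gt_0_iff)
  have "poly (shifted_legendre (2 * card A) + 1) 0 * cube_int A (weight 1 A)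
     = real ((2 * (2 * card A)) choose (2 * card A)) * cube_int A (\<lambda>t. weight 1 A t * poly (node_poly 1 A t) 0)"
    by (rule cube_int_node_poly_legendre[OF assms(1)]) (use N in auto)
  moreover have "weight 1 A t * poly (node_poly 1 A t) 0 = weight [:0, 1:] A t" for t
    by (simp add: weight_def poly_node_poly)
  ultimately show ?thesis by (simp add: shifted_legendre_at_0)
qed

text \<open>Case e = z at r = 1. The degree is odd, so f vanishes at 0 and e divides it; f(1) = 2,
  and the node polynomial at 1 is the product of the (1 - t_i)^2, which adds the simple node
  1.\<close>

lemma cube_int_weight_step2:
  assumes "finite A"
  shows "2 * cube_int A (weight [:0, 1:] A) = real ((4 * card A + 2) choose (2 * card A + 1)) * cube_int A (weight [:0, -1, 1:] A)"
proof -
  have "poly (shifted_legendre (2 * card A + 1) + 1) 1 * cube_int A (weight [:0, 1:] A)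
     = real ((2 * (2 * card A + 1)) choose (2 * card A + 1)) *
       cube_int A (\<lambda>t. weight [:0, 1:] A t * poly (node_poly [:0, 1:] A t) 1)"
  proof (rule cube_int_node_poly_legendre[OF assms])
    have "poly (shifted_legendre (2 * card A + 1) + 1) 0 = 0" by (simp add: shifted_legendre_at_0)
    then show "[:0, 1:] dvd shifted_legendre (2 * card A + 1) + 1" by (metis poly_eq_0_iff_dvd minus_zero)
  qed auto
  moreover have "weight [:0, 1:] A t * poly (node_poly [:0, 1:] A t) 1 = weight [:0, -1, 1:] A t" for t
  proof -
    have "(\<Prod>i\<in>A. (poly [:0, -1, 1:] (t i))\<^sup>2) = (\<Prod>i\<in>A. (poly [:0, 1:] (t i))\<^sup>2 * (1 - t i)\<^sup>2)"
      by (rule prod.cong) (auto simp: power2_eq_square algebra_simps)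
    then show ?thesis by (simp add: weight_def poly_node_poly prod.distrib)
  qed
  ultimately show ?thesis by (simp add: shifted_legendre_at_1)
qed

text \<open>Interpolating f = 1 without simple nodes, at r = 0: the integral of -g_j' is g_j(0) -
  g_j(1). Here g_j(0) = 0, and -g_j(1) is the weight with both simple nodes on the remaining
  indices. This step lowers the number of nodes.\<close>

lemma cube_int_weight_step3:
  assumes "finite A" "A \<noteq> {}"
  shows "cube_int A (weight 1 A) = (\<Sum>j\<in>A. cube_int (A - {j}) (weight [:0, -1, 1:] (A - {j})))"
proof -
  have "poly 1 0 * cube_int A (weight 1 A) = cube_int A (\<lambda>t. poly 0 0) +
    (\<Sum>j\<in>A. cube_int (A - {j}) (\<lambda>t. pint (pderiv 1 * hermite_term 1 (A - {j}) 0 t - 1 * pderiv (hermite_term 1 (A - {j}) 0 t))))"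
    by (rule cube_int_interpolation[OF assms(1)]) (use assms in \<open>auto simp: card_gt_0_iff intro!: cube_bounded_const\<close>)
  also have "\<dots> = (\<Sum>j\<in>A. cube_int (A - {j}) (weight [:0, -1, 1:] (A - {j})))"
  proof -
    have "pint (pderiv 1 * hermite_term 1 B 0 t - 1 * pderiv (hermite_term 1 B 0 t)) = weight [:0, -1, 1:] B t" for B t
    proof -
      have "(\<Prod>i\<in>B. (poly [:0, -1, 1:] (t i))\<^sup>2) = (\<Prod>i\<in>B. (t i)\<^sup>2 * (1 - t i)\<^sup>2)"
        by (rule prod.cong) (auto simp: power2_eq_square algebra_simps)
      then show ?thesis
        by (simp add: pint_uminus pint_pderiv poly_gam poly_node_poly weight_def prod.distrib mult_ac)
    qed
    then show ?thesis by (simp add: cube_int_0)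
  qed
  finally show ?thesis by simp
qed

text \<open>The value (2m - 1)! (m - 1)! Vol for N = m - 1, with the volume written as its product
  of Beta values.\<close>

definition selberg :: "nat \<Rightarrow> real" where
  "selberg N = fact (2 * N + 1) * fact N * (\<Prod>j<2 * N + 1. beta_int j)"

lemma beta_int_choose: "real (Suc n) * beta_int n * real ((2 * Suc n) choose Suc n) = 2"
proof -
  have b: "real ((2 * Suc n) choose Suc n) = fact (2 * Suc n) / (fact (Suc n) * fact (Suc n))"
    using binomial_fact[of "Suc n" "2 * Suc n", where 'a = real] by simp
  have f: "fact (2 * Suc n) = (2 * real (Suc n)) * fact (2 * n + 1)"
    by (simp add: fact_Suc algebra_simps)
  have g: "fact (Suc n) = real (Suc n) * fact n" by simp
  have "x * (F * F / G) * ((2 * x * G) / ((x * F) * (x * F))) = 2" if "x \<noteq> 0" "F \<noteq> 0" "G \<noteq> 0" for x F G :: real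
    using that by (simp add: field_simps)
  from this[of "real (Suc n)" "fact n" "fact (2 * n + 1)"] show ?thesis unfolding b beta_int_def f g
    by (simp del: of_nat_Suc fact_Suc)
qed

lemma selberg_Suc:
  "real ((4 * Suc N) choose (2 * Suc N)) * real ((4 * Suc N + 2) choose (2 * Suc N + 1)) * selberg (Suc N)
     = 4 * (real (Suc N) * selberg N)"
proof -
  define b1 b2 where "b1 = real ((4 * Suc N) choose (2 * Suc N))" and "b2 = real ((4 * Suc N + 2) choose (2 * Suc N + 1))"
  have 1: "real (2 * Suc N) * beta_int (2 * N + 1) * b1 = 2"
  proof -
    have "Suc (2 * N + 1) = 2 * Suc N" "2 * (2 * Suc N) = 4 * Suc N" by simp_all
    then show ?thesis using beta_int_choose[of "2 * N + 1"] by (simp only: b1_def)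
  qed
  have 2: "real (2 * Suc N + 1) * beta_int (2 * N + 2) * b2 = 2"
  proof -
    have "Suc (2 * N + 2) = 2 * Suc N + 1" "2 * (2 * Suc N + 1) = 4 * Suc N + 2" by simp_all
    then show ?thesis using beta_int_choose[of "2 * N + 2"] by (simp only: b2_def)
  qed
  have f: "fact (2 * Suc N + 1) = real (2 * Suc N + 1) * (real (2 * Suc N) * fact (2 * N + 1))"
    by (simp add: fact_Suc algebra_simps)
  have p: "(\<Prod>j<2 * Suc N + 1. beta_int j) = (\<Prod>j<2 * N + 1. beta_int j) * beta_int (2 * N + 1) * beta_int (2 * N + 2)"
    by (simp add: mult_ac)
  have "b1 * b2 * selberg (Suc N) = (real (2 * Suc N) * beta_int (2 * N + 1) * b1) * (real (2 * Suc N + 1) * beta_int (2 * N + 2) * b2)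
      * (real (Suc N) * selberg N)"
    unfolding selberg_def p f fact_Suc[of N] by (simp only: mult_ac of_nat_id)
  also have "\<dots> = 4 * (real (Suc N) * selberg N)" unfolding 1 2 by simp
  finally show ?thesis unfolding b1_def b2_def .
qed

lemma cube_int_weight: "finite A \<Longrightarrow> cube_int A (weight [:0, -1, 1:] A) = selberg (card A)"
proof (induction "card A" arbitrary: A)
  case 0
  then have "A = {}" by simp
  then show ?case
    by (simp add: cube_int_def weight_def discr_sq_def selberg_def beta_int_def PiM_empty set_lebesgue_integral_def)
next
  case (Suc N)
  then have ne: "A \<noteq> {}" by auto
  have "cube_int (A - {j}) (weight [:0, -1, 1:] (A - {j})) = selberg N" if "j \<in> A" for j
    using Suc that by (metis Diff_iff card_Diff_singleton diff_Suc_1 finite_Diff)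
  then have "cube_int A (weight 1 A) = real (Suc N) * selberg N"
    using cube_int_weight_step3[OF \<open>finite A\<close> ne] Suc(2) by simp
  then have "4 * (real (Suc N) * selberg N) =
    real ((4 * Suc N) choose (2 * Suc N)) * real ((4 * Suc N + 2) choose (2 * Suc N + 1)) * cube_int A (weight [:0, -1, 1:] A)"
    using cube_int_weight_step1[OF \<open>finite A\<close> ne] cube_int_weight_step2[OF \<open>finite A\<close>]
    unfolding Suc(2)[symmetric] by (metis (no_types, opaque_lifting) mult.assoc mult.left_commute numeral_Bit0_eq_double)
  then have "real ((4 * Suc N) choose (2 * Suc N)) * real ((4 * Suc N + 2) choose (2 * Suc N + 1)) * cube_int A (weight [:0, -1, 1:] A)
    = real ((4 * Suc N) choose (2 * Suc N)) * real ((4 * Suc N + 2) choose (2 * Suc N + 1)) * selberg (Suc N)"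
    by (simp only: selberg_Suc)
  moreover have "real ((4 * Suc N) choose (2 * Suc N)) * real ((4 * Suc N + 2) choose (2 * Suc N + 1)) \<noteq> 0"
    unfolding mult_eq_0_iff of_nat_eq_0_iff binomial_eq_0_iff by simp
  ultimately show ?case unfolding Suc(2)[symmetric] by (metis mult_left_cancel)
qed

section \<open>The reproducing property of \<open>Hhat\<close>\<close>

text \<open>Lebesgue measure on the cube becomes a product of probability measures, the form in
  which \<open>distr_PiM_reindex\<close> relabels coordinates.\<close>

definition unif_II :: "real measure" where
  "unif_II = density lborel (indicator II)"

lemma sets_unif [measurable_cong]: "sets unif_II = sets borel"
  by (simp add: unif_II_def)

lemma prob_space_unif: "prob_space unif_II"
  by (rule prob_spaceI) (simp add: unif_II_def emeasure_restricted)

lemma PiM_unif: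
  assumes "finite A"
  shows "Pi\<^sub>M A (\<lambda>_. unif_II) = density (leb_on A) (indicator (A \<rightarrow>\<^sub>E II))"
proof -
  interpret U: prob_space unif_II by (rule prob_space_unif)
  interpret product_sigma_finite "\<lambda>_::nat. unif_II" by standard
  have "density (leb_on A) (indicator (A \<rightarrow>\<^sub>E II)) = Pi\<^sub>M A (\<lambda>_. unif_II)"
  proof (rule PiM_eqI[OF assms])
    show "sets (density (leb_on A) (indicator (A \<rightarrow>\<^sub>E II))) = sets (Pi\<^sub>M A (\<lambda>_. unif_II))"
      by (auto simp: sets_unif intro!: sets_PiM_cong)
    fix X :: "nat \<Rightarrow> real set" assume X: "\<And>i. i \<in> A \<Longrightarrow> X i \<in> sets unif_II"
    then have X': "\<And>i. i \<in> A \<Longrightarrow> X i \<in> sets borel" by (simp add: sets_unif)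
    have "emeasure (density (leb_on A) (indicator (A \<rightarrow>\<^sub>E II))) (PiE A X) = emeasure (leb_on A) ((A \<rightarrow>\<^sub>E II) \<inter> PiE A X)"
      by (rule emeasure_restricted) (use assms X' in \<open>auto intro!: sets_PiM_I_finite\<close>)
    also have "(A \<rightarrow>\<^sub>E II) \<inter> PiE A X = PiE A (\<lambda>i. II \<inter> X i)" by (auto simp: PiE_def Pi_def)
    also have "emeasure (leb_on A) \<dots> = (\<Prod>i\<in>A. emeasure lborel (II \<inter> X i))"
      using assms X' by (intro lb.emeasure_PiM) auto
    also have "\<dots> = (\<Prod>i\<in>A. emeasure unif_II (X i))"
      using X' by (intro prod.cong refl) (simp add: unif_II_def emeasure_restricted)
    finally show "emeasure (density (leb_on A) (indicator (A \<rightarrow>\<^sub>E II))) (PiE A X) = (\<Prod>i\<in>A. emeasure unif_II (X i))" .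
  qed
  then show ?thesis by simp
qed

lemma cube_int_eq_unif:
  assumes "finite A" "f \<in> borel_measurable (leb_on A)"
  shows "cube_int A f = (\<integral>t. f t \<partial>Pi\<^sub>M A (\<lambda>_. unif_II))"
proof -
  have "(\<integral>t. f t \<partial>density (leb_on A) (\<lambda>t. ennreal (indicator (A \<rightarrow>\<^sub>E II) t))) = (\<integral>t. indicator (A \<rightarrow>\<^sub>E II) t *\<^sub>R f t \<partial>leb_on A)"
    by (rule integral_density) (use assms in auto)
  then show ?thesis by (simp add: cube_int_def set_lebesgue_integral_def PiM_unif[OF assms(1)] ennreal_indicator)
qed

lemma cube_int_reindex:
  assumes "finite K" "bij_betw \<pi> I K" "cube_bounded I g" "cube_bounded K (\<lambda>\<omega>. g (\<lambda>n\<in>I. \<omega> (\<pi> n)))"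
  shows "cube_int K (\<lambda>\<omega>. g (\<lambda>n\<in>I. \<omega> (\<pi> n))) = cube_int I g"
proof -
  have I: "finite I" using assms bij_betw_finite by blast
  have inj: "inj_on \<pi> I" and fn: "\<pi> \<in> I \<rightarrow> K" using assms(2) by (auto simp: bij_betw_def)
  let ?U = "\<lambda>A. Pi\<^sub>M A (\<lambda>_::nat. unif_II)"
  have s: "sets (?U A) = sets (leb_on A)" for A by (rule sets_PiM_cong) (auto simp: sets_unif)
  have d: "distr (?U K) (?U I) (\<lambda>\<omega>. \<lambda>n\<in>I. \<omega> (\<pi> n)) = ?U I"
    using distr_PiM_reindex[of K "\<lambda>_. unif_II" \<pi> I] prob_space_unif inj fn by simp
  have m: "(\<lambda>\<omega>. \<lambda>n\<in>I. \<omega> (\<pi> n)) \<in> measurable (?U K) (?U I)"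
    using fn by (intro measurable_restrict measurable_component_singleton) auto
  have g: "g \<in> borel_measurable (?U I)"
    using assms(3) unfolding cube_bounded_def measurable_cong_sets[OF s refl] by blast
  have "cube_int I g = (\<integral>t. g t \<partial>?U I)" using assms(3) by (intro cube_int_eq_unif I) (simp add: cube_bounded_def)
  also have "\<dots> = (\<integral>t. g t \<partial>distr (?U K) (?U I) (\<lambda>\<omega>. \<lambda>n\<in>I. \<omega> (\<pi> n)))" by (simp only: d)
  also have "\<dots> = (\<integral>\<omega>. g (\<lambda>n\<in>I. \<omega> (\<pi> n)) \<partial>?U K)" by (rule integral_distr[OF m g])
  also have "\<dots> = cube_int K (\<lambda>\<omega>. g (\<lambda>n\<in>I. \<omega> (\<pi> n)))"
    by (rule cube_int_eq_unif[symmetric]) (use assms in \<open>auto simp: cube_bounded_def\<close>)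
  finally show ?thesis by simp
qed

lemma node_poly_reindex:
  "bij_betw \<pi> I K \<Longrightarrow> node_poly e I (\<lambda>n\<in>I. \<omega> (\<pi> n)) = node_poly e K \<omega>"
  unfolding node_poly_def
  by (subst prod.reindex_bij_betw[symmetric, of \<pi> I K]) auto

lemma weight_reindex:
  assumes p: "bij_betw \<pi> I K" shows "weight e I (\<lambda>n\<in>I. \<omega> (\<pi> n)) = weight e K \<omega>"
proof -
  have "(\<Prod>i\<in>K. \<Prod>j\<in>K - {i}. (\<omega> i - \<omega> j)\<^sup>2) = (\<Prod>i\<in>I. \<Prod>j\<in>K - {\<pi> i}. (\<omega> (\<pi> i) - \<omega> j)\<^sup>2)"
    by (rule prod.reindex_bij_betw[OF p, symmetric])
  also have "\<dots> = (\<Prod>i\<in>I. \<Prod>j\<in>I - {i}. (\<omega> (\<pi> i) - \<omega> (\<pi> j))\<^sup>2)"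
  proof (rule prod.cong[OF refl])
    fix i assume i: "i \<in> I"
    have "bij_betw \<pi> (I - {i}) (K - {\<pi> i})" using p i by (auto simp: bij_betw_def inj_on_def)
    then show "(\<Prod>j\<in>K - {\<pi> i}. (\<omega> (\<pi> i) - \<omega> j)\<^sup>2) = (\<Prod>j\<in>I - {i}. (\<omega> (\<pi> i) - \<omega> (\<pi> j))\<^sup>2)"
      by (rule prod.reindex_bij_betw[symmetric])
  qed
  finally have "discr_sq K \<omega> = discr_sq I (\<lambda>n\<in>I. \<omega> (\<pi> n))" by (simp add: discr_sq_def)
  moreover have "(\<Prod>i\<in>K. (poly e (\<omega> i))\<^sup>2) = (\<Prod>i\<in>I. (poly e (\<omega> (\<pi> i)))\<^sup>2)"
    by (rule prod.reindex_bij_betw[OF p, symmetric])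
  ultimately show ?thesis by (simp add: weight_def)
qed

text \<open>The integrand is symmetric in the nodes, so relabelling by a bijection identifies the
  two integrals. Hence omitting any one node from A gives the same value.\<close>

lemma cube_int_gam_card:
  assumes "finite K" "finite I" "card K = card I"
  shows "cube_int K (\<lambda>t. pint (\<phi> * pderiv (hermite_term e K r t))) = cube_int I (\<lambda>t. pint (\<phi> * pderiv (hermite_term e I r t)))"
proof -
  obtain \<pi> where p: "bij_betw \<pi> I K" using finite_same_card_bij[OF assms(2,1)] assms(3) by auto
  have g: "hermite_term e I r (\<lambda>n\<in>I. \<omega> (\<pi> n)) = hermite_term e K r \<omega>" for \<omega>
    by (simp only: hermite_term_def node_poly_reindex[OF p] weight_reindex[OF p])
  have n: "cube_bounded A (\<lambda>t. pint (\<phi> * pderiv (hermite_term e A r t)))" for A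
    by (intro cube_bounded_LBINT coeffs_bounded_mult coeffs_bounded_const coeffs_bounded_pderiv coeffs_bounded_gam) simp
  have "cube_int K (\<lambda>\<omega>. pint (\<phi> * pderiv (hermite_term e I r (\<lambda>n\<in>I. \<omega> (\<pi> n))))) = cube_int I (\<lambda>t. pint (\<phi> * pderiv (hermite_term e I r t)))"
    by (rule cube_int_reindex[OF assms(1) p n]) (simp only: g n)
  then show ?thesis by (simp only: g)
qed

section \<open>The moment identity for \<open>Hker\<close>\<close>

abbreviation e_poly :: "real poly" where "e_poly \<equiv> [:0, -1, 1:]"

text \<open>The weighted part of the interpolant of the constant 1 that belongs to the simple nodes
  0 and 1; its value at r is \<open>J_ol\<close> plus \<open>J_ou\<close>.\<close>

definition Xpoly :: "nat set \<Rightarrow> (nat \<Rightarrow> real) \<Rightarrow> real poly" where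
  "Xpoly A t = smult (discr_sq A t * (\<Prod>j\<in>A. (t j)\<^sup>2)) (node_poly [:0, 1:] A t)
     + smult (discr_sq A t * (\<Prod>j\<in>A. (1 - t j)\<^sup>2)) (node_poly [:1, -1:] A t)"

lemma weight_ee: "weight e_poly A t = discr_sq A t * ((\<Prod>j\<in>A. (t j)\<^sup>2) * (\<Prod>j\<in>A. (1 - t j)\<^sup>2))"
proof -
  have "(\<Prod>i\<in>A. (poly e_poly (t i))\<^sup>2) = (\<Prod>i\<in>A. (t i)\<^sup>2 * (1 - t i)\<^sup>2)"
    by (rule prod.cong) (auto simp: power2_eq_square algebra_simps)
  then show ?thesis by (simp add: weight_def prod.distrib)
qed

text \<open>Origin of the factor 2 \<open>card A\<close>: interpolating \<phi>, the two halves of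
  \<phi>' \<gamma> - \<phi> \<gamma>' integrate to the same value by parts, and all nodes contribute
  equally. Interpolating 1, only the node a contributes to the integral against \<phi>(t_a): for
  other j the factor \<phi>(t_a) is constant in t_j, and \<gamma>_j vanishes at both ends.\<close>

lemma Hker_moment:
  assumes A: "finite A" "a \<in> A" and \<phi>: "poly \<phi> 0 = 0" "poly \<phi> 1 = 0" "degree \<phi> \<le> 2 * card A + 1"
  shows "2 * real (card A) * cube_int A (\<lambda>t. poly \<phi> (t a) * (weight e_poly A t - poly (Xpoly A t) r)) = poly \<phi> r * selberg (card A)"
proof -
  define \<gamma> where "\<gamma> j = hermite_term e_poly (A - {j}) r" for j
  define \<Psi> where "\<Psi> j = cube_int (A - {j}) (\<lambda>t. pint (\<phi> * pderiv (\<gamma> j t)))" for j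
  have \<gamma>01: "poly (\<gamma> j t) 0 = 0" "poly (\<gamma> j t) 1 = 0" for j t
    by (simp_all add: \<gamma>_def poly_gam poly_node_poly)
  have pg: "coeffs_bounded A (\<gamma> j)" for j unfolding \<gamma>_def by (rule coeffs_bounded_gam) auto
  have \<Psi>: "\<Psi> j = \<Psi> a" if "j \<in> A" for j
    unfolding \<Psi>_def \<gamma>_def by (rule cube_int_gam_card) (use A that in auto)
  have "poly \<phi> r * cube_int A (weight e_poly A) = cube_int A (\<lambda>t. poly 0 r) +
    (\<Sum>j\<in>A. cube_int (A - {j}) (\<lambda>t. pint (pderiv \<phi> * hermite_term e_poly (A - {j}) r t - \<phi> * pderiv (hermite_term e_poly (A - {j}) r t))))"
  proof (rule cube_int_interpolation[OF A(1)])
    show "e_poly dvd smult (weight e_poly A t) \<phi> - 0" for t using \<phi> by (simp add: dvd_smult dvd_r_iff)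
    show "degree (smult (weight e_poly A t) \<phi> - 0) < 2 * card A + degree e_poly" for t
      using degree_smult_le[of "weight e_poly A t" \<phi>] \<phi>(3) by simp
  qed (auto intro: cube_bounded_const)
  also have "\<dots> = (\<Sum>j\<in>A. - 2 * \<Psi> j)"
  proof -
    have "pint (pderiv \<phi> * \<gamma> j t - \<phi> * pderiv (\<gamma> j t)) = - 2 * pint (\<phi> * pderiv (\<gamma> j t))" for j t
      by (simp add: pint_diff pint_parts \<phi>)
    then show ?thesis by (simp add: cube_int_0 \<Psi>_def \<gamma>_def cube_int_cmult cube_int_uminus)
  qed
  also have "\<dots> = - 2 * real (card A) * \<Psi> a" using \<Psi> by simp
  finally have 1: "poly \<phi> r * selberg (card A) = - 2 * real (card A) * \<Psi> a" by (simp add: cube_int_weight[OF A(1)])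
  have "AE t in leb_on A. weight e_poly A t - poly (Xpoly A t) r = (\<Sum>j\<in>A. - poly (pderiv (\<gamma> j t)) (t j))"
    using AE_poly_nonzero[OF A(1), of e_poly]
  proof (rule eventually_mono)
    show "e_poly \<noteq> 0" by simp
    fix t assume t: "\<forall>i\<in>A. poly e_poly (t i) \<noteq> 0"
    have "poly 1 r * weight e_poly A t = poly (Xpoly A t) r +
        (\<Sum>j\<in>A. poly (pderiv 1) (t j) * poly (hermite_term e_poly (A - {j}) r t) (t j)
             - poly 1 (t j) * poly (pderiv (hermite_term e_poly (A - {j}) r t)) (t j))"
    proof (rule Hermite_interpolation[OF A(1)])
      show "poly (Xpoly A t) (t j) = 0" "poly (pderiv (Xpoly A t)) (t j) = 0" if "j \<in> A" for j
        using node_poly_double_root[OF A(1) that refl] by (simp_all add: Xpoly_def pderiv_add pderiv_smult)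
      show "poly (Xpoly A t) r = 0" if "discr_sq A t = 0" using that by (simp add: Xpoly_def)
      show "e_poly dvd smult (weight e_poly A t) 1 - Xpoly A t"
        unfolding dvd_r_iff by (simp add: Xpoly_def weight_ee poly_node_poly power2_commute mult_ac)
      have "degree (Xpoly A t) \<le> 2 * card A + 1" unfolding Xpoly_def
        using degree_node_poly[OF A(1), of "[:0, 1:]" t] degree_node_poly[OF A(1), of "[:1, -1:]" t]
        by (intro degree_add_le order.trans[OF degree_smult_le]) auto
      then have "degree (smult (weight e_poly A t) 1 - Xpoly A t) \<le> 2 * card A + 1"
        by (intro degree_diff_le order.trans[OF degree_smult_le]) auto
      then show "degree (smult (weight e_poly A t) 1 - Xpoly A t) < 2 * card A + degree e_poly" by simp
    qed (use t in auto)
    then show "weight e_poly A t - poly (Xpoly A t) r = (\<Sum>j\<in>A. - poly (pderiv (\<gamma> j t)) (t j))"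
      by (simp add: \<gamma>_def)
  qed
  then have ae: "AE t in leb_on A. poly \<phi> (t a) * (weight e_poly A t - poly (Xpoly A t) r)
      = (\<Sum>j\<in>A. - (poly \<phi> (t a) * poly (pderiv (\<gamma> j t)) (t j)))"
    by (rule eventually_mono) (simp add: sum_distrib_left sum_negf)
  have pX: "coeffs_bounded A (Xpoly A)"
  proof -
    have "coeffs_bounded A (\<lambda>t. smult (discr_sq A t * (\<Prod>j\<in>A. (t j)\<^sup>2)) (node_poly [:0, 1:] A t)
       - smult (-1) (smult (discr_sq A t * (\<Prod>j\<in>A. (1 - t j)\<^sup>2)) (node_poly [:1, -1:] A t)))"
      by (intro coeffs_bounded_diff coeffs_bounded_smult coeffs_bounded_node_poly cube_bounded_discr cube_bounded_intros) auto
    then show ?thesis unfolding Xpoly_def by simp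
  qed
  have cs: "cube_bounded A (\<lambda>t. poly \<phi> (t a) * poly (pderiv (\<gamma> j t)) (t j))" if "j \<in> A" for j
    using A that by (intro cube_bounded_mult cube_bounded_poly coeffs_bounded_const cube_bounded_coord coeffs_bounded_pderiv pg)
  have cs': "cube_bounded A (\<lambda>t. - (poly \<phi> (t a) * poly (pderiv (\<gamma> j t)) (t j)))" if "j \<in> A" for j
    using cube_bounded_mult[OF cube_bounded_const[of A "-1"] cs[OF that]] by simp
  have "cube_int A (\<lambda>t. poly \<phi> (t a) * (weight e_poly A t - poly (Xpoly A t) r))
      = cube_int A (\<lambda>t. \<Sum>j\<in>A. - (poly \<phi> (t a) * poly (pderiv (\<gamma> j t)) (t j)))"
    by (rule cube_int_cong_AE[OF A(1) _ _ ae])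
      (auto intro!: cube_bounded_mult cube_bounded_poly coeffs_bounded_const cube_bounded_coord A cube_bounded_diff cube_bounded_weight pX cube_bounded_const cube_bounded_sum cs')
  also have "\<dots> = (\<Sum>j\<in>A. cube_int A (\<lambda>t. - (poly \<phi> (t a) * poly (pderiv (\<gamma> j t)) (t j))))"
    by (rule cube_int_sum[OF A(1) A(1) cs'])
  also have "\<dots> = (\<Sum>j\<in>A. if j = a then - \<Psi> a else 0)"
  proof (rule sum.cong[OF refl])
    fix j assume j: "j \<in> A"
    show "cube_int A (\<lambda>t. - (poly \<phi> (t a) * poly (pderiv (\<gamma> j t)) (t j))) = (if j = a then - \<Psi> a else 0)"
    proof (cases "j = a")
      case True
      have "cube_int A (\<lambda>t. poly (smult (-1) (\<phi> * pderiv (\<gamma> a t))) (t a)) = cube_int (A - {a}) (\<lambda>t. pint (smult (-1) (\<phi> * pderiv (\<gamma> a t))))"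
      proof (rule cube_int_poly_coord[OF A])
        show "coeffs_bounded A (\<lambda>t. smult (-1) (\<phi> * pderiv (\<gamma> a t)))"
          by (intro coeffs_bounded_smult coeffs_bounded_mult coeffs_bounded_const cube_bounded_const coeffs_bounded_pderiv pg)
      qed (simp add: \<gamma>_def hermite_term_upd)
      also have "\<dots> = - \<Psi> a" using cube_int_cmult[of "A - {a}" "-1"] by (simp add: \<Psi>_def pint_uminus)
      finally show ?thesis using True by simp
    next
      case False
      have "cube_int A (\<lambda>t. poly (smult (- poly \<phi> (t a)) (pderiv (\<gamma> j t))) (t j))
          = cube_int (A - {j}) (\<lambda>t. pint (smult (- poly \<phi> (t a)) (pderiv (\<gamma> j t))))"
      proof (rule cube_int_poly_coord[OF A(1) j])
        have "cube_bounded A (\<lambda>t. - poly \<phi> (t a))"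
          using cube_bounded_mult[OF cube_bounded_const[of A "-1"] cube_bounded_poly[OF coeffs_bounded_const[of A \<phi>] cube_bounded_coord[OF A(2)]]] by simp
        then show "coeffs_bounded A (\<lambda>t. smult (- poly \<phi> (t a)) (pderiv (\<gamma> j t)))" by (intro coeffs_bounded_smult coeffs_bounded_pderiv pg)
      qed (use False in \<open>simp add: \<gamma>_def hermite_term_upd\<close>)
      also have "\<dots> = 0" by (simp only: pint_smult pint_pderiv \<gamma>01 diff_self mult_zero_right cube_int_0)
      finally show ?thesis using False by simp
    qed
  qed
  also have "\<dots> = - \<Psi> a" using A by simp
  finally show ?thesis using 1 by simp
qed

lemma Vdm_Suc: "Vdm (Suc N) t = Vdm N t * (\<Prod>j\<in>{1..N}. t (Suc N) - t j)"
proof -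
  have "{1..<Suc N} = {1..N}" by auto
  then show ?thesis unfolding Vdm_def by simp
qed

lemma Vdm_power4: "Vdm N t ^ 4 = discr_sq {1..N} t"
proof (induction N)
  case 0
  show ?case by (simp add: Vdm_def discr_sq_def)
next
  case (Suc N)
  have ins: "{1..Suc N} = insert (Suc N) {1..N}" by auto
  have "discr_sq {1..Suc N} t = discr_sq {1..N} t * (\<Prod>i\<in>{1..N}. (t (Suc N) - t i)\<^sup>2)\<^sup>2"
    unfolding ins by (rule discr_sq_insert) auto
  moreover have "(\<Prod>i\<in>{1..N}. (t (Suc N) - t i)\<^sup>2)\<^sup>2 = (\<Prod>i\<in>{1..N}. t (Suc N) - t i) ^ 4"
    by (simp add: prod_power_distrib flip: power_mult)
  ultimately show ?case unfolding Vdm_Suc power_mult_distrib Suc.IH by simp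
qed

lemma Hker_eq: "Hker m r t = weight e_poly {1..m-1} t - poly (Xpoly {1..m-1} t) r"
  unfolding Hker_def J_ou_def J_ol_def Xpoly_def weight_ee Vdm_power4
  by (simp add: poly_node_poly power2_commute[of r] mult_ac)

section \<open>Polynomial dependence of the kernel on its two variables\<close>

definition polydeg :: "nat \<Rightarrow> (real \<Rightarrow> real) \<Rightarrow> bool" where
  "polydeg D F \<longleftrightarrow> (\<exists>p. degree p \<le> D \<and> (\<forall>s. F s = poly p s))"

lemma polydeg_mono: "polydeg D F \<Longrightarrow> D \<le> E \<Longrightarrow> polydeg E F"
  unfolding polydeg_def using order.trans by blast

lemma polydeg_const: "polydeg 0 (\<lambda>s. c)"
  unfolding polydeg_def by (rule exI[of _ "[:c:]"]) simp

lemma polydeg_id: "polydeg 1 (\<lambda>s. s)"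
  unfolding polydeg_def by (rule exI[of _ "[:0, 1:]"]) simp

lemma polydeg_diff: "polydeg D F \<Longrightarrow> polydeg E G \<Longrightarrow> polydeg (max D E) (\<lambda>s. F s - G s)"
  unfolding polydeg_def by (metis degree_diff_le max.coboundedI1 max.coboundedI2 poly_diff)

lemma polydeg_mult: "polydeg D F \<Longrightarrow> polydeg E G \<Longrightarrow> polydeg (D + E) (\<lambda>s. F s * G s)"
  unfolding polydeg_def by (metis add_mono degree_mult_le order.trans poly_mult)

lemma polydeg_power: "polydeg D F \<Longrightarrow> polydeg (k * D) (\<lambda>s. F s ^ k)"
proof (induction k)
  case (Suc k)
  then show ?case using polydeg_mult[of D F "k * D" "\<lambda>s. F s ^ k"] by simp
qed (simp add: polydeg_const)

lemma polydeg_prod: "finite I \<Longrightarrow> (\<And>i. i \<in> I \<Longrightarrow> polydeg (D i) (F i)) \<Longrightarrow> polydeg (\<Sum>i\<in>I. D i) (\<lambda>s. \<Prod>i\<in>I. F i s)"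
proof (induction I rule: finite_induct)
  case (insert i I)
  then show ?case using polydeg_mult[of "D i" "F i" "\<Sum>i\<in>I. D i" "\<lambda>s. \<Prod>i\<in>I. F i s"] by simp
qed (simp add: polydeg_const)

lemma polydeg_coord: "polydeg 1 (\<lambda>s. (t(j := s)) i)"
  using polydeg_id polydeg_mono[OF polydeg_const, of 1 "t i"] by (cases "i = j") simp_all

definition grid :: "nat \<Rightarrow> real set" where
  "grid D = real ` {..D}"

lemma finite_grid: "finite (grid D)" and card_grid: "card (grid D) = Suc D"
  by (simp_all add: grid_def card_image)

text \<open>Expansion at fixed nodes separates s from the coefficients \<open>F z\<close>. When F
  depends on further variables, integrating over them acts on the coefficients only.\<close>

lemma polydeg_expand:
  assumes "polydeg D F" shows "F s = (\<Sum>z\<in>grid D. F z * poly (lagr_poly (grid D) z) s)"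
proof -
  obtain p where p: "degree p \<le> D" "\<And>s. F s = poly p s" using assms by (auto simp: polydeg_def)
  have "p = (\<Sum>z\<in>grid D. smult (poly p z) (lagr_poly (grid D) z))"
    by (rule lagr_poly_expand) (use p in \<open>auto simp: finite_grid card_grid\<close>)
  then have "poly p s = poly (\<Sum>z\<in>grid D. smult (poly p z) (lagr_poly (grid D) z)) s" by simp
  then show ?thesis by (simp add: p(2) poly_sum)
qed

lemma polydeg_Hker_coord: "\<exists>D. \<forall>t r. polydeg D (\<lambda>s. Hker m r (t(j := s)))"
proof -
  let ?V = "4 * (\<Sum>k\<in>{1..m-1}. \<Sum>j\<in>{1..<k}. max 1 1)" and ?I = "{1..m-1}"
  have "polydeg (max (max (0 + (\<Sum>j\<in>?I. 2 * max 1 0) + (\<Sum>j\<in>?I. 2 * max 0 1) + ?V)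
      (0 + (\<Sum>j\<in>?I. 2 * max 1 0) + (\<Sum>j\<in>?I. 2 * 1) + ?V))
      (0 + (\<Sum>j\<in>?I. 2 * max 1 0) + (\<Sum>j\<in>?I. 2 * max 0 1) + ?V)) (\<lambda>s. Hker m r (t(j := s)))" for t r
    unfolding Hker_def J_ou_def J_ol_def Vdm_def
    by (intro polydeg_diff polydeg_mult polydeg_power polydeg_prod polydeg_const polydeg_coord finite_atLeastAtMost finite_atLeastLessThan)
  then show ?thesis by blast
qed

lemma polydeg_Hker: assumes "m \<ge> 2" shows "polydeg (2 * m - 1) (\<lambda>r. Hker m r t)"
proof -
  have "polydeg (max (max 0 (1 + (\<Sum>j\<in>{1..m-1}. 2 * max 0 1) + 0 + 0)) (max 0 1 + (\<Sum>j\<in>{1..m-1}. 2 * max 0 1) + 0 + 0)) (\<lambda>r. Hker m r t)"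
    unfolding Hker_def J_ou_def[of m 0] J_ol_def J_ou_def
    by (intro polydeg_diff polydeg_mult polydeg_power polydeg_prod polydeg_const polydeg_id finite_atLeastAtMost)
  then show ?thesis by (rule polydeg_mono) (use assms in simp)
qed

lemma Hker_boundary: "Hker m 0 t = 0" "Hker m 1 t = 0"
  by (simp_all add: Hker_def J_ou_def J_ol_def power2_commute[of _ 1] mult_ac)

lemma cube_bounded_coord_upd: "i \<in> insert j B \<Longrightarrow> cube_bounded B (\<lambda>t. (t(j := s)) i)"
  by (cases "i = j") (auto intro: cube_bounded_const cube_bounded_coord)

lemma cube_bounded_Hker_upd:
  assumes "{1..m-1} \<subseteq> insert j B" shows "cube_bounded B (\<lambda>t. Hker m r (t(j := s)))"
proof -
  have c: "cube_bounded B (\<lambda>t. (t(j := s)) i)" if "i \<in> {1..m-1}" for i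
    using that assms by (intro cube_bounded_coord_upd) auto
  show ?thesis unfolding Hker_def J_ou_def J_ol_def Vdm_def
    by (intro cube_bounded_diff cube_bounded_mult cube_bounded_power cube_bounded_prod cube_bounded_const c) auto
qed

lemma Hbar_eq_cint: "Hbar m r s = cube_int {2..m-1} (\<lambda>t. Hker m r (t(1 := s)))"
  by (simp only: Hbar_def cube_int_def)

lemma index_insert: "(m::nat) \<ge> 2 \<Longrightarrow> insert 1 {2..m-1} = {1..m-1}"
  by auto

text \<open>The same D serves both formulas: they express \<open>Hbar\<close> and its integrals
  against \<phi> by the same finitely many values \<open>Hbar m r z\<close>, and thereby identify
  the cube integral with a one-variable one.\<close>

lemma Hbar_expand:
  assumes "m \<ge> 2"
  obtains D where "\<And>r s. Hbar m r s = (\<Sum>z\<in>grid D. Hbar m r z * poly (lagr_poly (grid D) z) s)"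
    "\<And>\<phi> r. cube_int {1..m-1} (\<lambda>t. poly \<phi> (t 1) * Hker m r t) = (\<Sum>z\<in>grid D. Hbar m r z * pint (\<phi> * lagr_poly (grid D) z))"
proof -
  obtain D where D: "\<And>t r. polydeg D (\<lambda>s. Hker m r (t(1 := s)))" using polydeg_Hker_coord by blast
  have n: "cube_bounded {2..m-1} (\<lambda>t. Hker m r (t(1 := s)))" for r s
    by (rule cube_bounded_Hker_upd) (use index_insert[OF assms] in auto)
  have sumc: "cube_int {2..m-1} (\<lambda>t. \<Sum>z\<in>grid D. Hker m r (t(1 := z)) * c z) = (\<Sum>z\<in>grid D. Hbar m r z * c z)" for r c
  proof -
    have "cube_int {2..m-1} (\<lambda>t. \<Sum>z\<in>grid D. Hker m r (t(1 := z)) * c z)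
        = (\<Sum>z\<in>grid D. cube_int {2..m-1} (\<lambda>t. Hker m r (t(1 := z)) * c z))"
      by (rule cube_int_sum) (intro finite_grid finite_atLeastAtMost cube_bounded_mult n cube_bounded_const)+
    also have "\<dots> = (\<Sum>z\<in>grid D. Hbar m r z * c z)"
      by (rule sum.cong) (auto simp: Hbar_eq_cint mult.commute[of _ "c _"] cube_int_cmult)
    finally show ?thesis .
  qed
  have 1: "Hbar m r s = (\<Sum>z\<in>grid D. Hbar m r z * poly (lagr_poly (grid D) z) s)" for r s
  proof -
    have "Hbar m r s = cube_int {2..m-1} (\<lambda>t. \<Sum>z\<in>grid D. Hker m r (t(1 := z)) * poly (lagr_poly (grid D) z) s)"
      unfolding Hbar_eq_cint by (subst polydeg_expand[OF D]) (rule refl)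
    then show ?thesis by (simp only: sumc)
  qed
  have 2: "cube_int {1..m-1} (\<lambda>t. poly \<phi> (t 1) * Hker m r t) = (\<Sum>z\<in>grid D. Hbar m r z * pint (\<phi> * lagr_poly (grid D) z))" for \<phi> r
  proof -
    have nn: "cube_bounded {1..m-1} (\<lambda>t. poly \<phi> (t 1) * Hker m r t)"
    proof -
      have "cube_bounded {1..m-1} (\<lambda>t. Hker m r t)" unfolding Hker_def J_ou_def J_ol_def Vdm_def
        by (intro cube_bounded_diff cube_bounded_mult cube_bounded_power cube_bounded_prod cube_bounded_const cube_bounded_coord) auto
      then show ?thesis using assms by (intro cube_bounded_mult cube_bounded_poly coeffs_bounded_const cube_bounded_coord) auto
    qed
    have "cube_int {1..m-1} (\<lambda>t. poly \<phi> (t 1) * Hker m r t)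
      = cube_int {2..m-1} (\<lambda>t. LBINT s:II. poly \<phi> ((t(1 := s)) 1) * Hker m r (t(1 := s)))"
      using cube_int_insert[of "{2..m-1}" 1 "\<lambda>t. poly \<phi> (t 1) * Hker m r t"] nn unfolding index_insert[OF assms] by simp
    also have "\<dots> = cube_int {2..m-1} (\<lambda>t. \<Sum>z\<in>grid D. Hker m r (t(1 := z)) * pint (\<phi> * lagr_poly (grid D) z))"
    proof (rule arg_cong[where f = "cube_int {2..m-1}"], rule ext)
      fix t
      define p where "p = (\<Sum>z\<in>grid D. smult (Hker m r (t(1 := z))) (lagr_poly (grid D) z))"
      have "poly \<phi> ((t(1 := s)) 1) * Hker m r (t(1 := s)) = poly (\<phi> * p) s" for s
        unfolding p_def using polydeg_expand[OF D, of r t s] by (simp add: poly_sum)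
      then have "(LBINT s:II. poly \<phi> ((t(1 := s)) 1) * Hker m r (t(1 := s))) = pint (\<phi> * p)"
        unfolding pint_def by presburger
      also have "\<dots> = (\<Sum>z\<in>grid D. Hker m r (t(1 := z)) * pint (\<phi> * lagr_poly (grid D) z))"
        unfolding p_def by (simp add: sum_distrib_left pint_sum pint_smult)
      finally show "(LBINT s:II. poly \<phi> ((t(1 := s)) 1) * Hker m r (t(1 := s))) = \<dots>" .
    qed
    finally show ?thesis by (simp only: sumc)
  qed
  show thesis by (rule that[OF 1 2])
qed

text \<open>In contrast to the variable s, the exact degree 2m - 1 in r matters: it confines the
  range of the integral operator to polynomials of that degree.\<close>

lemma Hbar_expand_r:
  assumes "m \<ge> 2"
  shows "Hbar m r s = (\<Sum>z\<in>grid (2*m-1). Hbar m z s * poly (lagr_poly (grid (2*m-1)) z) r)"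
proof -
  have n: "cube_bounded {2..m-1} (\<lambda>t. Hker m r (t(1 := s)))" for r s
    by (rule cube_bounded_Hker_upd) (use index_insert[OF assms] in auto)
  have "Hbar m r s = cube_int {2..m-1} (\<lambda>t. \<Sum>z\<in>grid (2*m-1). Hker m z (t(1 := s)) * poly (lagr_poly (grid (2*m-1)) z) r)"
    unfolding Hbar_eq_cint by (subst polydeg_expand[OF polydeg_Hker[OF assms]]) (rule refl)
  also have "\<dots> = (\<Sum>z\<in>grid (2*m-1). cube_int {2..m-1} (\<lambda>t. Hker m z (t(1 := s)) * poly (lagr_poly (grid (2*m-1)) z) r))"
    by (rule cube_int_sum) (intro finite_grid finite_atLeastAtMost cube_bounded_mult n cube_bounded_const)+
  also have "\<dots> = (\<Sum>z\<in>grid (2*m-1). Hbar m z s * poly (lagr_poly (grid (2*m-1)) z) r)"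
    by (rule sum.cong) (auto simp: Hbar_eq_cint mult.commute[of _ "poly _ _"] cube_int_cmult)
  finally show ?thesis .
qed

lemma Hbar_boundary: "Hbar m 0 s = 0" "Hbar m 1 s = 0"
  by (simp_all add: Hbar_eq_cint Hker_boundary cube_int_0)

definition Hconst :: "nat \<Rightarrow> real" where
  "Hconst m = 1 / Vol_moment_space (2*m-1) * (2 / (fact (2*m-1) * fact (m-2)))"

lemma Hhat_Hconst: "Hhat m r s = Hconst m * Hbar m r s"
  by (simp add: Hhat_def Hconst_def)

lemma Hhat_polynomial:
  assumes m: "m \<ge> 2"
  obtains qH :: "real \<Rightarrow> real poly" and D where
    "\<And>r s. Hhat m r s = poly (qH r) s" "\<And>r. degree (qH r) \<le> D"
    "\<And>\<phi> r. poly \<phi> 0 = 0 \<Longrightarrow> poly \<phi> 1 = 0 \<Longrightarrow> degree \<phi> \<le> 2*m-1 \<Longrightarrow> pint (\<phi> * qH r) = poly \<phi> r"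
    "\<And>r. qH r = (\<Sum>z\<in>grid (2*m-1). smult (poly (lagr_poly (grid (2*m-1)) z) r) (qH z))"
    "qH 0 = 0" "qH 1 = 0"
proof -
  obtain D where D: "\<And>r s. Hbar m r s = (\<Sum>z\<in>grid D. Hbar m r z * poly (lagr_poly (grid D) z) s)"
    and D2: "\<And>\<phi> r. cube_int {1..m-1} (\<lambda>t. poly \<phi> (t 1) * Hker m r t) = (\<Sum>z\<in>grid D. Hbar m r z * pint (\<phi> * lagr_poly (grid D) z))"
    by (rule Hbar_expand[OF m]) blast
  define qH where "qH r = smult (Hconst m) (\<Sum>z\<in>grid D. smult (Hbar m r z) (lagr_poly (grid D) z))" for r
  have H: "Hhat m r s = poly (qH r) s" for r s
    using D[of r s] by (simp add: Hhat_def qH_def Hconst_def poly_sum)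
  have deg: "degree (qH r) \<le> D" for r unfolding qH_def
  proof (intro order.trans[OF degree_smult_le] degree_sum_le finite_grid)
    fix z assume "z \<in> grid D"
    then show "degree (lagr_poly (grid D) z) \<le> D"
      using degree_lagr[OF finite_grid, of z D] by (simp add: card_grid)
  qed
  have rep: "pint (\<phi> * qH r) = poly \<phi> r"
    if \<phi>: "poly \<phi> 0 = 0" "poly \<phi> 1 = 0" "degree \<phi> \<le> 2*m-1" for \<phi> r
  proof -
    let ?A = "{1..m-1}"
    have cA: "card ?A = m - 1" by simp
    have N: "2 * (m - 1) + 1 = 2 * m - 1" using m by simp
    have "2 * real (card ?A) * cube_int ?A (\<lambda>t. poly \<phi> (t 1) * (weight e_poly ?A t - poly (Xpoly ?A t) r)) = poly \<phi> r * selberg (card ?A)"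
      by (rule Hker_moment) (use m \<phi> in auto)
    then have e: "2 * real (m - 1) * cube_int ?A (\<lambda>t. poly \<phi> (t 1) * Hker m r t) = poly \<phi> r * selberg (m - 1)"
      by (simp only: Hker_eq cA)
    have "pint (\<phi> * qH r) = Hconst m * cube_int ?A (\<lambda>t. poly \<phi> (t 1) * Hker m r t)"
      unfolding D2 qH_def by (simp add: pint_smult pint_sum sum_distrib_left)
    also have "\<dots> = Hconst m * (poly \<phi> r * selberg (m - 1) / (2 * real (m - 1)))"
      using e m by (simp add: field_simps)
    also have "\<dots> = poly \<phi> r"
    proof -
      \<comment> \<open>The moment identity leaves \<open>selberg (m - 1)\<close> / (2 (m - 1)).
        With (m - 1)! = (m - 1) (m - 2)! its reciprocal is precisely the normalising factor of
        \<open>Hhat\<close>.\<close>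
      define V where "V = Vol_moment_space (2*m-1)"
      have V: "V > 0" unfolding V_def Vol_moment_space_eq by (intro prod_pos) (simp add: beta_int_pos)
      have s: "selberg (m - 1) = fact (2*m-1) * fact (m-1) * V"
        unfolding selberg_def N V_def Vol_moment_space_eq by simp
      obtain k where k: "m = Suc (Suc k)" using m by (metis add_2_eq_Suc le_Suc_ex)
      have f: "(fact (m-1) :: real) = real (m-1) * fact (m-2)" by (simp add: k)
      have "(1 / V * (2 / (F * G))) * (x * (F * (n * G) * V) / (2 * n)) = x" if "F \<noteq> 0" "G \<noteq> 0" "n \<noteq> 0" for F G n x
        using V that by (simp add: field_simps)
      from this[of "fact (2*m-1)" "fact (m-2)" "real (m-1)" "poly \<phi> r"] show ?thesis
        unfolding Hconst_def s f V_def[symmetric] using m by simp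
    qed
    finally show ?thesis .
  qed
  have lin: "qH r = (\<Sum>z\<in>grid (2*m-1). smult (poly (lagr_poly (grid (2*m-1)) z) r) (qH z))" for r
  proof (rule poly_ext)
    fix s
    have "Hhat m r s = (\<Sum>z\<in>grid (2*m-1). poly (lagr_poly (grid (2*m-1)) z) r * Hhat m z s)"
      unfolding Hhat_Hconst by (subst Hbar_expand_r[OF m]) (simp add: sum_distrib_left mult_ac)
    then show "poly (qH r) s = poly (\<Sum>z\<in>grid (2*m-1). smult (poly (lagr_poly (grid (2*m-1)) z) r) (qH z)) s"
      by (simp add: H poly_sum)
  qed
  have "qH 0 = 0" "qH 1 = 0" by (simp_all add: qH_def Hbar_boundary)
  from that[OF H deg rep lin this] show thesis .
qed

section \<open>Finite-dimensional reproducing kernel Hilbert spaces\<close>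

definition lin_comb :: "'s set \<Rightarrow> 'i set \<Rightarrow> ('i \<Rightarrow> 's \<Rightarrow> real) \<Rightarrow> ('i \<Rightarrow> real) \<Rightarrow> 's \<Rightarrow> real" where
  "lin_comb S J \<alpha> c = (\<lambda>x\<in>S. \<Sum>j\<in>J. c j * \<alpha> j x)"

lemma lin_comb_extensional: "lin_comb S J \<alpha> c \<in> extensional S"
  by (simp add: lin_comb_def)

lemma lin_comb_combine: "(\<lambda>x\<in>S. a * lin_comb S J \<alpha> c x + b * lin_comb S J \<alpha> d x) = lin_comb S J \<alpha> (\<lambda>j. a * c j + b * d j)"
  by (auto simp: lin_comb_def sum.distrib sum_distrib_left algebra_simps fun_eq_iff)

lemma lin_comb_diff: "(\<lambda>x\<in>S. lin_comb S J \<alpha> c x - lin_comb S J \<alpha> d x) = lin_comb S J \<alpha> (\<lambda>j. c j - d j)"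
  using lin_comb_combine[where a = 1 and b = "-1" and c = c and d = d and S = S and J = J and \<alpha> = \<alpha>] by (simp add: algebra_simps)

lemma lin_comb_0: "(\<lambda>x\<in>S. 0) = lin_comb S J \<alpha> (\<lambda>j. 0)"
  by (simp add: lin_comb_def)

text \<open>Independence identifies H with Euclidean space on J. Cauchy sequences converge
  coordinatewise, and Cauchy-Schwarz bounds point evaluations.\<close>

lemma rkhs_finite_dim:
  fixes \<alpha> :: "'i \<Rightarrow> 's \<Rightarrow> real"
  assumes J: "finite J"
    and indep: "\<And>c. (\<And>x. x \<in> S \<Longrightarrow> (\<Sum>j\<in>J. c j * \<alpha> j x) = 0) \<Longrightarrow> (\<And>j. j \<in> J \<Longrightarrow> c j = 0)"
    and H: "H = range (lin_comb S J \<alpha>)"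
    and ip: "\<And>c d. ip (lin_comb S J \<alpha> c) (lin_comb S J \<alpha> d) = (\<Sum>j\<in>J. c j * d j)"
    and K: "\<And>x y. x \<in> S \<Longrightarrow> y \<in> S \<Longrightarrow> K x y = (\<Sum>j\<in>J. \<alpha> j x * \<alpha> j y)"
  shows "rkhs_with_kernel S H ip K"
proof -
  let ?F = "lin_comb S J \<alpha>"
  have dist: "ip_dist S H ip (?F c) (?F d) = L2_set (\<lambda>j. c j - d j) J" for c d
    by (simp add: ip_dist_def H lin_comb_diff ip L2_set_def power2_eq_square)
  have inj: "c j = d j" if "?F c = ?F d" "j \<in> J" for c d j
  proof -
    have "(\<Sum>j\<in>J. (c j - d j) * \<alpha> j x) = 0" if "x \<in> S" for x
      using fun_cong[OF \<open>?F c = ?F d\<close>, of x] that by (simp add: lin_comb_def left_diff_distrib sum_subtractf)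
    then have "c j - d j = 0" using indep[of "\<lambda>j. c j - d j"] \<open>j \<in> J\<close> by blast
    then show ?thesis by simp
  qed
  have F_cong: "?F c = ?F d" if "\<And>j. j \<in> J \<Longrightarrow> c j = d j" for c d
    using that by (auto simp: lin_comb_def fun_eq_iff intro!: sum.cong)
  have pos: "ip f f > 0" if fH: "f \<in> H" and f0: "f \<noteq> (\<lambda>x\<in>S. 0)" for f
  proof -
    obtain c where c: "f = ?F c" using fH H by auto
    have "\<exists>j\<in>J. c j \<noteq> 0" using f0 F_cong[of c "\<lambda>j. 0"] unfolding c lin_comb_0[of S J \<alpha>] by blast
    then obtain j where j: "j \<in> J" "c j \<noteq> 0" by blast
    have "0 < c j * c j" using j by (metis not_real_square_gt_zero)
    also have "\<dots> \<le> (\<Sum>j\<in>J. c j * c j)" using J j by (intro member_le_sum) auto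
    finally show ?thesis by (simp add: c ip)
  qed
  interpret M: Metric_space H "ip_dist S H ip"
  proof
    show "0 \<le> ip_dist S H ip f g" for f g
    proof (cases "f \<in> H \<and> g \<in> H")
      case True
      then obtain c d where "f = ?F c" "g = ?F d" using H by auto
      then show ?thesis by (simp add: dist)
    qed (auto simp: ip_dist_def)
    show "ip_dist S H ip f g = ip_dist S H ip g f" for f g
    proof (cases "f \<in> H \<and> g \<in> H")
      case True
      then obtain c d where "f = ?F c" "g = ?F d" using H by auto
      then show ?thesis by (simp add: dist L2_set_def power2_commute)
    qed (auto simp: ip_dist_def)
    show "ip_dist S H ip f g = 0 \<longleftrightarrow> f = g" if fg: "f \<in> H" "g \<in> H" for f g
    proof -
      obtain c d where cd: "f = ?F c" "g = ?F d" using H fg by auto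
      have "L2_set (\<lambda>j. c j - d j) J = 0 \<longleftrightarrow> (\<forall>j\<in>J. c j = d j)" by (simp add: L2_set_eq_0_iff J)
      then show ?thesis using inj[of c d] F_cong[of c d] unfolding cd dist by blast
    qed
    show "ip_dist S H ip f h \<le> ip_dist S H ip f g + ip_dist S H ip g h" if fgh: "f \<in> H" "g \<in> H" "h \<in> H" for f g h
    proof -
      obtain c d e where cd: "f = ?F c" "g = ?F d" "h = ?F e" using H fgh by auto
      have "L2_set (\<lambda>j. (c j - d j) + (d j - e j)) J \<le> L2_set (\<lambda>j. c j - d j) J + L2_set (\<lambda>j. d j - e j) J"
        by (rule L2_set_triangle_ineq)
      then show ?thesis by (simp add: cd dist)
    qed
  qed
  have complete: "M.mcomplete"
    unfolding M.mcomplete_def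
  proof (intro allI impI)
    fix \<sigma> assume C: "M.MCauchy \<sigma>"
    then have "range \<sigma> \<subseteq> H" unfolding M.MCauchy_def by blast
    then have "\<forall>n. \<exists>c. \<sigma> n = ?F c" unfolding H by blast
    then obtain c where c: "\<And>n. \<sigma> n = ?F (c n)" by metis
    have "convergent (\<lambda>n. c n j)" if j: "j \<in> J" for j
    proof (rule real_Cauchy_convergent, rule metric_CauchyI)
      fix e :: real assume "e > 0"
      then obtain N where N: "\<And>n n'. N \<le> n \<Longrightarrow> N \<le> n' \<Longrightarrow> ip_dist S H ip (\<sigma> n) (\<sigma> n') < e"
        using C unfolding M.MCauchy_def by blast
      have "dist (c m j) (c n j) < e" if "m \<ge> N" "n \<ge> N" for m n
      proof -
        have "\<bar>c m j - c n j\<bar> \<le> L2_set (\<lambda>j. \<bar>c m j - c n j\<bar>) J" using J j by (rule member_le_L2_set)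
        also have "\<dots> = ip_dist S H ip (\<sigma> m) (\<sigma> n)" by (simp add: c dist L2_set_def)
        also have "\<dots> < e" using N that by simp
        finally show ?thesis by (simp add: dist_real_def)
      qed
      then show "\<exists>M. \<forall>m\<ge>M. \<forall>n\<ge>M. dist (c m j) (c n j) < e" by blast
    qed
    then have "\<forall>j\<in>J. \<exists>l. (\<lambda>n. c n j) \<longlonglongrightarrow> l" by (simp add: convergent_def)
    then obtain l where l: "\<And>j. j \<in> J \<Longrightarrow> (\<lambda>n. c n j) \<longlonglongrightarrow> l j" by metis
    have "(\<lambda>n. L2_set (\<lambda>j. c n j - l j) J) \<longlonglongrightarrow> sqrt (\<Sum>j\<in>J. (l j - l j)\<^sup>2)"
      unfolding L2_set_def by (intro tendsto_intros l)
    then have lim: "(\<lambda>n. ip_dist S H ip (\<sigma> n) (?F l)) \<longlonglongrightarrow> 0" by (simp add: c dist)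
    have "limitin M.mtopology \<sigma> (?F l) sequentially"
      unfolding M.limit_metric_sequentially
    proof (intro conjI allI impI)
      show "?F l \<in> H" by (simp add: H)
      fix e :: real assume "e > 0"
      then obtain N where "\<forall>n\<ge>N. \<bar>ip_dist S H ip (\<sigma> n) (?F l)\<bar> < e"
        using LIMSEQ_D[OF lim, of e] by auto
      then show "\<exists>N. \<forall>n\<ge>N. \<sigma> n \<in> H \<and> ip_dist S H ip (\<sigma> n) (?F l) < e"
        using c H by (auto simp: abs_less_iff)
    qed
    then show "\<exists>x. limitin M.mtopology \<sigma> x sequentially" by blast
  qed
  have eval: "continuous_map M.mtopology euclideanreal (\<lambda>f. f x)" if x: "x \<in> S" for x
  proof -
    \<comment> \<open>The added 1 keeps the Lipschitz constant positive, so that e / B can serve as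
      \<delta>.\<close>
    define B where "B = L2_set (\<lambda>j. \<alpha> j x) J + 1"
    have B: "B > 0" unfolding B_def by (intro add_nonneg_pos) auto
    have lip: "\<bar>f x - g x\<bar> \<le> B * ip_dist S H ip f g" if fg: "f \<in> H" "g \<in> H" for f g
    proof -
      obtain c d where cd: "f = ?F c" "g = ?F d" using H fg by auto
      have "\<bar>f x - g x\<bar> = \<bar>\<Sum>j\<in>J. (c j - d j) * \<alpha> j x\<bar>"
        using x by (simp add: cd lin_comb_def sum_subtractf left_diff_distrib)
      also have "\<dots> \<le> (\<Sum>j\<in>J. \<bar>c j - d j\<bar> * \<bar>\<alpha> j x\<bar>)"
        by (rule order.trans[OF sum_abs]) (simp add: abs_mult)
      also have "\<dots> \<le> L2_set (\<lambda>j. c j - d j) J * L2_set (\<lambda>j. \<alpha> j x) J" by (rule L2_set_mult_ineq)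
      also have "\<dots> \<le> ip_dist S H ip f g * B" by (simp add: cd dist B_def mult_left_mono)
      finally show ?thesis by (simp add: mult.commute)
    qed
    have "continuous_map M.mtopology Met_TC.mtopology (\<lambda>f. f x)"
      unfolding M.metric_continuous_map[OF Met_TC.Metric_space_axioms]
    proof (intro conjI ballI allI impI)
      fix f and e :: real assume f: "f \<in> H" and e: "e > 0"
      show "\<exists>\<delta>>0. \<forall>g. g \<in> H \<and> ip_dist S H ip f g < \<delta> \<longrightarrow> dist (f x) (g x) < e"
      proof (intro exI[of _ "e / B"] conjI allI impI)
        fix g assume g: "g \<in> H \<and> ip_dist S H ip f g < e / B"
        have "dist (f x) (g x) \<le> B * ip_dist S H ip f g" using lip[of f g] f g by (simp add: dist_real_def)
        also have "\<dots> < e" using g B by (simp add: field_simps)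
        finally show "dist (f x) (g x) < e" .
      qed (use e B in auto)
    qed auto
    then show ?thesis by simp
  qed
  have "rkhs S H ip"
  proof
    show "H \<subseteq> extensional S" using H lin_comb_extensional by auto
    show "(\<lambda>x\<in>S. 0) \<in> H" unfolding H lin_comb_0[of S J \<alpha>] by blast
    show "(\<lambda>x\<in>S. a * f x + b * g x) \<in> H" if "f \<in> H" "g \<in> H" for a b f g
      using that unfolding H by (auto simp: lin_comb_combine)
    show "ip f g = ip g f" if "f \<in> H" "g \<in> H" for f g
      using that unfolding H by (auto simp: ip mult.commute)
    show "ip (\<lambda>x\<in>S. a * f x + b * g x) h = a * ip f h + b * ip g h" if "f \<in> H" "g \<in> H" "h \<in> H" for a b f g h
      using that unfolding H by (auto simp: lin_comb_combine ip sum.distrib sum_distrib_left algebra_simps)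
  qed (use pos complete eval in auto)
  moreover have k: "(\<lambda>y\<in>S. K x y) = ?F (\<lambda>j. \<alpha> j x)" if "x \<in> S" for x
    using K that by (auto simp: lin_comb_def fun_eq_iff)
  ultimately show ?thesis
    unfolding rkhs_with_kernel_def H by (auto simp: k ip) (simp add: lin_comb_def)
qed

text \<open>Gram-Schmidt by degree: the elements of U without a coefficient at D form a subspace of
  codimension at most one, and at most one further vector completes its basis.\<close>

lemma orthonormal_poly_basis:
  fixes U :: "real poly set"
  assumes "0 \<in> U" "\<And>p q a b. p \<in> U \<Longrightarrow> q \<in> U \<Longrightarrow> smult a p + smult b q \<in> U"
    and "\<And>p. p \<in> U \<Longrightarrow> p = 0 \<or> degree p < D"
  shows "\<exists>B. finite B \<and> B \<subseteq> U \<and> (\<forall>b\<in>B. \<forall>b'\<in>B. pint (b * b') = (if b = b' then 1 else 0))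
    \<and> (\<forall>u\<in>U. u = (\<Sum>b\<in>B. smult (pint (u * b)) b))"
  using assms
proof (induction D arbitrary: U)
  case 0
  then show ?case by (intro exI[of _ "{}"]) auto
next
  case (Suc D)
  note lin = Suc.prems(2)
  define U' where "U' = {p \<in> U. coeff p D = 0}"
  have sub: "U' \<subseteq> U" by (auto simp: U'_def)
  have "p = 0 \<or> degree p < D" if "p \<in> U'" for p
  proof (rule ccontr)
    assume "\<not> (p = 0 \<or> degree p < D)"
    then have "p \<noteq> 0" "degree p = D" using Suc.prems(3)[of p] that sub by auto
    then show False using that by (auto simp: U'_def)
  qed
  moreover have "0 \<in> U'" using Suc.prems(1) by (simp add: U'_def)
  moreover have "smult a p + smult b q \<in> U'" if "p \<in> U'" "q \<in> U'" for p q a b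
    using that lin[of p q a b] by (simp add: U'_def)
  ultimately have "\<exists>B. finite B \<and> B \<subseteq> U' \<and> (\<forall>b\<in>B. \<forall>b'\<in>B. pint (b * b') = (if b = b' then 1 else 0))
    \<and> (\<forall>u\<in>U'. u = (\<Sum>b\<in>B. smult (pint (u * b)) b))"
    by (intro Suc.IH)
  then obtain B where B0: "finite B \<and> B \<subseteq> U' \<and> (\<forall>b\<in>B. \<forall>b'\<in>B. pint (b * b') = (if b = b' then 1 else 0))
    \<and> (\<forall>u\<in>U'. u = (\<Sum>b\<in>B. smult (pint (u * b)) b))" ..
  have B: "finite B" "B \<subseteq> U'"
    "\<And>b b'. b \<in> B \<Longrightarrow> b' \<in> B \<Longrightarrow> pint (b * b') = (if b = b' then 1 else 0)"
    using B0 by simp_all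
  have B4: "u = (\<Sum>b\<in>B. smult (pint (u * b)) b)" if "u \<in> U'" for u
    using B0 that by (elim conjE) (drule (1) bspec)
  show ?case
  proof (cases "U' = U")
    case True
    show ?thesis by (rule exI[of _ B]) (rule B0[unfolded True])
  next
    case False
    then obtain u0 where u0: "u0 \<in> U" "coeff u0 D \<noteq> 0" using sub by (auto simp: U'_def)
    have sumU: "(\<Sum>b\<in>C. smult (f b) b) \<in> U'" if "C \<subseteq> B" "finite C" for C f
      using that(2,1)
    proof (induction C rule: finite_induct)
      case empty
      then show ?case using Suc.prems(1) by (simp add: U'_def)
    next
      case (insert b C)
      then have "b \<in> U'" "(\<Sum>b\<in>C. smult (f b) b) \<in> U'" using B(2) by auto
      then have "smult (f b) b + smult 1 (\<Sum>b\<in>C. smult (f b) b) \<in> U'"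
        using lin[of b "\<Sum>b\<in>C. smult (f b) b" "f b" 1] by (simp add: U'_def)
      then show ?case using insert by simp
    qed
    define v where "v = u0 - (\<Sum>b\<in>B. smult (pint (u0 * b)) b)"
    have sU: "(\<Sum>b\<in>B. smult (pint (u0 * b)) b) \<in> U'" by (rule sumU[OF subset_refl B(1)])
    have vU: "v \<in> U" using lin[OF u0(1) subsetD[OF sub sU], of 1 "-1"] by (simp add: v_def)
    have vD: "coeff v D \<noteq> 0" using u0(2) sU by (simp add: v_def U'_def)
    have v0: "v \<noteq> 0" using vD by auto
    have orth: "pint (v * b) = 0" if b: "b \<in> B" for b
    proof -
      have "pint (v * b) = pint (u0 * b) - (\<Sum>b'\<in>B. pint (u0 * b') * pint (b' * b))"
        by (simp add: v_def left_diff_distrib sum_distrib_right pint_diff pint_sum pint_smult)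
      also have "(\<Sum>b'\<in>B. pint (u0 * b') * pint (b' * b)) = (\<Sum>b'\<in>B. if b' = b then pint (u0 * b) else 0)"
        using B(3) b by (intro sum.cong) auto
      finally show ?thesis using B b by simp
    qed
    define e where "e = smult (1 / sqrt (pint (v * v))) v"
    have pv: "pint (v * v) > 0" by (rule pint_square_pos[OF v0])
    have e1: "pint (e * e) = 1" using pv by (simp add: e_def pint_smult real_sqrt_mult_self)
    have eb: "pint (e * b) = 0" "pint (b * e) = 0" if "b \<in> B" for b
      using orth[OF that] by (simp_all add: e_def pint_smult mult.commute)
    have eD: "coeff e D \<noteq> 0" using vD pv by (simp add: e_def)
    have eU: "e \<in> U" using lin[OF vU vU, of "1 / sqrt (pint (v * v))" 0] by (simp add: e_def)
    have eB: "e \<notin> B" using eD B(2) by (auto simp: U'_def)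
    have "u = (\<Sum>b\<in>insert e B. smult (pint (u * b)) b)" if u: "u \<in> U" for u
    proof -
      define c where "c = coeff u D / coeff e D"
      define w where "w = u - smult c e"
      have "w \<in> U'" using lin[OF u eU, of 1 "- c"] eD by (simp add: w_def U'_def c_def)
      then have w: "w = (\<Sum>b\<in>B. smult (pint (w * b)) b)" by (rule B4)
      have wb: "pint (w * b) = pint (u * b)" if "b \<in> B" for b
        using eb[OF that] by (simp add: w_def left_diff_distrib pint_diff pint_smult)
      have "w = (\<Sum>b\<in>B. smult (pint (u * b)) b)"
        using w wb by (metis (no_types, lifting) sum.cong)
      moreover have "pint (u * e) = c"
      proof -
        have "pint (w * e) = (\<Sum>b\<in>B. pint (w * b) * pint (b * e))"
          by (subst w) (simp add: sum_distrib_right pint_sum pint_smult)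
        then have "pint (w * e) = 0" using eb by simp
        then show ?thesis using e1 by (simp add: w_def left_diff_distrib pint_diff pint_smult)
      qed
      ultimately show ?thesis using B(1) eB by (simp add: w_def algebra_simps)
    qed
    then have "\<forall>u\<in>U. u = (\<Sum>b\<in>insert e B. smult (pint (u * b)) b)" by blast
    moreover have "\<forall>b\<in>insert e B. \<forall>b'\<in>insert e B. pint (b * b') = (if b = b' then 1 else 0)"
      using B(3) eb e1 eB by auto
    moreover have "finite (insert e B)" "insert e B \<subseteq> U" using B(1,2) eU sub by auto
    ultimately show ?thesis by (intro exI[of _ "insert e B"] conjI)
  qed
qed

section \<open>Square integrable functions and operators with polynomial kernel\<close>

lemma L2_mult_integrable:
  assumes "\<phi> \<in> L2" "\<psi> \<in> L2" shows "integrable (lebesgue_on II) (\<lambda>s. \<phi> s * \<psi> s)"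
proof (rule Bochner_Integration.integrable_bound)
  show "integrable (lebesgue_on II) (\<lambda>s. (\<phi> s)\<^sup>2 + (\<psi> s)\<^sup>2)" using assms by (simp add: L2_def)
  show "(\<lambda>s. \<phi> s * \<psi> s) \<in> borel_measurable (lebesgue_on II)" using assms by (auto simp: L2_def)
  have "\<bar>a * b\<bar> \<le> a\<^sup>2 + b\<^sup>2" for a b :: real
  proof -
    have "2 * (\<bar>a\<bar> * \<bar>b\<bar>) \<le> \<bar>a\<bar>\<^sup>2 + \<bar>b\<bar>\<^sup>2" using sum_squares_bound[of "\<bar>a\<bar>" "\<bar>b\<bar>"] by simp
    moreover have "0 \<le> \<bar>a\<bar> * \<bar>b\<bar>" by simp
    ultimately show ?thesis unfolding abs_mult power2_abs by linarith
  qed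
  then show "AE s in lebesgue_on II. norm (\<phi> s * \<psi> s) \<le> norm ((\<phi> s)\<^sup>2 + (\<psi> s)\<^sup>2)" by simp
qed

lemma L2_combine:
  assumes "\<phi> \<in> L2" "\<psi> \<in> L2" shows "(\<lambda>s. a * \<phi> s + b * \<psi> s) \<in> L2"
proof -
  have i: "integrable (lebesgue_on II) (\<lambda>s. (\<phi> s)\<^sup>2)" "integrable (lebesgue_on II) (\<lambda>s. (\<psi> s)\<^sup>2)"
    using assms by (auto simp: L2_def)
  have "integrable (lebesgue_on II) (\<lambda>s. a\<^sup>2 * (\<phi> s)\<^sup>2 + b\<^sup>2 * (\<psi> s)\<^sup>2 + (2 * a * b) * (\<phi> s * \<psi> s))"
    using i L2_mult_integrable[OF assms] by (intro Bochner_Integration.integrable_add integrable_mult_right)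
  moreover have "(\<lambda>s. (a * \<phi> s + b * \<psi> s)\<^sup>2) = (\<lambda>s. a\<^sup>2 * (\<phi> s)\<^sup>2 + b\<^sup>2 * (\<psi> s)\<^sup>2 + (2 * a * b) * (\<phi> s * \<psi> s))"
    by (auto simp: power2_eq_square algebra_simps)
  ultimately show ?thesis using assms by (auto simp: L2_def)
qed

lemma poly_L2: "poly p \<in> L2"
proof -
  have c: "continuous_on II (poly p)" "continuous_on II (\<lambda>s. (poly p s)\<^sup>2)" by (intro continuous_intros)+
  then show ?thesis unfolding L2_def
    using continuous_imp_measurable_on_sets_lebesgue[OF c(1)] continuous_imp_integrable_real[of 0 1, OF c(2)] by auto
qed

lemma L2_inner_commute: "L2_inner \<phi> \<psi> = L2_inner \<psi> \<phi>"
  by (simp add: L2_inner_def mult.commute)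

lemma L2_inner_combine:
  assumes "\<phi> \<in> L2" "\<psi> \<in> L2" "\<rho> \<in> L2"
  shows "L2_inner (\<lambda>s. a * \<phi> s + b * \<psi> s) \<rho> = a * L2_inner \<phi> \<rho> + b * L2_inner \<psi> \<rho>"
proof -
  have "(\<lambda>s. (a * \<phi> s + b * \<psi> s) * \<rho> s) = (\<lambda>s. a * (\<phi> s * \<rho> s) + b * (\<psi> s * \<rho> s))"
    by (auto simp: algebra_simps)
  then show ?thesis unfolding L2_inner_def
    using L2_mult_integrable[OF assms(1,3)] L2_mult_integrable[OF assms(2,3)] by simp
qed

lemma L2_inner_cong:
  "(\<And>s. s \<in> II \<Longrightarrow> \<phi> s = \<phi>' s) \<Longrightarrow> (\<And>s. s \<in> II \<Longrightarrow> \<psi> s = \<psi>' s) \<Longrightarrow> L2_inner \<phi> \<psi> = L2_inner \<phi>' \<psi>'"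
  unfolding L2_inner_def by (rule Bochner_Integration.integral_cong) (auto simp: space_restrict_space)

lemma L2_inner_poly: "L2_inner (poly p) (poly q) = pint (p * q)"
  unfolding L2_inner_def by (simp flip: pint_lebesgue_on)

definition poly_comb :: "real poly set \<Rightarrow> (real poly \<Rightarrow> real) \<Rightarrow> real poly" where
  "poly_comb B c = (\<Sum>b\<in>B. smult (c b) b)"

lemma poly_psum: "poly (poly_comb B c) s = (\<Sum>b\<in>B. c b * poly b s)"
  by (simp add: poly_comb_def poly_sum)

lemma L2_inner_psum:
  assumes "finite B" "\<phi> \<in> L2"
  shows "L2_inner \<phi> (poly (poly_comb B c)) = (\<Sum>b\<in>B. c b * L2_inner \<phi> (poly b))"
proof -
  have "L2_inner \<phi> (poly (poly_comb B c)) = (\<integral>s. (\<Sum>b\<in>B. c b * (\<phi> s * poly b s)) \<partial>lebesgue_on II)"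
    unfolding L2_inner_def poly_psum by (simp add: sum_distrib_left mult_ac)
  also have "\<dots> = (\<Sum>b\<in>B. c b * L2_inner \<phi> (poly b))"
    unfolding L2_inner_def using L2_mult_integrable[OF assms(2) poly_L2] by simp
  finally show ?thesis .
qed

definition orthonormal_polys :: "real poly set \<Rightarrow> bool" where
  "orthonormal_polys B \<longleftrightarrow> finite B \<and> (\<forall>b\<in>B. \<forall>b'\<in>B. pint (b * b') = (if b = b' then 1 else 0))"

lemma pint_psum_basis:
  assumes "orthonormal_polys B" "b \<in> B" shows "pint (poly_comb B c * b) = c b"
proof -
  have "pint (poly_comb B c * b) = (\<Sum>b'\<in>B. c b' * pint (b' * b))"
    by (simp add: poly_comb_def sum_distrib_right pint_sum pint_smult)
  also have "\<dots> = (\<Sum>b'\<in>B. if b' = b then c b else 0)"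
    using assms by (intro sum.cong) (auto simp: orthonormal_polys_def)
  finally show ?thesis using assms by (simp add: orthonormal_polys_def)
qed

lemma pint_psum_psum:
  assumes "orthonormal_polys B" shows "pint (poly_comb B c * poly_comb B d) = (\<Sum>b\<in>B. c b * d b)"
proof -
  have "pint (poly_comb B c * poly_comb B d) = (\<Sum>b\<in>B. d b * pint (poly_comb B c * b))"
    by (simp add: poly_comb_def[of B d] sum_distrib_left pint_sum pint_smult)
  then show ?thesis using pint_psum_basis[OF assms] by (simp add: mult.commute)
qed

text \<open>The double annihilator is used as the span of the sections, so that the coordinate functions
  of the sections in an orthonormal basis are linearly independent.\<close>
lemma section_basis:
  fixes q :: "'a \<Rightarrow> real poly"
  assumes "\<And>r. r \<in> S \<Longrightarrow> degree (q r) \<le> D"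
  obtains B where "orthonormal_polys B" "\<forall>r\<in>S. q r = poly_comb B (\<lambda>b. pint (q r * b))"
    "\<forall>c. (\<forall>r\<in>S. (\<Sum>b\<in>B. c b * pint (q r * b)) = 0) \<longrightarrow> (\<forall>b\<in>B. c b = 0)"
proof -
  define U where "U = {p. degree p \<le> D \<and> (\<forall>g. (\<forall>r\<in>S. pint (q r * g) = 0) \<longrightarrow> pint (p * g) = 0)}"
  have "\<exists>B. finite B \<and> B \<subseteq> U \<and> (\<forall>b\<in>B. \<forall>b'\<in>B. pint (b * b') = (if b = b' then 1 else 0))
    \<and> (\<forall>u\<in>U. u = (\<Sum>b\<in>B. smult (pint (u * b)) b))"
  proof (rule orthonormal_poly_basis[where D = "Suc D"])
    show "0 \<in> U" by (simp add: U_def)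
    show "smult a p + smult b s \<in> U" if "p \<in> U" "s \<in> U" for p s a b
      using that by (auto simp: U_def distrib_right pint_add pint_smult intro!: degree_add_le order.trans[OF degree_smult_le])
    show "p = 0 \<or> degree p < Suc D" if "p \<in> U" for p using that by (simp add: U_def)
  qed
  then obtain B where B: "finite B \<and> B \<subseteq> U \<and> (\<forall>b\<in>B. \<forall>b'\<in>B. pint (b * b') = (if b = b' then 1 else 0))
    \<and> (\<forall>u\<in>U. u = (\<Sum>b\<in>B. smult (pint (u * b)) b))" ..
  have on: "orthonormal_polys B" using B by (simp add: orthonormal_polys_def)
  have ex: "q r = poly_comb B (\<lambda>b. pint (q r * b))" if r: "r \<in> S" for r
  proof -
    have "q r \<in> U" using assms r by (auto simp: U_def)
    then show ?thesis unfolding poly_comb_def using B by (elim conjE) (drule (1) bspec)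
  qed
  have "c b = 0" if c: "\<And>r. r \<in> S \<Longrightarrow> (\<Sum>b\<in>B. c b * pint (q r * b)) = 0" and b: "b \<in> B" for c b
  proof -
    let ?p = "poly_comb B c"
    have "pint (q r * ?p) = 0" if "r \<in> S" for r
      using c[OF that] by (simp add: poly_comb_def sum_distrib_left pint_sum pint_smult)
    then have z: "pint (u * ?p) = 0" if "u \<in> U" for u using that by (simp add: U_def)
    have "pint (?p * ?p) = (\<Sum>b\<in>B. c b * pint (b * ?p))"
      by (simp add: poly_comb_def[of B c] sum_distrib_right pint_sum pint_smult)
    also have "\<dots> = 0" using z B by (intro sum.neutral) auto
    finally have "?p = 0" by (simp only: pint_square_eq_0_iff)
    then show ?thesis using pint_psum_basis[OF on b, of c] by simp
  qed
  with on ex show thesis by (intro that) blast+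
qed

lemma lin_comb_coordinates:
  assumes indep: "\<And>c. (\<And>x. x \<in> S \<Longrightarrow> (\<Sum>j\<in>J. c j * \<alpha> j x) = 0) \<Longrightarrow> (\<And>j. j \<in> J \<Longrightarrow> c j = 0)"
    and eq: "lin_comb S J \<alpha> c = lin_comb S J \<alpha> d" and j: "j \<in> J"
  shows "c j = d j"
proof -
  have "(\<Sum>j\<in>J. (c j - d j) * \<alpha> j x) = 0" if "x \<in> S" for x
    using fun_cong[OF eq, of x] that by (simp add: lin_comb_def left_diff_distrib sum_subtractf)
  then have "c j - d j = 0" using indep[of "\<lambda>j. c j - d j"] j by blast
  then show ?thesis by simp
qed

text \<open>A Gram kernel of polynomials. In an orthonormal basis it becomes a sum of products of
  independent coordinate functions, and declaring these orthonormal gives the required Hilbert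
  space.\<close>

lemma finite_rank_reproducing_kernel:
  assumes q: "\<And>r. r \<in> S \<Longrightarrow> degree (q r) \<le> D"
    and K: "\<And>x y. x \<in> S \<Longrightarrow> y \<in> S \<Longrightarrow> K x y = pint (q x * q y)"
  shows "is_reproducing_kernel S K"
proof -
  obtain B where B: "orthonormal_polys B" and ex': "\<forall>r\<in>S. q r = poly_comb B (\<lambda>b. pint (q r * b))"
    and indep': "\<forall>c. (\<forall>r\<in>S. (\<Sum>b\<in>B. c b * pint (q r * b)) = 0) \<longrightarrow> (\<forall>b\<in>B. c b = 0)"
    by (rule section_basis[of S q D]) (rule q)
  have ex: "\<And>r. r \<in> S \<Longrightarrow> q r = poly_comb B (\<lambda>b. pint (q r * b))" using ex' by blast
  have indep: "\<And>c. (\<And>r. r \<in> S \<Longrightarrow> (\<Sum>b\<in>B. c b * pint (q r * b)) = 0) \<Longrightarrow> (\<And>b. b \<in> B \<Longrightarrow> c b = 0)"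
    using indep' by blast
  define F where "F = lin_comb S B (\<lambda>b r. pint (q r * b))"
  \<comment> \<open>Independence makes the choice unique on B, which is where the inner product
    reads it.\<close>
  define cf where "cf f = (SOME c. f = F c)" for f
  have cf: "cf (F c) b = c b" if "b \<in> B" for c b
  proof -
    have "F c = F (cf (F c))" unfolding cf_def by (rule someI[of _ c]) simp
    from this[unfolded F_def] have "c b = cf (F c) b" unfolding F_def
      by (rule lin_comb_coordinates[where S = S and J = B and \<alpha> = "\<lambda>b r. pint (q r * b)", rotated]) (use that indep in blast)+
    then show ?thesis by simp
  qed
  have "rkhs_with_kernel S (range F) (\<lambda>f g. \<Sum>b\<in>B. cf f b * cf g b) K"
    unfolding F_def
  proof (rule rkhs_finite_dim)
    show "finite B" using B by (simp add: orthonormal_polys_def)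
    show "(\<Sum>b\<in>B. cf (lin_comb S B (\<lambda>b r. pint (q r * b)) c) b * cf (lin_comb S B (\<lambda>b r. pint (q r * b)) d) b) = (\<Sum>b\<in>B. c b * d b)" for c d
      unfolding F_def[symmetric] by (rule sum.cong) (simp_all add: cf)
    show "K x y = (\<Sum>b\<in>B. pint (q x * b) * pint (q y * b))" if "x \<in> S" "y \<in> S" for x y
      unfolding K[OF that] by (subst ex[OF that(1)], subst ex[OF that(2)]) (rule pint_psum_psum[OF B])
  qed (use indep in auto)
  then show ?thesis unfolding is_reproducing_kernel_def by blast
qed

text \<open>The operator sees \<phi> only through its inner products with the basis B, so its null
  space is the orthogonal complement of B. Up to null functions \<open>ker_perp k\<close> is
  therefore the span of B, and the images of B are orthonormal for
  \<open>range_inner k\<close>.\<close>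

lemma range_rkhs:
  assumes q: "\<And>r. r \<in> II \<Longrightarrow> degree (q r) \<le> D"
    and k: "\<And>r s. r \<in> II \<Longrightarrow> s \<in> II \<Longrightarrow> k r s = poly (q r) s"
    and K: "\<And>x y. x \<in> II \<Longrightarrow> y \<in> II \<Longrightarrow> K x y = pint (q x * q y)"
  shows "rkhs_with_kernel II (integral_op k ` L2) (range_inner k) K"
proof -
  obtain B where B: "orthonormal_polys B" and ex': "\<forall>r\<in>II. q r = poly_comb B (\<lambda>b. pint (q r * b))"
    and indep': "\<forall>c. (\<forall>r\<in>II. (\<Sum>b\<in>B. c b * pint (q r * b)) = 0) \<longrightarrow> (\<forall>b\<in>B. c b = 0)"
    by (rule section_basis[of II q D]) (rule q)
  have ex: "\<And>r. r \<in> II \<Longrightarrow> q r = poly_comb B (\<lambda>b. pint (q r * b))" using ex' by blast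
  have indep: "\<And>c. (\<And>r. r \<in> II \<Longrightarrow> (\<Sum>b\<in>B. c b * pint (q r * b)) = 0) \<Longrightarrow> (\<And>b. b \<in> B \<Longrightarrow> c b = 0)"
    using indep' by blast
  have fB: "finite B" using B by (simp add: orthonormal_polys_def)
  define F where "F = lin_comb II B (\<lambda>b r. pint (q r * b))"
  have T: "integral_op k \<phi> = F (\<lambda>b. L2_inner \<phi> (poly b))" if "\<phi> \<in> L2" for \<phi>
  proof -
    have "(\<integral>s. \<phi> s * k r s \<partial>lebesgue_on II) = (\<Sum>b\<in>B. L2_inner \<phi> (poly b) * pint (q r * b))" if r: "r \<in> II" for r
    proof -
      have "(\<integral>s. \<phi> s * k r s \<partial>lebesgue_on II) = L2_inner \<phi> (k r)" by (simp add: L2_inner_def)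
      also have "\<dots> = L2_inner \<phi> (poly (q r))" by (rule L2_inner_cong[OF refl k[OF r]])
      also have "\<dots> = L2_inner \<phi> (poly (poly_comb B (\<lambda>b. pint (q r * b))))" using ex[OF r] by simp
      also have "\<dots> = (\<Sum>b\<in>B. L2_inner \<phi> (poly b) * pint (q r * b))"
        using L2_inner_psum[OF fB \<open>\<phi> \<in> L2\<close>] by (simp add: mult.commute)
      finally show ?thesis .
    qed
    then show ?thesis by (simp add: integral_op_def F_def lin_comb_def restrict_def fun_eq_iff)
  qed
  have inner_psum: "L2_inner (poly (poly_comb B c)) (poly b) = c b" if "b \<in> B" for c b
    by (simp add: L2_inner_poly pint_psum_basis[OF B that])
  have F_cong: "F c = F d" if "\<And>b. b \<in> B \<Longrightarrow> c b = d b" for c d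
    unfolding F_def lin_comb_def using that by (intro restrict_ext sum.cong) auto
  have T_psum: "integral_op k (poly (poly_comb B c)) = F c" for c
    unfolding T[OF poly_L2] by (rule F_cong) (rule inner_psum)
  have coord: "c b = d b" if "F c = F d" "b \<in> B" for c d b
    by (rule lin_comb_coordinates[where S = II and J = B and \<alpha> = "\<lambda>b r. pint (q r * b)" and c = c and d = d, OF _ that(1)[unfolded F_def] that(2)]) (use indep in blast)
  have zero: "(\<lambda>r\<in>II. 0) = F (\<lambda>b. 0)" by (simp add: F_def lin_comb_def)
  have ker: "L2_inner \<psi> (poly b) = 0" if "\<psi> \<in> L2" "integral_op k \<psi> = (\<lambda>r\<in>II. 0)" "b \<in> B" for \<psi> b
    using coord[of "\<lambda>b. L2_inner \<psi> (poly b)" "\<lambda>b. 0" b] that unfolding zero T[OF that(1)] by simp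
  have perp: "poly (poly_comb B c) \<in> ker_perp k" for c
  proof -
    have "L2_inner (poly (poly_comb B c)) \<psi> = 0" if "\<psi> \<in> L2" "integral_op k \<psi> = (\<lambda>r\<in>II. 0)" for \<psi>
      using ker[OF that] by (subst L2_inner_commute) (simp add: L2_inner_psum[OF fB that(1)])
    then show ?thesis by (simp add: ker_perp_def poly_L2)
  qed
  have uniq: "L2_inner \<phi> \<psi> = (\<Sum>b\<in>B. c b * d b)"
    if \<phi>: "\<phi> \<in> ker_perp k" "integral_op k \<phi> = F c" and \<psi>: "\<psi> \<in> ker_perp k" "integral_op k \<psi> = F d" for \<phi> \<psi> c d
  proof -
    have L: "\<phi> \<in> L2" "\<psi> \<in> L2" using \<phi> \<psi> by (auto simp: ker_perp_def)
    have cb: "L2_inner \<phi> (poly b) = c b" if "b \<in> B" for b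
      using coord[of "\<lambda>b. L2_inner \<phi> (poly b)" c b] \<phi>(2) that unfolding T[OF L(1)] by simp
    have db: "L2_inner \<psi> (poly b) = d b" if "b \<in> B" for b
      using coord[of "\<lambda>b. L2_inner \<psi> (poly b)" d b] \<psi>(2) that unfolding T[OF L(2)] by simp
    \<comment> \<open>Elements of \<open>ker_perp k\<close> are fixed only almost everywhere, so
      \<psi> is compared with its expansion in B. The difference lies in the null space and is
      therefore orthogonal to \<phi>.\<close>
    define \<eta> where "\<eta> = (\<lambda>s. 1 * \<psi> s + (-1) * poly (poly_comb B d) s)"
    have \<eta>: "\<eta> \<in> L2" unfolding \<eta>_def by (rule L2_combine[OF L(2) poly_L2])
    have "L2_inner \<eta> (poly b) = 0" if "b \<in> B" for b
      unfolding \<eta>_def L2_inner_combine[OF L(2) poly_L2 poly_L2] using db[OF that] inner_psum[OF that] by simp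
    then have "integral_op k \<eta> = (\<lambda>r\<in>II. 0)" unfolding T[OF \<eta>] zero by (rule F_cong)
    then have 0: "L2_inner \<phi> \<eta> = 0" using \<phi>(1) \<eta> by (simp add: ker_perp_def)
    have "L2_inner \<eta> \<phi> = 1 * L2_inner \<psi> \<phi> + (-1) * L2_inner (poly (poly_comb B d)) \<phi>"
      unfolding \<eta>_def by (rule L2_inner_combine[OF L(2) poly_L2 L(1)])
    then have "L2_inner \<phi> \<psi> = L2_inner \<phi> (poly (poly_comb B d))"
      using 0 by (simp add: L2_inner_commute[of _ \<phi>])
    also have "\<dots> = (\<Sum>b\<in>B. d b * L2_inner \<phi> (poly b))" by (rule L2_inner_psum[OF fB L(1)])
    also have "\<dots> = (\<Sum>b\<in>B. c b * d b)" by (rule sum.cong) (auto simp: cb)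
    finally show ?thesis .
  qed
  have ri: "range_inner k (F c) (F d) = (\<Sum>b\<in>B. c b * d b)" for c d
    unfolding range_inner_def
  proof (rule the_equality)
    show "\<exists>\<phi>\<in>ker_perp k. \<exists>\<psi>\<in>ker_perp k. integral_op k \<phi> = F c \<and> integral_op k \<psi> = F d \<and> (\<Sum>b\<in>B. c b * d b) = L2_inner \<phi> \<psi>"
      by (intro bexI[of _ "poly (poly_comb B c)"] bexI[of _ "poly (poly_comb B d)"] conjI T_psum perp)
        (simp add: L2_inner_poly pint_psum_psum[OF B])
  qed (use uniq in auto)
  have range: "integral_op k ` L2 = range F"
  proof
    show "integral_op k ` L2 \<subseteq> range F" using T by auto
    show "range F \<subseteq> integral_op k ` L2"
    proof
      fix f assume "f \<in> range F"
      then obtain c where "f = F c" by blast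
      then show "f \<in> integral_op k ` L2" by (metis T_psum poly_L2 imageI)
    qed
  qed
  show ?thesis
  proof (rule rkhs_finite_dim[OF fB])
    show "integral_op k ` L2 = range (lin_comb II B (\<lambda>b r. pint (q r * b)))" using range by (simp add: F_def)
    show "range_inner k (lin_comb II B (\<lambda>b r. pint (q r * b)) c) (lin_comb II B (\<lambda>b r. pint (q r * b)) d) = (\<Sum>b\<in>B. c b * d b)" for c d
      using ri by (simp add: F_def)
    show "K x y = (\<Sum>b\<in>B. pint (q x * b) * pint (q y * b))" if "x \<in> II" "y \<in> II" for x y
      unfolding K[OF that] by (subst ex[OF that(1)], subst ex[OF that(2)]) (rule pint_psum_psum[OF B])
  qed (use indep in auto)
qed

text \<open>Two representers of evaluation at x differ by some g with \<open>ip g g\<close> = g x -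
  g x = 0, so the description in \<open>reproducing_kernel\<close> is unique.\<close>

lemma reproducing_kernel_eq:
  assumes R: "rkhs_with_kernel S H ip K" and x: "x \<in> S"
  shows "reproducing_kernel H ip x = (\<lambda>y\<in>S. K x y)"
proof -
  interpret rkhs S H ip using R by (simp add: rkhs_with_kernel_def)
  let ?k = "\<lambda>y\<in>S. K x y"
  have k: "?k \<in> H" "\<And>f. f \<in> H \<Longrightarrow> ip f ?k = f x" using R x by (auto simp: rkhs_with_kernel_def)
  have "(THE k. k \<in> H \<and> (\<forall>f\<in>H. ip f k = f x)) = ?k"
  proof (rule the_equality)
    fix k' assume k': "k' \<in> H \<and> (\<forall>f\<in>H. ip f k' = f x)"
    define g where "g = (\<lambda>y\<in>S. 1 * k' y + (-1) * ?k y)"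
    have gH: "g \<in> H" unfolding g_def by (intro lincomb_mem k(1)) (use k' in blast)
    have "ip g g = 1 * ip k' g + (-1) * ip ?k g"
      using ip_linear[of k' ?k g 1 "-1"] k' k gH by (simp add: g_def)
    also have "\<dots> = g x - g x" using k' k gH ip_commute by simp
    finally have "\<not> ip g g > 0" by simp
    then have g0: "g = (\<lambda>x\<in>S. 0)" using ip_pos[OF gH] by blast
    show "k' = ?k"
    proof
      fix y show "k' y = ?k y"
      proof (cases "y \<in> S")
        case True
        then show ?thesis using fun_cong[OF g0, of y] by (simp add: g_def)
      next
        case False
        then show ?thesis using k' carrier_extensional by (auto simp: extensional_def)
      qed
    qed
  qed (use k in auto)
  then show ?thesis by (simp add: reproducing_kernel_def fun_eq_iff)
qed

section \<open>The reproducing kernel of \<open>Pi0\<close> in an orthonormal basis\<close>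

definition Pi0_poly :: "nat \<Rightarrow> real poly \<Rightarrow> bool" where
  "Pi0_poly n p \<longleftrightarrow> degree p \<le> n \<and> poly p 0 = 0 \<and> poly p 1 = 0"

lemma Pi0_eq: "Pi0 n = {restrict (poly p) II | p. Pi0_poly n p}"
  by (simp add: Pi0_def Pi0_poly_def)

lemma Pi0_kernel:
  obtains \<kappa> :: "real \<Rightarrow> real poly" where
    "\<And>x. Pi0_poly n (\<kappa> x)" "\<And>x p. Pi0_poly n p \<Longrightarrow> pint (p * \<kappa> x) = poly p x"
    "rkhs_with_kernel II (Pi0 n) L2_inner (\<lambda>x y. poly (\<kappa> x) y)"
proof -
  define U where "U = {p. Pi0_poly n p}"
  have "\<exists>B. finite B \<and> B \<subseteq> U \<and> (\<forall>b\<in>B. \<forall>b'\<in>B. pint (b * b') = (if b = b' then 1 else 0))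
    \<and> (\<forall>u\<in>U. u = (\<Sum>b\<in>B. smult (pint (u * b)) b))"
  proof (rule orthonormal_poly_basis[where D = "Suc n"])
    show "0 \<in> U" by (simp add: U_def Pi0_poly_def)
    show "smult a p + smult b s \<in> U" if "p \<in> U" "s \<in> U" for p s a b
      using that by (auto simp: U_def Pi0_poly_def intro!: degree_add_le order.trans[OF degree_smult_le])
    show "p = 0 \<or> degree p < Suc n" if "p \<in> U" for p using that by (simp add: U_def Pi0_poly_def)
  qed
  then obtain B where B: "finite B \<and> B \<subseteq> U \<and> (\<forall>b\<in>B. \<forall>b'\<in>B. pint (b * b') = (if b = b' then 1 else 0))
    \<and> (\<forall>u\<in>U. u = (\<Sum>b\<in>B. smult (pint (u * b)) b))" ..
  have on: "orthonormal_polys B" and fB: "finite B" using B by (simp_all add: orthonormal_polys_def)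
  have ex: "u = poly_comb B (\<lambda>b. pint (u * b))" if "Pi0_poly n u" for u
    unfolding poly_comb_def using B that unfolding U_def by (elim conjE) (drule bspec, rule CollectI)
  have mem: "Pi0_poly n (poly_comb B c)" for c
  proof -
    have b: "Pi0_poly n b" if "b \<in> B" for b using that B by (auto simp: U_def)
    have "degree (poly_comb B c) \<le> n" unfolding poly_comb_def
      using b by (intro degree_sum_le fB order.trans[OF degree_smult_le]) (simp add: Pi0_poly_def)
    moreover have "poly (poly_comb B c) 0 = 0" "poly (poly_comb B c) 1 = 0"
      unfolding poly_psum using b by (auto simp: Pi0_poly_def intro!: sum.neutral)
    ultimately show ?thesis by (simp add: Pi0_poly_def)
  qed
  define \<kappa> where "\<kappa> x = poly_comb B (\<lambda>b. poly b x)" for x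
  have rep: "pint (p * \<kappa> x) = poly p x" if p: "Pi0_poly n p" for p x
  proof -
    have "pint (p * \<kappa> x) = pint (poly_comb B (\<lambda>b. pint (p * b)) * poly_comb B (\<lambda>b. poly b x))"
      unfolding \<kappa>_def using ex[OF p] by simp
    also have "\<dots> = poly (poly_comb B (\<lambda>b. pint (p * b))) x" by (simp add: pint_psum_psum[OF on] poly_psum)
    finally show ?thesis using ex[OF p] by simp
  qed
  have lin_comb: "lin_comb II B poly c = restrict (poly (poly_comb B c)) II" for c
    by (simp add: lin_comb_def poly_psum restrict_def fun_eq_iff)
  have "rkhs_with_kernel II (Pi0 n) L2_inner (\<lambda>x y. poly (\<kappa> x) y)"
  proof (rule rkhs_finite_dim[OF fB])
    show "Pi0 n = range (lin_comb II B poly)"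
      unfolding Pi0_eq lin_comb using ex mem by (auto simp: image_iff) metis
    show "L2_inner (lin_comb II B poly c) (lin_comb II B poly d) = (\<Sum>b\<in>B. c b * d b)" for c d
    proof -
      have "L2_inner (lin_comb II B poly c) (lin_comb II B poly d) = L2_inner (poly (poly_comb B c)) (poly (poly_comb B d))"
        unfolding lin_comb by (rule L2_inner_cong) auto
      then show ?thesis by (simp add: L2_inner_poly pint_psum_psum[OF on])
    qed
    show "poly (\<kappa> x) y = (\<Sum>b\<in>B. poly b x * poly b y)" for x y by (simp add: \<kappa>_def poly_psum)
    show "c b = 0" if "\<And>x. x \<in> II \<Longrightarrow> (\<Sum>b\<in>B. c b * poly b x) = 0" "b \<in> B" for c b
    proof -
      have "II \<subseteq> {x. poly (poly_comb B c) x = 0}" using that(1) by (auto simp: poly_psum)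
      moreover have "infinite II" by (simp add: infinite_Icc)
      ultimately have "poly_comb B c = 0" using poly_roots_finite finite_subset by blast
      then show ?thesis using pint_psum_basis[OF on that(2), of c] by simp
    qed
  qed
  then show thesis using mem rep by (intro that) (auto simp: \<kappa>_def)
qed

lemma Pi0_poly_eqI:
  assumes "Pi0_poly n p" "Pi0_poly n q" "\<And>h. Pi0_poly n h \<Longrightarrow> pint (h * p) = pint (h * q)"
  shows "p = q"
proof -
  have "Pi0_poly n (p - q)" using assms(1,2) by (auto simp: Pi0_poly_def intro: degree_diff_le)
  then have "pint ((p - q) * p) = pint ((p - q) * q)" by (rule assms(3))
  then have "pint ((p - q) * (p - q)) = 0" by (simp add: right_diff_distrib pint_diff)
  then show ?thesis by (simp only: pint_square_eq_0_iff right_minus_eq)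
qed

section \<open>The Christoffel-Darboux formula\<close>

definition r_poly :: "real poly" where "r_poly = [:0, 1, -1:]"

lemma poly_rr [simp]: "poly r_poly x = x - x * x" and degree_rr [simp]: "degree r_poly = 2" and r_poly_nonzero [simp]: "r_poly \<noteq> 0"
  by (simp_all add: r_poly_def algebra_simps)

definition legendre2 :: "nat \<Rightarrow> real poly" where
  "legendre2 n = pderiv (pderiv (shifted_legendre n))"

text \<open>Two integrations by parts move both derivatives onto the weighted g; the double zeros of
  the weight at 0 and 1 remove the boundary terms. So the P_n'' are orthogonal for the weight (r -
  r^2)^2, and the degree n - 2 yields their norm constants.\<close>

lemma pint_legendre2:
  assumes "degree g + 2 \<le> n"
  shows "pint (r_poly * r_poly * (legendre2 n * g))
    = coeff g (n - 2) * (real (n + 2) * real (n + 1) * (fact n * fact n / fact (2 * n + 1)))"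
proof -
  let ?P = "shifted_legendre n"
  let ?w = "r_poly * r_poly * g"
  have d1: "poly (pderiv ?w) 0 = 0" "poly (pderiv ?w) 1 = 0"
    by (simp_all add: pderiv_mult pderiv_pCons)
  obtain k where k: "n = Suc (Suc k)" using assms by (metis add_2_eq_Suc' le_Suc_ex add_Suc_right add.commute)
  have dk: "degree g \<le> k" using assms k by simp
  have "degree ?w \<le> degree (r_poly * r_poly) + degree g" by (rule degree_mult_le)
  also have "degree (r_poly * r_poly) = 4" by (simp add: degree_mult_eq)
  finally have dw: "degree ?w \<le> n + 2" using assms by simp
  have "pint (r_poly * r_poly * (legendre2 n * g)) = pint (pderiv (pderiv ?P) * ?w)"
    by (simp only: legendre2_def mult_ac)
  also have "\<dots> = - pint (pderiv ?P * pderiv ?w)" by (subst pint_parts) simp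
  also have "\<dots> = pint (?P * pderiv (pderiv ?w))" using d1 by (subst pint_parts) simp
  also have "\<dots> = coeff (pderiv (pderiv ?w)) n * (fact n * fact n / fact (2 * n + 1))"
    by (rule pint_shifted_legendre) (use dw in \<open>simp add: degree_pderiv\<close>)
  also have "coeff (pderiv (pderiv ?w)) n = real (n + 1) * (real (n + 2) * coeff ?w (n + 2))"
    by (simp add: coeff_pderiv algebra_simps)
  also have "coeff ?w (n + 2) = coeff g k"
  proof -
    have "?w = pCons 0 (pCons 0 (g - smult 2 (pCons 0 g) + pCons 0 (pCons 0 g)))"
      by (rule poly_ext) (simp add: algebra_simps)
    then show ?thesis using k dk by (simp add: coeff_eq_0)
  qed
  finally show ?thesis using k by (simp add: mult_ac)
qed

lemma coeff_synthetic_div: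
  assumes "degree (p::real poly) \<le> Suc k" shows "coeff (synthetic_div p c) k = coeff p (Suc k)"
proof -
  have "coeff p (Suc k) = coeff ([:- c, 1:] * synthetic_div p c + [:poly p c:]) (Suc k)"
    by (simp only: synthetic_div_correct')
  also have "\<dots> = coeff (synthetic_div p c) k - c * coeff (synthetic_div p c) (Suc k)"
    by simp
  also have "coeff (synthetic_div p c) (Suc k) = 0"
    using assms by (intro coeff_eq_0) (simp add: degree_synthetic_div)
  finally show ?thesis by simp
qed

text \<open>Polynomial dependence on x is what later permits cancelling a factor that has
  zeros.\<close>

lemma pint_synthetic_div_poly: "\<exists>g. \<forall>x. pint (v * synthetic_div p x) = poly g x"
proof (induction p arbitrary: v)
  case 0
  show ?case by (rule exI[of _ 0]) simp
next
  case (pCons c p)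
  obtain g where g: "\<And>x. pint ((v * [:0, 1:]) * synthetic_div p x) = poly g x" using pCons.IH by blast
  have "pint (v * synthetic_div (pCons c p) x) = poly (smult (pint v) p + g) x" for x
  proof -
    have "v * synthetic_div (pCons c p) x = smult (poly p x) v + (v * [:0, 1:]) * synthetic_div p x"
      by (simp add: algebra_simps)
    then show ?thesis by (simp only: pint_add pint_smult g) simp
  qed
  then show ?case by blast
qed

lemma continuous_synthetic_div: "continuous_on UNIV (\<lambda>(x, y). poly (synthetic_div p x) (y::real))"
proof (induction p)
  case (pCons c p)
  then show ?case by (auto simp: case_prod_beta intro!: continuous_intros)
qed simp

text \<open>The Christoffel-Darboux quotient as a polynomial in y. Since
  \<open>synthetic_div p x\<close> is (p(y) - p(x)) / (y - x), the values p(x) cancel in the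
  combination, and the diagonal y = x is included.\<close>

definition cd_poly :: "nat \<Rightarrow> real \<Rightarrow> real poly" where
  "cd_poly m x = smult (poly (legendre2 (2*m-1)) x) (synthetic_div (legendre2 (2*m)) x)
     - smult (poly (legendre2 (2*m)) x) (synthetic_div (legendre2 (2*m-1)) x)"

lemma degree_legendre2: "degree (legendre2 n) \<le> n - 2"
  unfolding legendre2_def degree_pderiv using degree_shifted_legendre_le[of n] by simp

lemma coeff_legendre2: "coeff (legendre2 (Suc (Suc k))) k = real (Suc (Suc k)) * real (Suc k) * real ((2 * Suc (Suc k)) choose Suc (Suc k))"
  unfolding legendre2_def coeff_pderiv by (simp only: coeff_shifted_legendre mult_ac)

lemma cd_poly_linear:
  "[:- x, 1:] * cd_poly m x = smult (poly (legendre2 (2*m-1)) x) (legendre2 (2*m)) - smult (poly (legendre2 (2*m)) x) (legendre2 (2*m-1))"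
proof -
  have s: "[:- x, 1:] * synthetic_div p x = p - [:poly p x:]" for p :: "real poly"
    by (metis add_diff_cancel_right' synthetic_div_correct')
  have "[:- x, 1:] * cd_poly m x = smult (poly (legendre2 (2*m-1)) x) ([:- x, 1:] * synthetic_div (legendre2 (2*m)) x)
     - smult (poly (legendre2 (2*m)) x) ([:- x, 1:] * synthetic_div (legendre2 (2*m-1)) x)"
    by (simp only: cd_poly_def right_diff_distrib mult_smult_right)
  also have "\<dots> = smult (poly (legendre2 (2*m-1)) x) (legendre2 (2*m)) - smult (poly (legendre2 (2*m)) x) (legendre2 (2*m-1))"
    unfolding s by (rule poly_ext) (simp add: algebra_simps)
  finally show ?thesis .
qed

definition cd_const :: "nat \<Rightarrow> real" where
  "cd_const m = 2 * (2 * real m - 1) * (2 * real m) * (2 * real m + 1)"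

text \<open>Write \<psi> = (y - x) s + \<psi>(x). The factor y - x clears the quotient and
  orthogonality kills s, so the integral is \<psi>(x) times a factor \<open>I x\<close>. Testing
  with P''_(2m-1) and reading off a leading coefficient determines \<open>I x\<close> up to the
  factor P''_(2m-1)(x).\<close>

lemma cd_poly_reproducing:
  assumes m: "m \<ge> 2" and \<psi>: "degree \<psi> \<le> 2 * m - 3"
  shows "pint (r_poly * r_poly * (cd_poly m x * \<psi>)) = cd_const m * poly \<psi> x"
proof -
  let ?a = "legendre2 (2*m)" and ?b = "legendre2 (2*m-1)"
  obtain k where k: "m = Suc (Suc k)" using m by (metis add_2_eq_Suc le_Suc_ex)
  define I where "I x = pint (r_poly * r_poly * cd_poly m x)" for x
  have ortho: "pint (r_poly * r_poly * (legendre2 n * \<rho>)) = 0" if "degree \<rho> + 2 < n" for n \<rho>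
    using that by (subst pint_legendre2) (auto simp: coeff_eq_0)
  have red: "pint (r_poly * r_poly * (cd_poly m x * \<rho>)) = I x * poly \<rho> x" if d: "degree \<rho> \<le> 2 * m - 3" for \<rho> x
  proof -
    define s where "s = synthetic_div \<rho> x"
    have ds: "degree s \<le> 2 * m - 4" using d by (simp add: s_def degree_synthetic_div)
    have "r_poly * r_poly * (cd_poly m x * \<rho>) = r_poly * r_poly * (cd_poly m x * ([:- x, 1:] * s + [:poly \<rho> x:]))"
      by (simp only: s_def synthetic_div_correct')
    also have "\<dots> = r_poly * r_poly * (([:- x, 1:] * cd_poly m x) * s) + smult (poly \<rho> x) (r_poly * r_poly * cd_poly m x)"
      by (rule poly_ext) (simp add: algebra_simps)
    also have "\<dots> = smult (poly ?b x) (r_poly * r_poly * (?a * s)) - smult (poly ?a x) (r_poly * r_poly * (?b * s))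
       + smult (poly \<rho> x) (r_poly * r_poly * cd_poly m x)"
      unfolding cd_poly_linear by (rule poly_ext) (simp add: algebra_simps)
    finally have "pint (r_poly * r_poly * (cd_poly m x * \<rho>)) = poly ?b x * pint (r_poly * r_poly * (?a * s)) - poly ?a x * pint (r_poly * r_poly * (?b * s))
       + poly \<rho> x * I x" by (simp only: pint_add pint_diff pint_smult I_def)
    moreover have "pint (r_poly * r_poly * (?a * s)) = 0" "pint (r_poly * r_poly * (?b * s)) = 0"
      using ds k by (auto intro!: ortho)
    ultimately show ?thesis by (simp add: mult.commute)
  qed
  have d: "degree (cd_poly m x) \<le> 2 * m - 3" for x
    unfolding cd_poly_def using degree_legendre2[of "2*m"] degree_legendre2[of "2*m-1"] k
    by (intro degree_diff_le order.trans[OF degree_smult_le]) (auto simp: degree_synthetic_div)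
  have bI: "poly ?b x * I x = poly ?b x * cd_const m" for x
  proof -
    define n where "n = 2 * m - 1"
    have nk: "n = Suc (Suc (2 * k + 1))" "2 * m - 3 = 2 * k + 1" "2 * m = Suc (Suc (2 * k + 2))" using k by (auto simp: n_def)
    have "I x * poly ?b x = pint (r_poly * r_poly * (cd_poly m x * ?b))"
      using degree_legendre2[of "2*m-1"] by (intro red[symmetric]) simp
    also have "\<dots> = pint (r_poly * r_poly * (legendre2 n * cd_poly m x))" by (simp only: n_def mult_ac)
    also have "\<dots> = coeff (cd_poly m x) (2 * k + 1) * (real (n + 2) * real (n + 1) * (fact n * fact n / fact (2 * n + 1)))"
      using d[of x] by (subst pint_legendre2) (simp_all add: nk)
    \<comment> \<open>Here 2 k + 1 = 2 m - 3. Only the quotient of P''_(2m) reaches this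
      degree.\<close>
    also have "coeff (cd_poly m x) (2 * k + 1) = poly ?b x * coeff ?a (2 * k + 2)"
    proof -
      have "coeff (synthetic_div ?a x) (2 * k + 1) = coeff ?a (2 * k + 2)"
        using coeff_synthetic_div[of ?a "2 * k + 1" x] degree_legendre2[of "2*m"] nk by simp
      moreover have "coeff (synthetic_div ?b x) (2 * k + 1) = 0"
        using degree_legendre2[of "2*m-1"] nk by (intro coeff_eq_0) (simp add: degree_synthetic_div)
      ultimately show ?thesis by (simp add: cd_poly_def)
    qed
    also have "coeff ?a (2 * k + 2) = real (n + 1) * real n * real ((2 * (n + 1)) choose (n + 1))"
      using coeff_legendre2[of "2 * k + 2"] unfolding nk(3) by (simp add: nk(1))
    also have "poly ?b x * (real (n + 1) * real n * real ((2 * (n + 1)) choose (n + 1))) *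
        (real (n + 2) * real (n + 1) * (fact n * fact n / fact (2 * n + 1)))
      = poly ?b x * (real n * real (n + 1) * real (n + 2) * (real (Suc n) * beta_int n * real ((2 * Suc n) choose Suc n)))"
      unfolding beta_int_def by (simp only: Suc_eq_plus1 mult_ac)
    also have "\<dots> = poly ?b x * (real n * real (n + 1) * real (n + 2) * 2)" by (simp only: beta_int_choose)
    also have "real n * real (n + 1) * real (n + 2) * 2 = cd_const m"
      unfolding cd_const_def n_def using m by (simp add: of_nat_diff algebra_simps)
    finally show ?thesis by (simp add: mult.commute)
  qed
  \<comment> \<open>As I is a polynomial in x, the nonzero polynomial \<open>?b\<close> can be
    cancelled, which settles its zeros too.\<close>
  obtain ga gb where g: "\<And>x. pint (r_poly * r_poly * synthetic_div ?a x) = poly ga x" "\<And>x. pint (r_poly * r_poly * synthetic_div ?b x) = poly gb x"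
    using pint_synthetic_div_poly by metis
  define G where "G = ?b * ga - ?a * gb"
  have G: "I x = poly G x" for x
    unfolding I_def cd_poly_def right_diff_distrib mult_smult_right pint_diff pint_smult g G_def by simp
  have "?b * (G - [:cd_const m:]) = 0"
    by (rule poly_ext) (use bI G in \<open>simp add: right_diff_distrib\<close>)
  moreover have "?b \<noteq> 0"
  proof -
    have e: "2 * m - 1 = Suc (Suc (2 * k + 1))" using k by simp
    have "coeff ?b (2 * k + 1) \<noteq> 0" unfolding e coeff_legendre2 by (simp add: binomial_eq_0_iff del: binomial_Suc_Suc)
    then show ?thesis by auto
  qed
  ultimately have "G = [:cd_const m:]" by simp
  then have "I x = cd_const m" using G by simp
  then show ?thesis using red[OF \<psi>, of x] by simp
qed

text \<open>Elements of \<open>Pi0\<close> are h = (r - r^2) \<psi> with \<psi> of degree at most 2m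
  - 3. Pairing two of them produces the weight (r - r^2)^2, and the prefactor x - x^2 turns the
  reproduced \<psi>(x) back into h(x).\<close>

lemma Pi0_kernel_cd:
  assumes m: "m \<ge> 2" and \<kappa>: "\<And>x. Pi0_poly (2*m-1) (\<kappa> x)" "\<And>x p. Pi0_poly (2*m-1) p \<Longrightarrow> pint (p * \<kappa> x) = poly p x"
  shows "\<kappa> x = smult ((x - x\<^sup>2) / cd_const m) (r_poly * cd_poly m x)"
proof (rule Pi0_poly_eqI[OF \<kappa>(1)])
  obtain k where k: "m = Suc (Suc k)" using m by (metis add_2_eq_Suc le_Suc_ex)
  have d: "degree (cd_poly m x) \<le> 2 * m - 3"
    unfolding cd_poly_def using degree_legendre2[of "2*m"] degree_legendre2[of "2*m-1"] k
    by (intro degree_diff_le order.trans[OF degree_smult_le]) (auto simp: degree_synthetic_div)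
  have "degree (r_poly * cd_poly m x) \<le> 2 + degree (cd_poly m x)"
    by (rule order.trans[OF degree_mult_le]) simp
  then have "degree (r_poly * cd_poly m x) \<le> 2 * m - 1" using d k by simp
  then show "Pi0_poly (2*m-1) (smult ((x - x\<^sup>2) / cd_const m) (r_poly * cd_poly m x))"
    unfolding Pi0_poly_def by (auto intro: order.trans[OF degree_smult_le])
  fix h assume h: "Pi0_poly (2*m-1) h"
  then have "[:0, -1, 1:] dvd h" by (simp add: Pi0_poly_def dvd_r_iff)
  then obtain s where "h = [:0, -1, 1:] * s" by (rule dvdE)
  then have hs: "h = r_poly * (- s)" by (intro poly_ext) (simp add: algebra_simps)
  define \<psi> where "\<psi> = - s"
  have h\<psi>: "h = r_poly * \<psi>" using hs by (simp only: \<psi>_def)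
  have d\<psi>: "degree \<psi> \<le> 2 * m - 3"
  proof (cases "\<psi> = 0")
    case False
    then have "degree h = 2 + degree \<psi>" unfolding h\<psi> by (subst degree_mult_eq) auto
    then show ?thesis using h k by (simp add: Pi0_poly_def)
  qed simp
  have C: "cd_const m \<noteq> 0" unfolding cd_const_def using m by auto
  have "pint (h * smult ((x - x\<^sup>2) / cd_const m) (r_poly * cd_poly m x)) = (x - x\<^sup>2) / cd_const m * pint (r_poly * r_poly * (cd_poly m x * \<psi>))"
    unfolding h\<psi> by (simp only: mult_smult_right pint_smult mult_ac)
  also have "\<dots> = (x - x\<^sup>2) * poly \<psi> x" using C by (simp add: cd_poly_reproducing[OF m d\<psi>])
  also have "\<dots> = poly h x" unfolding h\<psi> by (simp add: power2_eq_square algebra_simps)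
  finally show "pint (h * \<kappa> x) = pint (h * smult ((x - x\<^sup>2) / cd_const m) (r_poly * cd_poly m x))"
    using \<kappa>(2)[OF h] by simp
qed

lemma rkhs_with_kernel_cong:
  assumes "rkhs_with_kernel S H ip K" "\<And>x y. x \<in> S \<Longrightarrow> y \<in> S \<Longrightarrow> K x y = K' x y"
  shows "rkhs_with_kernel S H ip K'"
proof -
  have "(\<lambda>y\<in>S. K x y) = (\<lambda>y\<in>S. K' x y)" if "x \<in> S" for x using assms(2)[OF that] by (auto simp: restrict_def)
  then show ?thesis using assms(1) by (auto simp: rkhs_with_kernel_def)
qed

text \<open>Reading the quotient by continuity is encoded by a continuous Q that agrees with it off
  the diagonal; these points are dense in the square, so Q is determined.\<close>

theorem theorem7p3:
  fixes m :: nat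
  assumes "m \<ge> 2"
  shows "rkhs_with_kernel II (Pi0 (2*m-1)) L2_inner (K_Pi0 (2*m-1))
    \<and> (\<forall>r1\<in>II. \<forall>r2\<in>II. K_Pi0 (2*m-1) r1 r2 =
         (\<integral>s. L2_proj (Pi0 (2*m-1)) (\<lambda>s. Hhat m r1 s) s * L2_proj (Pi0 (2*m-1)) (\<lambda>s. Hhat m r2 s) s
            \<partial>lebesgue_on II))
    \<and> (\<exists>Q :: real \<times> real \<Rightarrow> real.
         (\<forall>r1\<in>II. \<forall>r2\<in>II. r1 \<noteq> r2 \<longrightarrow> Q (r1, r2) =
            (legendre_dd (2*m) r1 * legendre_dd (2*m-1) r2
               - legendre_dd (2*m-1) r1 * legendre_dd (2*m) r2) / (r1 - r2))
         \<and> continuous_on (II \<times> II) Q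
         \<and> (\<forall>r1\<in>II. \<forall>r2\<in>II. K_Pi0 (2*m-1) r1 r2 =
              (r1 - r1\<^sup>2) * (r2 - r2\<^sup>2) / (2 * (2 * real m - 1) * (2 * real m) * (2 * real m + 1))
                * Q (r1, r2)))
    \<and> integral_op (Hhat m) ` L2 = Pi0 (2*m-1)
    \<and> rkhs_with_kernel II (Pi0 (2*m-1)) (range_inner (Hhat m)) (K_Hhat m)
    \<and> is_reproducing_kernel II (\<lambda>r1 r2. K_Hhat m r1 r2 - K_Pi0 (2*m-1) r1 r2)"
proof -
  let ?n = "2 * m - 1"
  obtain \<kappa> where \<kappa>: "\<And>x. Pi0_poly ?n (\<kappa> x)" "\<And>x p. Pi0_poly ?n p \<Longrightarrow> pint (p * \<kappa> x) = poly p x"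
    and rkhs: "rkhs_with_kernel II (Pi0 ?n) L2_inner (\<lambda>x y. poly (\<kappa> x) y)"
    using Pi0_kernel[of ?n] by metis
  obtain qH D where H: "\<And>r s. Hhat m r s = poly (qH r) s" and degH: "\<And>r. degree (qH r) \<le> D"
    and repH: "\<And>\<phi> r. poly \<phi> 0 = 0 \<Longrightarrow> poly \<phi> 1 = 0 \<Longrightarrow> degree \<phi> \<le> ?n \<Longrightarrow> pint (\<phi> * qH r) = poly \<phi> r"
    and linH: "\<And>r. qH r = (\<Sum>z\<in>grid ?n. smult (poly (lagr_poly (grid ?n) z) r) (qH z))"
    and H01: "qH 0 = 0" "qH 1 = 0"
    by (rule Hhat_polynomial[OF assms]) blast
  have rep: "pint (p * qH r) = poly p r" if "Pi0_poly ?n p" for p r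
    using that repH by (simp add: Pi0_poly_def)
  have K: "K_Pi0 ?n x y = poly (\<kappa> x) y" if "x \<in> II" "y \<in> II" for x y
    using reproducing_kernel_eq[OF rkhs that(1)] that(2) by (simp add: K_Pi0_def)
  have KK: "poly (\<kappa> x) y = pint (\<kappa> x * \<kappa> y)" for x y using \<kappa>(2)[OF \<kappa>(1)] by simp
  have KH: "K_Hhat m x y = pint (qH x * qH y)" for x y
  proof -
    have "K_Hhat m x y = L2_inner (poly (qH x)) (poly (qH y))" by (simp add: K_Hhat_def H L2_inner_def)
    then show ?thesis by (simp add: L2_inner_poly)
  qed
  have part1: "rkhs_with_kernel II (Pi0 ?n) L2_inner (K_Pi0 ?n)"
    using rkhs by (rule rkhs_with_kernel_cong) (rule K[symmetric])

  \<comment> \<open>Both \<open>qH r\<close> and \<open>\<kappa> r\<close> reproduce evaluation at r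
    on \<open>Pi0\<close>, so their difference is orthogonal to it.\<close>
  have proj: "L2_proj (Pi0 ?n) (\<lambda>s. Hhat m r s) = restrict (poly (\<kappa> r)) II" for r
    unfolding L2_proj_def
  proof (rule the_equality)
    have inner: "L2_inner (\<lambda>s. Hhat m r s - restrict (poly p) II s) (restrict (poly h) II) = poly h r - pint (h * p)"
      if "Pi0_poly ?n h" for p h
    proof -
      have "L2_inner (\<lambda>s. Hhat m r s - restrict (poly p) II s) (restrict (poly h) II) = L2_inner (poly (qH r - p)) (poly h)"
        by (rule L2_inner_cong) (auto simp: H)
      also have "\<dots> = pint (h * qH r) - pint (h * p)"
        by (simp add: L2_inner_poly left_diff_distrib pint_diff mult.commute[of h])
      finally show ?thesis by (simp add: rep[OF that])
    qed
    show "restrict (poly (\<kappa> r)) II \<in> Pi0 ?n \<and>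
        (\<forall>h\<in>Pi0 ?n. L2_inner (\<lambda>s. Hhat m r s - restrict (poly (\<kappa> r)) II s) h = 0)"
      unfolding Pi0_eq using \<kappa> inner by auto
    fix g assume g: "g \<in> Pi0 ?n \<and> (\<forall>h\<in>Pi0 ?n. L2_inner (\<lambda>s. Hhat m r s - g s) h = 0)"
    then obtain p where p: "g = restrict (poly p) II" "Pi0_poly ?n p" unfolding Pi0_eq by auto
    have "p = \<kappa> r"
    proof (rule Pi0_poly_eqI[OF p(2) \<kappa>(1)])
      fix h assume h: "Pi0_poly ?n h"
      then have "restrict (poly h) II \<in> Pi0 ?n" unfolding Pi0_eq by blast
      then have "poly h r - pint (h * p) = 0" using g inner[OF h, of p] p(1) by auto
      then show "pint (h * p) = pint (h * \<kappa> r)" using \<kappa>(2)[OF h] by simp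
    qed
    then show "g = restrict (poly (\<kappa> r)) II" using p by simp
  qed
  have part2: "K_Pi0 ?n r1 r2 = (\<integral>s. L2_proj (Pi0 ?n) (\<lambda>s. Hhat m r1 s) s * L2_proj (Pi0 ?n) (\<lambda>s. Hhat m r2 s) s \<partial>lebesgue_on II)"
    if "r1 \<in> II" "r2 \<in> II" for r1 r2
  proof -
    have "(\<integral>s. L2_proj (Pi0 ?n) (\<lambda>s. Hhat m r1 s) s * L2_proj (Pi0 ?n) (\<lambda>s. Hhat m r2 s) s \<partial>lebesgue_on II)
      = L2_inner (restrict (poly (\<kappa> r1)) II) (restrict (poly (\<kappa> r2)) II)" by (simp only: proj L2_inner_def)
    also have "\<dots> = L2_inner (poly (\<kappa> r1)) (poly (\<kappa> r2))" by (rule L2_inner_cong) auto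
    finally show ?thesis by (simp only: L2_inner_poly KK K[OF that])
  qed

  \<comment> \<open>Numerator and denominator both have the opposite sign to those in the
    statement.\<close>
  define Q where "Q = (\<lambda>(x, y). poly (cd_poly m x) y)"
  have dd: "legendre_dd k x = poly (legendre2 k) x" for k x by (simp add: legendre_dd_def legendre2_def)
  have Q1: "Q (x, y) = (legendre_dd (2*m) x * legendre_dd ?n y - legendre_dd ?n x * legendre_dd (2*m) y) / (x - y)"
    if "x \<noteq> y" for x y
  proof -
    have "poly ([:- x, 1:] * cd_poly m x) y = (y - x) * Q (x, y)" by (simp add: Q_def algebra_simps)
    then have "(y - x) * Q (x, y) = legendre_dd ?n x * legendre_dd (2*m) y - legendre_dd (2*m) x * legendre_dd ?n y"
      unfolding cd_poly_linear by (simp add: dd)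
    then show ?thesis using that by (simp add: field_simps)
  qed
  have "continuous_on UNIV Q"
    unfolding Q_def cd_poly_def case_prod_beta
    using continuous_synthetic_div[of "legendre2 (2*m)"] continuous_synthetic_div[of "legendre2 ?n"]
    by (auto simp: case_prod_beta intro!: continuous_intros)
  then have Q2: "continuous_on (II \<times> II) Q" by (rule continuous_on_subset) simp
  have Q3: "K_Pi0 ?n x y = (x - x\<^sup>2) * (y - y\<^sup>2) / (2 * (2 * real m - 1) * (2 * real m) * (2 * real m + 1)) * Q (x, y)"
    if "x \<in> II" "y \<in> II" for x y
  proof -
    have "\<kappa> x = smult ((x - x\<^sup>2) / cd_const m) (r_poly * cd_poly m x)"
      by (rule Pi0_kernel_cd[OF assms]) (rule \<kappa>(1), rule \<kappa>(2))
    then have "K_Pi0 ?n x y = (x - x\<^sup>2) / cd_const m * ((y - y\<^sup>2) * Q (x, y))"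
      by (simp only: K[OF that]) (simp add: Q_def power2_eq_square)
    then show ?thesis by (simp add: cd_const_def)
  qed

  have range: "integral_op (Hhat m) ` L2 = Pi0 ?n"
  proof
    show "Pi0 ?n \<subseteq> integral_op (Hhat m) ` L2"
    proof
      fix f assume "f \<in> Pi0 ?n"
      then obtain p where p: "f = restrict (poly p) II" "Pi0_poly ?n p" unfolding Pi0_eq by auto
      \<comment> \<open>By the reproducing property the operator is the identity on
        \<open>Pi0\<close>.\<close>
      have "integral_op (Hhat m) (poly p) = f"
      proof -
        have "(\<integral>s. poly p s * Hhat m r s \<partial>lebesgue_on II) = poly p r" for r
          using L2_inner_poly[of p "qH r"] rep[OF p(2), of r] by (simp add: L2_inner_def H)
        then show ?thesis by (simp add: integral_op_def p(1) restrict_def)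
      qed
      then show "f \<in> integral_op (Hhat m) ` L2" using poly_L2 by blast
    qed
    show "integral_op (Hhat m) ` L2 \<subseteq> Pi0 ?n"
    proof
      fix f assume "f \<in> integral_op (Hhat m) ` L2"
      then obtain \<phi> where \<phi>: "\<phi> \<in> L2" and f: "f = integral_op (Hhat m) \<phi>" by blast
      \<comment> \<open>By the expansion in r the image of \<phi> is a combination of Lagrange
        polynomials whose coefficients are the pairings of \<phi> with finitely many
        sections.\<close>
      define p where "p = (\<Sum>z\<in>grid ?n. smult (L2_inner \<phi> (poly (qH z))) (lagr_poly (grid ?n) z))"
      have p: "L2_inner \<phi> (poly (qH r)) = poly p r" for r
      proof -
        have "L2_inner \<phi> (poly (qH r)) = (\<integral>s. (\<Sum>z\<in>grid ?n. poly (lagr_poly (grid ?n) z) r * (\<phi> s * poly (qH z) s)) \<partial>lebesgue_on II)"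
          unfolding L2_inner_def by (subst linH) (simp add: poly_sum sum_distrib_left mult_ac)
        also have "\<dots> = (\<Sum>z\<in>grid ?n. poly (lagr_poly (grid ?n) z) r * L2_inner \<phi> (poly (qH z)))"
          unfolding L2_inner_def using L2_mult_integrable[OF \<phi> poly_L2] by simp
        also have "\<dots> = poly p r" by (simp add: p_def poly_sum mult.commute)
        finally show ?thesis .
      qed
      have "degree p \<le> ?n" unfolding p_def
      proof (intro degree_sum_le finite_grid order.trans[OF degree_smult_le])
        fix z assume "z \<in> grid ?n"
        then show "degree (lagr_poly (grid ?n) z) \<le> ?n"
          using degree_lagr[OF finite_grid, of z ?n] by (simp add: card_grid)
      qed
      moreover have "poly p 0 = 0" "poly p 1 = 0" unfolding p[symmetric] by (simp_all add: H01 L2_inner_def)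
      ultimately have "Pi0_poly ?n p" by (simp add: Pi0_poly_def)
      moreover have "f = restrict (poly p) II"
        unfolding f p[symmetric] restrict_def integral_op_def L2_inner_def by (simp add: H fun_eq_iff p[symmetric] L2_inner_def)
      ultimately show "f \<in> Pi0 ?n" unfolding Pi0_eq by blast
    qed
  qed
  have part5: "rkhs_with_kernel II (Pi0 ?n) (range_inner (Hhat m)) (K_Hhat m)"
    unfolding range[symmetric] by (rule range_rkhs[of qH D]) (simp_all add: degH H KH)
  \<comment> \<open>The mixed pairings of sections with their projections all equal
    \<open>poly (\<kappa> x) y\<close>. So the difference of the kernels is the Gram kernel of the
    components of the sections orthogonal to \<open>Pi0\<close>.\<close>
  have part6: "is_reproducing_kernel II (\<lambda>r1 r2. K_Hhat m r1 r2 - K_Pi0 ?n r1 r2)"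
  proof (rule finite_rank_reproducing_kernel[of II "\<lambda>r. qH r - \<kappa> r" "max D ?n"])
    show "degree (qH r - \<kappa> r) \<le> max D ?n" for r
      using degH[of r] \<kappa>(1)[of r] by (intro degree_diff_le) (auto simp: Pi0_poly_def)
    show "K_Hhat m x y - K_Pi0 ?n x y = pint ((qH x - \<kappa> x) * (qH y - \<kappa> y))" if "x \<in> II" "y \<in> II" for x y
    proof -
      have "pint (qH x * \<kappa> y) = poly (\<kappa> x) y"
        using rep[OF \<kappa>(1), of y x] KK[of x y] KK[of y x] by (simp only: mult.commute)
      moreover have "pint (\<kappa> x * qH y) = poly (\<kappa> x) y" by (rule rep[OF \<kappa>(1)])
      moreover have "(qH x - \<kappa> x) * (qH y - \<kappa> y) = qH x * qH y - qH x * \<kappa> y - \<kappa> x * qH y + \<kappa> x * \<kappa> y"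
        by (simp add: algebra_simps)
      ultimately show ?thesis by (simp only: KH K[OF that] pint_diff pint_add KK)
    qed
  qed
  show ?thesis
    by (intro conjI ballI exI[of _ Q] impI part1 part2 Q1 Q2 Q3 range part5 part6)
qed

end
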